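(* Let $R=K[x_1,\dots,x_d]$ with $d\ge 3$ and $\mathfrak{m}=(x_1,\dots,x_d)$. Let $K=\mathbb{R}$ and let $I$ be an ideal of $R$ of codimension $d$ minimally generated by $\nu(\mathfrak{m}^2)-1$ quadrics. If $I$ is a Gorenstein ideal, then, up to change of variables, $I$ is one of the following $d$ ideals: $$I=(x_ix_j,\ x_1^2\pm x_k^2 \mid 1\le i<j\le d,\ k=2,\dots,d).$$ The converse holds for all fields $K$: over any field $K$, every ideal $(x_ix_j,\ x_1^2\pm x_k^2 \mid 1\le i<j\le d,\ k=2,\dots,d)$ of $K[x_1,\dots,x_d]$ is Gorenstein.
   Context: A quadric is a homogeneous polynomial of degree $2$. $\nu(\cdot)$ denotes the minimal number of generators, so $\nu(\mathfrak{m}^2)=\binom{d+1}{2}$. An ideal $I\subset R$ is called Gorenstein if $R/I$ is a Gorenstein ring. A change of variables means an invertible linear change of the variables $x_1,\dots,x_d$ over the base field. In the displayed ideals, a sign $\pm$ is chosen for each $k=2,\dots,d$. *)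

theory Defs
  imports
    "HOL-Algebra.Ideal_Product"
    "HOL-Algebra.Ring_Divisibility"
    "HOL-Library.Poly_Mapping"
    "HOL-Library.Extended_Nat"
begin

section \<open>The polynomial ring in d variables over a field\<close>

text \<open>A monomial is its exponent function, and a polynomial maps monomials to coefficients. The
  variables are indexed by \<open>1, \<dots>, d\<close>; the type itself has countably many variables, the carrier
  selects the polynomials that involve only the first \<open>d\<close> of them.\<close>

type_synonym 'k mpoly = "(nat \<Rightarrow>\<^sub>0 nat) \<Rightarrow>\<^sub>0 'k"

definition poly_ring :: "nat \<Rightarrow> ('k::field) mpoly ring" where
  "poly_ring d =
    \<lparr>carrier = {p. \<forall>m\<in>Poly_Mapping.keys p. Poly_Mapping.keys m \<subseteq> {1..d}},
     monoid.mult = (*), one = 1, zero = 0, add = (+)\<rparr>"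

definition const :: "'k::field \<Rightarrow> 'k mpoly" where
  "const c = Poly_Mapping.single 0 c"

definition var :: "nat \<Rightarrow> ('k::field) mpoly" where
  "var i = Poly_Mapping.single (Poly_Mapping.single i 1) 1"

definition quadric :: "('k::field) mpoly \<Rightarrow> bool" where
  "quadric p \<longleftrightarrow>
    (\<forall>m\<in>Poly_Mapping.keys p. (\<Sum>i\<in>Poly_Mapping.keys m. Poly_Mapping.lookup m i) = 2)"

definition irrelevant_ideal :: "nat \<Rightarrow> ('k::field) mpoly set" where
  "irrelevant_ideal d = Idl\<^bsub>poly_ring d\<^esub> (var ` {1..d})"

text \<open>An invertible linear change of variables, as the automorphism of the polynomial ring that it
  induces. Bijectivity amounts to invertibility of the coefficient matrix.\<close>

definition linear_change :: "nat \<Rightarrow> (('k::field) mpoly \<Rightarrow> 'k mpoly) \<Rightarrow> bool" where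
  "linear_change d \<phi> \<longleftrightarrow>
    \<phi> \<in> ring_iso (poly_ring d) (poly_ring d) \<and>
    (\<forall>c. \<phi> (const c) = const c) \<and>
    (\<exists>a :: nat \<Rightarrow> nat \<Rightarrow> 'k. \<forall>i\<in>{1..d}. \<phi> (var i) = (\<Sum>j\<in>{1..d}. const (a i j) * var j))"

section \<open>Generators and codimension\<close>

definition min_num_gens :: "('a, 'b) ring_scheme \<Rightarrow> 'a set \<Rightarrow> nat" where
  "min_num_gens R J =
    (LEAST n. \<exists>S. S \<subseteq> carrier R \<and> finite S \<and> card S = n \<and> Idl\<^bsub>R\<^esub> S = J)"

definition minimally_generates :: "('a, 'b) ring_scheme \<Rightarrow> 'a set \<Rightarrow> 'a set \<Rightarrow> bool" where
  "minimally_generates R S J \<longleftrightarrow>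
    S \<subseteq> carrier R \<and> Idl\<^bsub>R\<^esub> S = J \<and> (\<forall>T. T \<subset> S \<longrightarrow> Idl\<^bsub>R\<^esub> T \<noteq> J)"

definition prime_height :: "('a, 'b) ring_scheme \<Rightarrow> 'a set \<Rightarrow> enat" where
  "prime_height R P =
    Sup {enat n | n. \<exists>C :: nat \<Rightarrow> 'a set.
      (\<forall>i\<le>n. primeideal (C i) R) \<and> (\<forall>i<n. C i \<subset> C (Suc i)) \<and> C n = P}"

text \<open>The codimension (height) of an ideal. The improper ideal gets the value \<open>\<infinity>\<close>.\<close>

definition codimension :: "('a, 'b) ring_scheme \<Rightarrow> 'a set \<Rightarrow> enat" where
  "codimension R I = Inf (prime_height R ` {P. primeideal P R \<and> I \<subseteq> P})"

section \<open>Localization\<close>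

text \<open>The fraction \<open>a/s\<close>, as the class of all pairs equivalent to \<open>(a, s)\<close>; the set \<open>S\<close> is meant to
  be multiplicatively closed.\<close>

definition fraction :: "('a, 'b) ring_scheme \<Rightarrow> 'a set \<Rightarrow> 'a \<Rightarrow> 'a \<Rightarrow> ('a \<times> 'a) set" where
  "fraction A S a s =
    {(b, t). b \<in> carrier A \<and> t \<in> S \<and>
      (\<exists>u\<in>S. u \<otimes>\<^bsub>A\<^esub> (a \<otimes>\<^bsub>A\<^esub> t) = u \<otimes>\<^bsub>A\<^esub> (b \<otimes>\<^bsub>A\<^esub> s))}"

text \<open>As for \<^const>\<open>rcoset_mult\<close>, the unions range over all representatives, which for
  multiplicatively closed \<open>S\<close> all yield the same class.\<close>

definition localization :: "('a, 'b) ring_scheme \<Rightarrow> 'a set \<Rightarrow> ('a \<times> 'a) set ring" where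
  "localization A S =
    \<lparr>carrier = {fraction A S a s | a s. a \<in> carrier A \<and> s \<in> S},
     monoid.mult = (\<lambda>X Y. \<Union>(a, s)\<in>X. \<Union>(b, t)\<in>Y. fraction A S (a \<otimes>\<^bsub>A\<^esub> b) (s \<otimes>\<^bsub>A\<^esub> t)),
     one = fraction A S \<one>\<^bsub>A\<^esub> \<one>\<^bsub>A\<^esub>,
     zero = fraction A S \<zero>\<^bsub>A\<^esub> \<one>\<^bsub>A\<^esub>,
     add = (\<lambda>X Y. \<Union>(a, s)\<in>X. \<Union>(b, t)\<in>Y.
       fraction A S (a \<otimes>\<^bsub>A\<^esub> t \<oplus>\<^bsub>A\<^esub> b \<otimes>\<^bsub>A\<^esub> s) (s \<otimes>\<^bsub>A\<^esub> t))\<rparr>"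

section \<open>Injective dimension and Gorenstein rings\<close>

definition module_homs ::
    "('a, 'c) ring_scheme \<Rightarrow> ('a, 'm) module \<Rightarrow> ('a, 'n) module \<Rightarrow> ('m \<Rightarrow> 'n) set" where
  "module_homs A M N =
    {f. f \<in> carrier M \<rightarrow> carrier N \<and>
      (\<forall>x\<in>carrier M. \<forall>y\<in>carrier M. f (x \<oplus>\<^bsub>M\<^esub> y) = f x \<oplus>\<^bsub>N\<^esub> f y) \<and>
      (\<forall>a\<in>carrier A. \<forall>x\<in>carrier M. f (a \<odot>\<^bsub>M\<^esub> x) = a \<odot>\<^bsub>N\<^esub> f x)}"

definition self_module :: "('a, 'c) ring_scheme \<Rightarrow> ('a, 'a) module" where
  "self_module A =
    \<lparr>carrier = carrier A, monoid.mult = monoid.mult A, one = one A, zero = zero A,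
     add = add A, smult = monoid.mult A\<rparr>"

text \<open>A definition cannot quantify over types, so the modules below have carriers in the fixed type
  \<open>'a list\<close>, where \<open>'a\<close> is the element type of the ring. This loses nothing. Copies of the ring and of
  all its ideals live in that type, so by Baer's criterion it detects injectivity. Over a noetherian
  ring the terms of a finite minimal injective resolution of the ring are direct sums of injective
  hulls \<open>E(A/P)\<close>, each \<open>P\<close> occurring finitely often, and so have cardinality at most that of \<open>'a list\<close>.\<close>

definition injective_module :: "('a, 'c) ring_scheme \<Rightarrow> ('a, 'e) module \<Rightarrow> bool" where
  "injective_module A E \<longleftrightarrow> module A E \<and>
    (\<forall>(N :: ('a, 'a list) module) L f.
      module A N \<and> submodule L A N \<and> f \<in> module_homs A (N\<lparr>carrier := L\<rparr>) E \<longrightarrow>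
      (\<exists>g\<in>module_homs A N E. \<forall>x\<in>L. g x = f x))"

definition injective_resolution ::
    "('a, 'c) ring_scheme \<Rightarrow> ('a, 'm) module \<Rightarrow> ('m \<Rightarrow> 'e) \<Rightarrow> (nat \<Rightarrow> ('a, 'e) module) \<Rightarrow>
      (nat \<Rightarrow> 'e \<Rightarrow> 'e) \<Rightarrow> bool" where
  "injective_resolution A M \<eta> E \<delta> \<longleftrightarrow>
    (\<forall>i. injective_module A (E i)) \<and>
    \<eta> \<in> module_homs A M (E 0) \<and> inj_on \<eta> (carrier M) \<and>
    (\<forall>i. \<delta> i \<in> module_homs A (E i) (E (Suc i))) \<and>
    \<eta> ` carrier M = a_kernel (E 0) (E 1) (\<delta> 0) \<and>
    (\<forall>i. \<delta> i ` carrier (E i) = a_kernel (E (Suc i)) (E (Suc (Suc i))) (\<delta> (Suc i)))"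

definition finite_injective_dimension ::
    "('a, 'c) ring_scheme \<Rightarrow> ('a, 'm) module \<Rightarrow> bool" where
  "finite_injective_dimension A M \<longleftrightarrow>
    (\<exists>n \<eta> (E :: nat \<Rightarrow> ('a, 'a list) module) \<delta>.
      injective_resolution A M \<eta> E \<delta> \<and> (\<forall>i>n. carrier (E i) = {\<zero>\<^bsub>E i\<^esub>}))"

text \<open>A noetherian commutative ring is Gorenstein if its localization at every maximal ideal has
  finite injective dimension as a module over itself.\<close>

definition gorenstein_ring :: "('a, 'c) ring_scheme \<Rightarrow> bool" where
  "gorenstein_ring A \<longleftrightarrow> cring A \<and> noetherian_ring A \<and>
    (\<forall>P. maximalideal P A \<longrightarrow>
      (let B = localization A (carrier A - P) in finite_injective_dimension B (self_module B)))"

definition gorenstein_ideal :: "('a, 'c) ring_scheme \<Rightarrow> 'a set \<Rightarrow> bool" where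
  "gorenstein_ideal R I \<longleftrightarrow> ideal I R \<and> gorenstein_ring (R Quot I)"

section \<open>The ideals of the classification\<close>

definition sign_choice :: "nat \<Rightarrow> (nat \<Rightarrow> 'k::field) \<Rightarrow> bool" where
  "sign_choice d \<epsilon> \<longleftrightarrow> (\<forall>k\<in>{2..d}. \<epsilon> k \<in> {1, -1})"

definition signed_ideal :: "nat \<Rightarrow> (nat \<Rightarrow> 'k::field) \<Rightarrow> 'k mpoly set" where
  "signed_ideal d \<epsilon> = Idl\<^bsub>poly_ring d\<^esub>
    ({var i * var j | i j. 1 \<le> i \<and> i < j \<and> j \<le> d} \<union>
     {var 1 ^ 2 + const (\<epsilon> k) * var k ^ 2 | k. 2 \<le> k \<and> k \<le> d})"

text \<open>There are \<open>2 ^ (d - 1)\<close> sign choices. Up to permuting the variables with indices \<open>2, \<dots>, d\<close> only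
  the number \<open>m\<close> of minus signs matters; this is how they amount to \<open>d\<close> ideals. The representative
  with \<open>m < d\<close> minus signs puts them on the last \<open>m\<close> variables.\<close>

definition standard_signs :: "nat \<Rightarrow> nat \<Rightarrow> nat \<Rightarrow> 'k::field" where
  "standard_signs d m k = (if k \<le> d - m then 1 else -1)"

end

(*
For the forward direction, let S be the given generators. They are linearly independent quadrics
spanning a hyperplane in the space of all quadrics, so they are the quadrics killed by a functional
L, and L (v * w) is a symmetric bilinear form on linear forms.

If this form is degenerate, some nonzero linear form u has u * m inside I. In the local ring B at
the origin the maximal ideal M then has the residue field K as a direct summand, spanned by u. In a
finite injective resolution of B, dimension shifting turns Ext^i(K, B) into Ext^(i-1)(M, B), which
contains Ext^(i-1)(K, B). So all Ext^i(K, B) with i > 0 vanish, and every homomorphism M -> B is a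
multiplication. The projection of M onto the summand spanned by u is not: it fixes u, so it could
only be multiplication by a unit, but it kills another variable. Hence I is not Gorenstein.

If the form is nondegenerate, an orthonormal basis with squares 1 and -1 gives the change of
variables.

For the converse, the coefficient of x_1^2 in a normal form is a functional on R/I whose trace form is
nondegenerate. It identifies Hom(N, R/I) with the dual space of N for every module N, so R/I is
self-injective, and it is local, hence equal to its only localization.
*)
theory Submission
  imports Defs
begin

section \<open>Modules with carrier in lists and injectivity\<close>

text \<open>Vanishing of Ext is phrased without Ext: every homomorphism from \<open>M\<close> into a
  cosyzygy \<open>Z\<close> is multiplication by an element of \<open>Z\<close>. This property
  passes from each cosyzygy of the injective resolution to the preceding one, starting at the zero
  tail. That \<open>B u\<close> splits off needs a map on the local ring that sees \<open>u\<close>.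
  An ideal generated by quadrics has no terms of degree below two, so the value and the gradient at
  the origin survive in the localization, and a partial derivative that is nonzero on
  \<open>u\<close> provides the map. On quadrics \<open>L\<close> is determined only up to a scalar,
  so only the ratios of the squares of the basis vectors matter. In the quotient the square of the
  k-th variable is minus its sign times the square of the first one; this is why the basis is sorted
  by comparing squares with that of its first vector. The real field enters through square roots and
  through halving in the polarization step. The converse uses of the signs only that their squares
  are 1, so characteristic 2 is covered.\<close>

definition list_module :: "('a, 'c) ring_scheme \<Rightarrow> ('a, 'a list) module" where
  "list_module A =
    \<lparr>carrier = (\<lambda>x. [x]) ` carrier A, monoid.mult = (\<lambda>x y. []), one = [], zero = [\<zero>\<^bsub>A\<^esub>],
     add = (\<lambda>x y. [hd x \<oplus>\<^bsub>A\<^esub> hd y]), smult = (\<lambda>a x. [a \<otimes>\<^bsub>A\<^esub> hd x])\<rparr>"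

lemma list_module_simps [simp]:
  "carrier (list_module A) = (\<lambda>x. [x]) ` carrier A"
  "\<zero>\<^bsub>list_module A\<^esub> = [\<zero>\<^bsub>A\<^esub>]"
  "x \<oplus>\<^bsub>list_module A\<^esub> y = [hd x \<oplus>\<^bsub>A\<^esub> hd y]"
  "a \<odot>\<^bsub>list_module A\<^esub> x = [a \<otimes>\<^bsub>A\<^esub> hd x]"
  by (simp_all add: list_module_def)

lemma self_module_simps [simp]:
  "carrier (self_module A) = carrier A"
  "\<zero>\<^bsub>self_module A\<^esub> = \<zero>\<^bsub>A\<^esub>"
  "x \<oplus>\<^bsub>self_module A\<^esub> y = x \<oplus>\<^bsub>A\<^esub> y"
  "a \<odot>\<^bsub>self_module A\<^esub> x = a \<otimes>\<^bsub>A\<^esub> x"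
  by (simp_all add: self_module_def)

lemma (in cring) abelian_group_list_module: "abelian_group (list_module R)"
proof (rule abelian_groupI)
  fix x assume "x \<in> carrier (list_module R)"
  then obtain a where "a \<in> carrier R" "x = [a]" by auto
  then show "\<exists>y\<in>carrier (list_module R). y \<oplus>\<^bsub>list_module R\<^esub> x = \<zero>\<^bsub>list_module R\<^esub>"
    by (intro bexI[of _ "[\<ominus> a]"]) (auto simp: l_neg)
qed (auto simp: a_ac)

lemma (in cring) module_list_module: "module R (list_module R)"
  by (rule moduleI[OF is_cring abelian_group_list_module]) (auto simp: l_distr r_distr m_assoc)

lemma (in cring) module_self_module: "module R (self_module R)"
proof (rule moduleI[OF is_cring])
  show "abelian_group (self_module R)"
  proof (rule abelian_groupI)
    fix x assume "x \<in> carrier (self_module R)"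
    then show "\<exists>y\<in>carrier (self_module R). y \<oplus>\<^bsub>self_module R\<^esub> x = \<zero>\<^bsub>self_module R\<^esub>"
      by (intro bexI[of _ "\<ominus> x"]) (auto simp: l_neg)
  qed (simp_all add: a_ac)
qed (simp_all add: l_distr r_distr m_assoc)

text \<open>Injectivity is tested only on modules of lists, so an ideal enters the test through its
  singleton lists.\<close>

lemma (in cring) submodule_list_module:
  assumes "ideal J R"
  shows "submodule ((\<lambda>x. [x]) ` J) R (list_module R)"
proof -
  interpret J: ideal J R by fact
  interpret L: module R "list_module R" by (rule module_list_module)
  have inv: "\<ominus>\<^bsub>list_module R\<^esub> [x] = [\<ominus> x]" if "x \<in> carrier R" for x
    by (rule L.minus_equality) (use that in \<open>auto simp: l_neg\<close>)
  show ?thesis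
    by (rule L.submoduleI) (auto simp: inv J.Icarr J.I_l_closed J.a_inv_closed J.zero_closed)
qed

text \<open>\<open>hom_eval B M N Z\<close> says \<open>Ext\<^sup>1(B/M, Z) = 0\<close> for a submodule \<open>Z\<close> of \<open>N\<close>.\<close>

definition hom_eval :: "('a, 'c) ring_scheme \<Rightarrow> 'a set \<Rightarrow> ('a, 'n) module \<Rightarrow> 'n set \<Rightarrow> bool" where
  "hom_eval B M N Z \<longleftrightarrow>
    (\<forall>f. f ` M \<subseteq> Z \<and> f \<in> module_homs B (self_module B\<lparr>carrier := M\<rparr>) N \<longrightarrow>
      (\<exists>z\<in>Z. \<forall>a\<in>M. f a = a \<odot>\<^bsub>N\<^esub> z))"

lemma hom_from_ideal_iff:
  "f \<in> module_homs B (self_module B\<lparr>carrier := M\<rparr>) N \<longleftrightarrow>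
    (\<forall>x\<in>M. f x \<in> carrier N) \<and>
    (\<forall>x\<in>M. \<forall>y\<in>M. f (x \<oplus>\<^bsub>B\<^esub> y) = f x \<oplus>\<^bsub>N\<^esub> f y) \<and>
    (\<forall>a\<in>carrier B. \<forall>x\<in>M. f (a \<otimes>\<^bsub>B\<^esub> x) = a \<odot>\<^bsub>N\<^esub> f x)"
  by (auto simp: module_homs_def self_module_def)

text \<open>The easy half of Baer's criterion: the homomorphism extends from \<open>M\<close> to the
  whole ring and is then multiplication by the image of 1.\<close>

lemma injective_module_hom_from_ideal:
  assumes inj: "injective_module B E" and M: "ideal M B"
    and f: "f \<in> module_homs B (self_module B\<lparr>carrier := M\<rparr>) E"
  obtains e where "e \<in> carrier E" "\<And>a. a \<in> M \<Longrightarrow> f a = a \<odot>\<^bsub>E\<^esub> e"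
proof -
  interpret E: module B E using inj by (simp add: injective_module_def)
  interpret M: ideal M B by fact
  let ?L = "(\<lambda>x. [x]) ` M"
  have "f \<circ> hd \<in> module_homs B (list_module B\<lparr>carrier := ?L\<rparr>) E"
    using f unfolding hom_from_ideal_iff by (auto simp: module_homs_def)
  then obtain g where g: "g \<in> module_homs B (list_module B) E" "\<forall>x\<in>?L. g x = (f \<circ> hd) x"
    using inj E.module_list_module E.submodule_list_module[OF M]
    unfolding injective_module_def by blast
  have "g [\<one>\<^bsub>B\<^esub>] \<in> carrier E" using g(1) by (auto simp: module_homs_def)
  moreover have "f a = a \<odot>\<^bsub>E\<^esub> g [\<one>\<^bsub>B\<^esub>]" if a: "a \<in> M" for a
  proof -
    have "g (a \<odot>\<^bsub>list_module B\<^esub> [\<one>\<^bsub>B\<^esub>]) = a \<odot>\<^bsub>E\<^esub> g [\<one>\<^bsub>B\<^esub>]"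
      using g(1) M.Icarr[OF a] unfolding module_homs_def by (auto simp del: list_module_simps(3,4))
    then show ?thesis using g(2) a M.Icarr[OF a] by auto
  qed
  ultimately show ?thesis by (rule that)
qed

text \<open>The function \<open>c\<close> realises the residue field as a direct summand \<open>B u\<close> of the ideal \<open>M\<close>: an
  element \<open>a\<close> of \<open>M\<close> has the component \<open>c a \<otimes> u\<close> there.\<close>

locale residue_summand = cring B for B :: "('a, 'c) ring_scheme" (structure) +
  fixes M :: "'a set" and u :: 'a and c :: "'a \<Rightarrow> 'a"
  assumes M: "ideal M B"
    and u: "u \<in> M"
    and u_annihilates: "a \<in> M \<Longrightarrow> a \<otimes> u = \<zero>"
    and c_closed: "a \<in> M \<Longrightarrow> c a \<in> carrier B"
    and c_add: "a \<in> M \<Longrightarrow> b \<in> M \<Longrightarrow> c (a \<oplus> b) \<ominus> (c a \<oplus> c b) \<in> M"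
    and c_mult: "a \<in> carrier B \<Longrightarrow> b \<in> M \<Longrightarrow> c (a \<otimes> b) \<ominus> a \<otimes> c b \<in> M"
    and c_u: "c u \<ominus> \<one> \<in> M"
begin

sublocale M: ideal M B by (rule M)

text \<open>The function \<open>c\<close> is additive and linear only modulo \<open>M\<close>. On an
  element killed by \<open>M\<close> such congruences become equations.\<close>

lemma smult_cong_mod:
  assumes "module B N" "z \<in> carrier N" "\<And>a. a \<in> M \<Longrightarrow> a \<odot>\<^bsub>N\<^esub> z = \<zero>\<^bsub>N\<^esub>"
    and "a \<in> carrier B" "b \<in> carrier B" "a \<ominus> b \<in> M"
  shows "a \<odot>\<^bsub>N\<^esub> z = b \<odot>\<^bsub>N\<^esub> z"
proof -
  interpret N: module B N by fact
  have "a = b \<oplus> (a \<ominus> b)" using assms(4,5) by algebra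
  then have "a \<odot>\<^bsub>N\<^esub> z = b \<odot>\<^bsub>N\<^esub> z \<oplus>\<^bsub>N\<^esub> (a \<ominus> b) \<odot>\<^bsub>N\<^esub> z"
    using assms N.smult_l_distr[of b "a \<ominus> b" z] by auto
  then show ?thesis using assms by simp
qed

text \<open>This is the projection of \<open>M\<close> onto the summand \<open>B u\<close> followed
  by the map sending \<open>u\<close> to \<open>z\<close>, which makes sense because
  \<open>M\<close> kills \<open>z\<close>.\<close>

lemma component_hom:
  assumes N: "module B N" and z: "z \<in> carrier N"
    and ann: "\<And>a. a \<in> M \<Longrightarrow> a \<odot>\<^bsub>N\<^esub> z = \<zero>\<^bsub>N\<^esub>"
  shows "(\<lambda>a. c a \<odot>\<^bsub>N\<^esub> z) \<in> module_homs B (self_module B\<lparr>carrier := M\<rparr>) N"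
    and "c u \<odot>\<^bsub>N\<^esub> z = z"
proof -
  interpret N: module B N by fact
  have cong: "a \<odot>\<^bsub>N\<^esub> z = b \<odot>\<^bsub>N\<^esub> z" if "a \<ominus> b \<in> M" "a \<in> carrier B" "b \<in> carrier B" for a b
    using smult_cong_mod[OF N z ann] that by blast
  have "c (a \<oplus> b) \<odot>\<^bsub>N\<^esub> z = c a \<odot>\<^bsub>N\<^esub> z \<oplus>\<^bsub>N\<^esub> c b \<odot>\<^bsub>N\<^esub> z" if "a \<in> M" "b \<in> M" for a b
    using cong[OF c_add[OF that]] that z
    by (simp add: c_closed N.smult_l_distr M.a_closed)
  moreover have "c (a \<otimes> b) \<odot>\<^bsub>N\<^esub> z = a \<odot>\<^bsub>N\<^esub> (c b \<odot>\<^bsub>N\<^esub> z)" if "a \<in> carrier B" "b \<in> M" for a b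
    using cong[OF c_mult[OF that]] that z
    by (simp add: c_closed N.smult_assoc1 M.I_l_closed)
  ultimately show "(\<lambda>a. c a \<odot>\<^bsub>N\<^esub> z) \<in> module_homs B (self_module B\<lparr>carrier := M\<rparr>) N"
    unfolding hom_from_ideal_iff using z by (auto simp: c_closed)
  show "c u \<odot>\<^bsub>N\<^esub> z = z" using cong[OF c_u] u z by (simp add: c_closed)
qed

text \<open>Since \<open>E\<close> is injective, the obstruction for \<open>Z\<close> is an element of \<open>E'\<close> killed by \<open>M\<close>. Mapping
  the summand \<open>B u\<close> onto that element shows that it is divisible by \<open>u\<close>, hence removable.\<close>

lemma hom_eval_descend:
  assumes inj: "injective_module B E" and E': "module B E'"
    and \<delta>: "\<delta> \<in> module_homs B E E'"
    and surj: "\<delta> ` carrier E = Z'"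
    and eval: "hom_eval B M E' Z'"
  shows "hom_eval B M E (a_kernel E E' \<delta>)"
  unfolding hom_eval_def
proof (intro allI impI, elim conjE)
  fix f assume fZ: "f ` M \<subseteq> a_kernel E E' \<delta>"
    and f: "f \<in> module_homs B (self_module B\<lparr>carrier := M\<rparr>) E"
  interpret E: module B E using inj by (simp add: injective_module_def)
  interpret E': module B E' by fact
  have \<delta>_closed: "\<delta> x \<in> carrier E'" if "x \<in> carrier E" for x
    using \<delta> that by (auto simp: module_homs_def)
  have \<delta>_smult: "\<delta> (a \<odot>\<^bsub>E\<^esub> x) = a \<odot>\<^bsub>E'\<^esub> \<delta> x" if "x \<in> carrier E" "a \<in> carrier B" for a x
    using \<delta> that by (auto simp: module_homs_def)
  have \<delta>_add: "\<delta> (x \<oplus>\<^bsub>E\<^esub> y) = \<delta> x \<oplus>\<^bsub>E'\<^esub> \<delta> y" if "x \<in> carrier E" "y \<in> carrier E" for x y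
    using \<delta> that by (auto simp: module_homs_def)
  obtain e where e: "e \<in> carrier E" "\<And>a. a \<in> M \<Longrightarrow> f a = a \<odot>\<^bsub>E\<^esub> e"
    using injective_module_hom_from_ideal[OF inj M f] by blast
  have ann: "a \<odot>\<^bsub>E'\<^esub> \<delta> e = \<zero>\<^bsub>E'\<^esub>" if "a \<in> M" for a
    using fZ that e \<delta>_smult[OF e(1) M.Icarr[OF that]] by (auto simp: a_kernel_def')
  let ?g = "\<lambda>a. c a \<odot>\<^bsub>E'\<^esub> \<delta> e"
  note g = component_hom[OF E' \<delta>_closed[OF e(1)] ann]
  have "?g ` M \<subseteq> Z'"
  proof
    fix x assume "x \<in> ?g ` M"
    then obtain a where a: "a \<in> M" "x = c a \<odot>\<^bsub>E'\<^esub> \<delta> e" by auto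
    then have "x = \<delta> (c a \<odot>\<^bsub>E\<^esub> e)" using e by (simp add: \<delta>_smult c_closed)
    then show "x \<in> Z'" using surj e a c_closed by blast
  qed
  then have "\<exists>w\<in>Z'. \<forall>a\<in>M. ?g a = a \<odot>\<^bsub>E'\<^esub> w"
    using eval[unfolded hom_eval_def, rule_format, of ?g] g(1) by simp
  then obtain w where w: "w \<in> Z'" "\<forall>a\<in>M. ?g a = a \<odot>\<^bsub>E'\<^esub> w" ..
  from w(1) obtain e' where e': "e' \<in> carrier E" "w = \<delta> e'" unfolding surj[symmetric] by blast
  have uc: "u \<in> carrier B" using u M.Icarr by auto
  \<comment> \<open>Since \<open>\<delta> e = u w\<close> with \<open>w = \<delta> e'\<close>,
    subtracting \<open>u e'\<close> moves \<open>e\<close> into the kernel. Products with elements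
    of \<open>M\<close> do not change, because these annihilate \<open>u\<close>.\<close>
  let ?z = "e \<oplus>\<^bsub>E\<^esub> (\<ominus> u) \<odot>\<^bsub>E\<^esub> e'"
  have "\<delta> e = u \<odot>\<^bsub>E'\<^esub> \<delta> e'" using g(2) bspec[OF w(2) u] e' by simp
  then have "\<delta> ?z = u \<odot>\<^bsub>E'\<^esub> \<delta> e' \<oplus>\<^bsub>E'\<^esub> (\<ominus> u) \<odot>\<^bsub>E'\<^esub> \<delta> e'"
    using e e' uc by (simp add: \<delta>_add \<delta>_smult)
  also have "\<dots> = (u \<oplus> \<ominus> u) \<odot>\<^bsub>E'\<^esub> \<delta> e'"
    using uc \<delta>_closed[OF e'(1)] by (subst E'.smult_l_distr) auto
  also have "\<dots> = \<zero>\<^bsub>E'\<^esub>" using uc \<delta>_closed[OF e'(1)] by (simp add: r_neg)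
  finally have "?z \<in> a_kernel E E' \<delta>" using e e' uc by (simp add: a_kernel_def')
  moreover have "f a = a \<odot>\<^bsub>E\<^esub> ?z" if a: "a \<in> M" for a
  proof -
    have ac: "a \<in> carrier B" using a M.Icarr by auto
    have "a \<otimes> (\<ominus> u) = \<zero>" using u_annihilates[OF a] ac uc by (simp add: r_minus)
    then have "a \<odot>\<^bsub>E\<^esub> ((\<ominus> u) \<odot>\<^bsub>E\<^esub> e') = \<zero>\<^bsub>E\<^esub>"
      using E.smult_assoc1[of a "\<ominus> u" e'] ac uc e' by simp
    then show ?thesis using e a ac uc e' by (simp add: E.smult_r_distr)
  qed
  ultimately show "\<exists>z\<in>a_kernel E E' \<delta>. \<forall>a\<in>M. f a = a \<odot>\<^bsub>E\<^esub> z" by blast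
qed

text \<open>Dimension shifting: the property is trivial on the zero tail, descends one kernel of the
  resolution at a time, and reaches the kernel in degree 0, which is the image of \<open>B\<close>
  under \<open>\<eta>\<close>.\<close>

lemma hom_eval_self:
  assumes "finite_injective_dimension B (self_module B)"
  shows "hom_eval B M (self_module B) (carrier B)"
proof -
  obtain n \<eta> and E :: "nat \<Rightarrow> ('a, 'a list) module" and \<delta> where
    res: "injective_resolution B (self_module B) \<eta> E \<delta>"
    and triv: "\<And>i. i > n \<Longrightarrow> carrier (E i) = {\<zero>\<^bsub>E i\<^esub>}"
    using assms unfolding finite_injective_dimension_def by blast
  have inj: "injective_module B (E i)" for i
    using res by (simp add: injective_resolution_def)
  have mod: "module B (E i)" for i
    using inj by (simp add: injective_module_def)
  have \<delta>: "\<delta> i \<in> module_homs B (E i) (E (Suc i))"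
    and ex: "\<delta> i ` carrier (E i) = a_kernel (E (Suc i)) (E (Suc (Suc i))) (\<delta> (Suc i))" for i
    using res by (simp_all add: injective_resolution_def)
  have \<eta>: "\<eta> \<in> module_homs B (self_module B) (E 0)" "inj_on \<eta> (carrier B)"
    "\<eta> ` carrier B = a_kernel (E 0) (E 1) (\<delta> 0)"
    using res by (simp_all add: injective_resolution_def)
  \<comment> \<open>The induction runs downwards from \<open>Suc n\<close>, the first index at which
    \<open>triv\<close> makes the term zero.\<close>
  have "hom_eval B M (E i) (a_kernel (E i) (E (Suc i)) (\<delta> i))" if "i \<le> Suc n" for i
    using that
  proof (induction rule: inc_induct)
    case base
    interpret E: module B "E (Suc n)" by (rule mod)
    have "\<zero>\<^bsub>E (Suc n)\<^esub> \<in> \<delta> n ` carrier (E n)"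
    proof -
      interpret En: module B "E n" by (rule mod)
      have "\<delta> n \<zero>\<^bsub>E n\<^esub> \<in> carrier (E (Suc n))" using \<delta>[of n] by (auto simp: module_homs_def)
      then show ?thesis using triv[of "Suc n"] En.zero_closed by (metis image_eqI lessI singletonD)
    qed
    then have K: "a_kernel (E (Suc n)) (E (Suc (Suc n))) (\<delta> (Suc n)) = {\<zero>\<^bsub>E (Suc n)\<^esub>}"
      using triv[of "Suc n"] unfolding ex by (auto simp: a_kernel_def')
    show ?case unfolding K hom_eval_def
    proof (intro allI impI, elim conjE)
      fix f :: "'a \<Rightarrow> 'a list" assume "f ` M \<subseteq> {\<zero>\<^bsub>E (Suc n)\<^esub>}"
      then have "f a = a \<odot>\<^bsub>E (Suc n)\<^esub> \<zero>\<^bsub>E (Suc n)\<^esub>" if "a \<in> M" for a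
        using that M.Icarr[OF that] by auto
      then show "\<exists>z\<in>{\<zero>\<^bsub>E (Suc n)\<^esub>}. \<forall>a\<in>M. f a = a \<odot>\<^bsub>E (Suc n)\<^esub> z" by blast
    qed
  next
    case (step i)
    then show ?case using hom_eval_descend[OF inj mod \<delta> ex] by blast
  qed
  then have ev: "hom_eval B M (E 0) (\<eta> ` carrier B)" using \<eta>(3) by auto
  show ?thesis unfolding hom_eval_def
  proof (intro allI impI, elim conjE)
    fix f assume fM: "f ` M \<subseteq> carrier B"
      and f: "f \<in> module_homs B (self_module B\<lparr>carrier := M\<rparr>) (self_module B)"
    have hom: "\<eta> (x \<oplus> y) = \<eta> x \<oplus>\<^bsub>E 0\<^esub> \<eta> y" "\<eta> (x \<otimes> y) = x \<odot>\<^bsub>E 0\<^esub> \<eta> y"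
      if "x \<in> carrier B" "y \<in> carrier B" for x y
      using \<eta>(1) that unfolding module_homs_def by auto
    have closed: "\<eta> x \<in> carrier (E 0)" if "x \<in> carrier B" for x
      using \<eta>(1) that unfolding module_homs_def by auto
    have fc: "f x \<in> carrier B" if "x \<in> M" for x using fM that by auto
    have "(\<lambda>x. \<eta> (f x)) \<in> module_homs B (self_module B\<lparr>carrier := M\<rparr>) (E 0)"
      using f unfolding hom_from_ideal_iff by (simp add: hom closed fc)
    moreover have "(\<lambda>x. \<eta> (f x)) ` M \<subseteq> \<eta> ` carrier B" using fc by blast
    ultimately have "\<exists>w\<in>\<eta> ` carrier B. \<forall>a\<in>M. \<eta> (f a) = a \<odot>\<^bsub>E 0\<^esub> w"
      using ev[unfolded hom_eval_def, rule_format, of "\<lambda>x. \<eta> (f x)"] by simp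
    then obtain z where z: "z \<in> carrier B" "\<forall>a\<in>M. \<eta> (f a) = a \<odot>\<^bsub>E 0\<^esub> \<eta> z" by blast
    have "f a = a \<otimes> z" if a: "a \<in> M" for a
    proof (rule inj_onD[OF \<eta>(2)])
      show "\<eta> (f a) = \<eta> (a \<otimes> z)" using z a M.Icarr[OF a] by (simp add: hom)
    qed (use a z fc M.Icarr in auto)
    then show "\<exists>z\<in>carrier B. \<forall>a\<in>M. f a = a \<odot>\<^bsub>self_module B\<^esub> z" using z(1) by auto
  qed
qed

text \<open>The projection of \<open>M\<close> onto its summand \<open>B u\<close> would be multiplication by a unit, so it would
  not kill \<open>y\<close>.\<close>

lemma infinite_injective_dimension:
  assumes units: "carrier B - M \<subseteq> Units B"
    and u0: "u \<noteq> \<zero>" and y: "y \<in> M" "c y \<in> M" "y \<noteq> \<zero>"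
  shows "\<not> finite_injective_dimension B (self_module B)"
proof
  assume fin: "finite_injective_dimension B (self_module B)"
  have uc: "u \<in> carrier B" using u M.Icarr by auto
  have yc: "y \<in> carrier B" using y M.Icarr by auto
  have mod: "module B (self_module B)" by (rule module_self_module)
  note g = component_hom[OF mod, of u]
  have g1: "(\<lambda>a. c a \<otimes> u) \<in> module_homs B (self_module B\<lparr>carrier := M\<rparr>) (self_module B)"
    and g2: "c u \<otimes> u = u"
    using g uc u_annihilates by auto
  have "(\<lambda>a. c a \<otimes> u) ` M \<subseteq> carrier B" using c_closed uc by auto
  then have "\<exists>a\<in>carrier B. \<forall>x\<in>M. c x \<otimes> u = x \<otimes> a"
    using hom_eval_self[OF fin, unfolded hom_eval_def, rule_format, of "\<lambda>a. c a \<otimes> u"] g1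
    by simp
  then obtain a where a: "a \<in> carrier B" "\<forall>x\<in>M. c x \<otimes> u = x \<otimes> a" ..
  have "u = u \<otimes> a" using bspec[OF a(2) u] g2 by simp
  then have "a \<notin> M" using u0 u_annihilates[of a] uc a(1) by (auto simp: m_comm)
  then have aU: "a \<in> Units B" using units a by auto
  have "y \<otimes> a = \<zero>" using bspec[OF a(2) y(1)] u_annihilates[OF y(2)] by simp
  then have "y = \<zero>"
    using aU yc by (metis Units_closed Units_inv_closed Units_r_inv l_null m_assoc r_one)
  then show False using y by simp
qed

end

section \<open>Localization\<close>

locale multiplicative_set = cring R for R :: "('a, 'b) ring_scheme" (structure) +
  fixes S :: "'a set"
  assumes S_subset: "S \<subseteq> carrier R"
    and one_S: "\<one> \<in> S"
    and mult_S: "s \<in> S \<Longrightarrow> t \<in> S \<Longrightarrow> s \<otimes> t \<in> S"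
begin

lemma S_carrier [simp]: "s \<in> S \<Longrightarrow> s \<in> carrier R"
  using S_subset by blast

declare one_S [simp] mult_S [simp]

lemma mem_fraction_iff:
  "(b, t) \<in> fraction R S a s \<longleftrightarrow>
    b \<in> carrier R \<and> t \<in> S \<and> (\<exists>u\<in>S. u \<otimes> (a \<otimes> t) = u \<otimes> (b \<otimes> s))"
  by (simp add: fraction_def)

text \<open>The middle denominator \<open>t\<close> has to be part of the witness
  \<open>u v t\<close>, because it can be cancelled only up to a factor from
  \<open>S\<close>.\<close>

lemma fraction_trans:
  assumes "a \<in> carrier R" "b \<in> carrier R" "c \<in> carrier R" "s \<in> S" "t \<in> S" "r \<in> S"
    and "\<exists>u\<in>S. u \<otimes> (a \<otimes> t) = u \<otimes> (b \<otimes> s)" "\<exists>u\<in>S. u \<otimes> (b \<otimes> r) = u \<otimes> (c \<otimes> t)"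
  shows "\<exists>u\<in>S. u \<otimes> (a \<otimes> r) = u \<otimes> (c \<otimes> s)"
proof -
  obtain u v where uv: "u \<in> S" "v \<in> S"
    and e: "u \<otimes> (a \<otimes> t) = u \<otimes> (b \<otimes> s)" "v \<otimes> (b \<otimes> r) = v \<otimes> (c \<otimes> t)"
    using assms by blast
  note car = assms(1-3) S_carrier[OF assms(4)] S_carrier[OF assms(5)] S_carrier[OF assms(6)]
    S_carrier[OF uv(1)] S_carrier[OF uv(2)]
  have "u \<otimes> v \<otimes> t \<otimes> (a \<otimes> r) = v \<otimes> r \<otimes> (u \<otimes> (a \<otimes> t))" using car by algebra
  also have "\<dots> = u \<otimes> s \<otimes> (v \<otimes> (b \<otimes> r))" unfolding e(1) using car by algebra
  also have "\<dots> = u \<otimes> v \<otimes> t \<otimes> (c \<otimes> s)" unfolding e(2) using car by algebra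
  finally show ?thesis using uv assms by (intro bexI[of _ "u \<otimes> v \<otimes> t"]) auto
qed

lemma fraction_eq_iff:
  assumes "a \<in> carrier R" "b \<in> carrier R" "s \<in> S" "t \<in> S"
  shows "fraction R S a s = fraction R S b t \<longleftrightarrow> (\<exists>u\<in>S. u \<otimes> (a \<otimes> t) = u \<otimes> (b \<otimes> s))"
    (is "_ \<longleftrightarrow> ?r")
proof
  assume "fraction R S a s = fraction R S b t"
  moreover have "(b, t) \<in> fraction R S b t" using assms by (auto simp: mem_fraction_iff)
  ultimately have "(b, t) \<in> fraction R S a s" by simp
  then show ?r by (simp add: mem_fraction_iff)
next
  assume r: ?r
  then have r': "\<exists>u\<in>S. u \<otimes> (b \<otimes> s) = u \<otimes> (a \<otimes> t)" by metis
  have "(c, q) \<in> fraction R S a s \<longleftrightarrow> (c, q) \<in> fraction R S b t" for c q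
    unfolding mem_fraction_iff using fraction_trans[OF assms(2,1) _ assms(4,3) _ r', of c q]
      fraction_trans[OF assms(1,2) _ assms(3,4) _ r, of c q] by blast
  then show "fraction R S a s = fraction R S b t" by auto
qed

lemma fraction_eqI:
  assumes "a \<in> carrier R" "b \<in> carrier R" "s \<in> S" "t \<in> S" "u \<in> S"
    and "u \<otimes> (a \<otimes> t) = u \<otimes> (b \<otimes> s)"
  shows "fraction R S a s = fraction R S b t"
  using assms fraction_eq_iff by blast

lemma self_mem_fraction: "a \<in> carrier R \<Longrightarrow> s \<in> S \<Longrightarrow> (a, s) \<in> fraction R S a s"
  by (auto simp: mem_fraction_iff)

text \<open>The union over all representatives collapses: every pair of representatives yields the
  same class, and the index sets are nonempty.\<close>

lemma mult_localization:
  assumes a: "a \<in> carrier R" and b: "b \<in> carrier R" and s: "s \<in> S" and t: "t \<in> S"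
  shows "fraction R S a s \<otimes>\<^bsub>localization R S\<^esub> fraction R S b t = fraction R S (a \<otimes> b) (s \<otimes> t)"
proof -
  have *: "fraction R S (a' \<otimes> b') (s' \<otimes> t') = fraction R S (a \<otimes> b) (s \<otimes> t)"
    if "(a', s') \<in> fraction R S a s" "(b', t') \<in> fraction R S b t" for a' b' s' t'
  proof -
    from that obtain u v where *: "u \<in> S" "v \<in> S" "a' \<in> carrier R" "b' \<in> carrier R" "s' \<in> S" "t' \<in> S"
      and e: "u \<otimes> (a \<otimes> s') = u \<otimes> (a' \<otimes> s)" "v \<otimes> (b \<otimes> t') = v \<otimes> (b' \<otimes> t)"
      unfolding mem_fraction_iff by blast
    note car = *(3,4) a b S_carrier[OF *(1)] S_carrier[OF *(2)] S_carrier[OF *(5)]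
      S_carrier[OF *(6)] S_carrier[OF s] S_carrier[OF t]
    have "u \<otimes> v \<otimes> ((a' \<otimes> b') \<otimes> (s \<otimes> t)) = (u \<otimes> (a' \<otimes> s)) \<otimes> (v \<otimes> (b' \<otimes> t))" using car by algebra
    also have "\<dots> = (u \<otimes> (a \<otimes> s')) \<otimes> (v \<otimes> (b \<otimes> t'))" by (simp only: e)
    also have "\<dots> = u \<otimes> v \<otimes> ((a \<otimes> b) \<otimes> (s' \<otimes> t'))" using car by algebra
    finally show ?thesis using * car s t by (intro fraction_eqI[of _ _ _ _ "u \<otimes> v"]) auto
  qed
  have "fraction R S a s \<otimes>\<^bsub>localization R S\<^esub> fraction R S b t =
      (\<Union>(a', s')\<in>fraction R S a s. \<Union>(b', t')\<in>fraction R S b t. fraction R S (a' \<otimes> b') (s' \<otimes> t'))"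
    by (simp add: localization_def)
  also have "\<dots> = (\<Union>p\<in>fraction R S a s. \<Union>q\<in>fraction R S b t. fraction R S (a \<otimes> b) (s \<otimes> t))"
    using * by (intro SUP_cong) auto
  also have "\<dots> = fraction R S (a \<otimes> b) (s \<otimes> t)"
    using self_mem_fraction[OF a s] self_mem_fraction[OF b t] by blast
  finally show ?thesis .
qed

lemma add_localization:
  assumes a: "a \<in> carrier R" and b: "b \<in> carrier R" and s: "s \<in> S" and t: "t \<in> S"
  shows "fraction R S a s \<oplus>\<^bsub>localization R S\<^esub> fraction R S b t =
    fraction R S (a \<otimes> t \<oplus> b \<otimes> s) (s \<otimes> t)"
proof -
  have *: "fraction R S (a' \<otimes> t' \<oplus> b' \<otimes> s') (s' \<otimes> t') = fraction R S (a \<otimes> t \<oplus> b \<otimes> s) (s \<otimes> t)"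
    if "(a', s') \<in> fraction R S a s" "(b', t') \<in> fraction R S b t" for a' b' s' t'
  proof -
    from that obtain u v where *: "u \<in> S" "v \<in> S" "a' \<in> carrier R" "b' \<in> carrier R" "s' \<in> S" "t' \<in> S"
      and e: "u \<otimes> (a \<otimes> s') = u \<otimes> (a' \<otimes> s)" "v \<otimes> (b \<otimes> t') = v \<otimes> (b' \<otimes> t)"
      unfolding mem_fraction_iff by blast
    note car = *(3,4) a b S_carrier[OF *(1)] S_carrier[OF *(2)] S_carrier[OF *(5)]
      S_carrier[OF *(6)] S_carrier[OF s] S_carrier[OF t]
    have "u \<otimes> v \<otimes> ((a' \<otimes> t' \<oplus> b' \<otimes> s') \<otimes> (s \<otimes> t)) =
        (u \<otimes> (a' \<otimes> s)) \<otimes> (v \<otimes> (t \<otimes> t')) \<oplus> (v \<otimes> (b' \<otimes> t)) \<otimes> (u \<otimes> (s \<otimes> s'))"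
      using car by algebra
    also have "\<dots> = (u \<otimes> (a \<otimes> s')) \<otimes> (v \<otimes> (t \<otimes> t')) \<oplus> (v \<otimes> (b \<otimes> t')) \<otimes> (u \<otimes> (s \<otimes> s'))"
      by (simp only: e)
    also have "\<dots> = u \<otimes> v \<otimes> ((a \<otimes> t \<oplus> b \<otimes> s) \<otimes> (s' \<otimes> t'))" using car by algebra
    finally show ?thesis using * car s t by (intro fraction_eqI[of _ _ _ _ "u \<otimes> v"]) auto
  qed
  have "fraction R S a s \<oplus>\<^bsub>localization R S\<^esub> fraction R S b t =
      (\<Union>(a', s')\<in>fraction R S a s. \<Union>(b', t')\<in>fraction R S b t. fraction R S (a' \<otimes> t' \<oplus> b' \<otimes> s') (s' \<otimes> t'))"
    by (simp add: localization_def)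
  also have "\<dots> = (\<Union>p\<in>fraction R S a s. \<Union>q\<in>fraction R S b t. fraction R S (a \<otimes> t \<oplus> b \<otimes> s) (s \<otimes> t))"
    using * by (intro SUP_cong) auto
  also have "\<dots> = fraction R S (a \<otimes> t \<oplus> b \<otimes> s) (s \<otimes> t)"
    using self_mem_fraction[OF a s] self_mem_fraction[OF b t] by blast
  finally show ?thesis .
qed

lemma localization_carrier:
  "carrier (localization R S) = {fraction R S a s | a s. a \<in> carrier R \<and> s \<in> S}"
  by (simp add: localization_def)

lemma localization_one: "\<one>\<^bsub>localization R S\<^esub> = fraction R S \<one> \<one>"
  by (simp add: localization_def)

lemma localization_zero: "\<zero>\<^bsub>localization R S\<^esub> = fraction R S \<zero> \<one>"
  by (simp add: localization_def)

lemma fraction_hom: "(\<lambda>a. fraction R S a \<one>) \<in> ring_hom R (localization R S)"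
proof (rule ring_hom_memI)
  show "fraction R S a \<one> \<in> carrier (localization R S)" if "a \<in> carrier R" for a
    unfolding localization_carrier using that one_S by blast
qed (auto simp: localization_one mult_localization add_localization)

lemma fraction_inverse:
  assumes "s \<in> S"
  shows "fraction R S s \<one> \<otimes>\<^bsub>localization R S\<^esub> fraction R S \<one> s = \<one>\<^bsub>localization R S\<^esub>"
  using assms by (simp add: mult_localization localization_one fraction_eqI[where u = \<one>])

lemma fraction_mult_denominator:
  assumes "a \<in> carrier R" "s \<in> S"
  shows "fraction R S a s \<otimes>\<^bsub>localization R S\<^esub> fraction R S s \<one> = fraction R S a \<one>"
  using assms by (simp add: mult_localization) (rule fraction_eqI[where u = \<one>], auto)

lemma fraction_eq_zero_iff:
  assumes "a \<in> carrier R"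
  shows "fraction R S a \<one> = \<zero>\<^bsub>localization R S\<^esub> \<longleftrightarrow> (\<exists>u\<in>S. u \<otimes> a = \<zero>)"
  using assms by (simp add: localization_zero fraction_eq_iff)

lemma localization_at_units:
  assumes "S \<subseteq> Units R"
  shows "(\<lambda>a. fraction R S a \<one>) \<in> ring_iso R (localization R S)" and "cring (localization R S)"
proof -
  let ?h = "\<lambda>a. fraction R S a \<one>"
  have "inj_on ?h (carrier R)"
  proof (rule inj_onI)
    fix a b assume *: "a \<in> carrier R" "b \<in> carrier R" "?h a = ?h b"
    then obtain u where "u \<in> S" "u \<otimes> a = u \<otimes> b" by (auto simp: fraction_eq_iff)
    then show "a = b" using assms * by (meson Units_l_cancel subsetD)
  qed
  moreover have "?h ` carrier R = carrier (localization R S)"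
  proof -
    have "fraction R S a s = ?h (a \<otimes> inv s)" if "a \<in> carrier R" "s \<in> S" for a s
    proof (rule fraction_eqI[where u = \<one>])
      have s: "s \<in> Units R" using that assms by auto
      then have "a \<otimes> inv s \<otimes> s = a" using that by (simp add: m_assoc)
      then show "\<one> \<otimes> (a \<otimes> \<one>) = \<one> \<otimes> (a \<otimes> inv s \<otimes> s)" using that by simp
      show "a \<otimes> inv s \<in> carrier R" using that s by simp
    qed (use that in auto)
    moreover have "a \<otimes> inv s \<in> carrier R" if "a \<in> carrier R" "s \<in> S" for a s
      using that assms by auto
    ultimately show ?thesis unfolding localization_carrier using one_S by blast
  qed
  ultimately show iso: "?h \<in> ring_iso R (localization R S)"
    using fraction_hom by (simp add: ring_iso_def bij_betw_def)
  \<comment> \<open>Transport along an isomorphism gives a commutative ring whose zero is the image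
    of zero. In \<open>localization\<close> that is the zero by definition.\<close>
  have "cring ((localization R S)\<lparr>zero := ?h \<zero>\<rparr>)"
    by (rule ring_iso_imp_img_cring[OF iso])
  then show "cring (localization R S)" by (simp add: localization_def)
qed

end

section \<open>Self-injectivity from a nondegenerate functional\<close>

text \<open>Through \<open>\<kappa>\<close> every \<open>B\<close>-module is a vector space over the
  field, so its dual space can be formed.\<close>

locale scalars = cring B for B :: "('a, 'c) ring_scheme" (structure) +
  fixes \<kappa> :: "'k::field \<Rightarrow> 'a"
  assumes \<kappa>_closed [simp]: "\<kappa> a \<in> carrier B"
    and \<kappa>_add: "\<kappa> (a + b) = \<kappa> a \<oplus> \<kappa> b"
    and \<kappa>_mult: "\<kappa> (a * b) = \<kappa> a \<otimes> \<kappa> b"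
    and \<kappa>_one: "\<kappa> 1 = \<one>"
begin

definition functional :: "('a, 'n) module \<Rightarrow> 'n set \<Rightarrow> ('n \<Rightarrow> 'k) \<Rightarrow> bool" where
  "functional N L f \<longleftrightarrow>
    (\<forall>x\<in>L. \<forall>y\<in>L. f (x \<oplus>\<^bsub>N\<^esub> y) = f x + f y) \<and>
    (\<forall>a. \<forall>x\<in>L. f (\<kappa> a \<odot>\<^bsub>N\<^esub> x) = a * f x)"

lemma \<kappa>_zero: "\<kappa> 0 = \<zero>"
proof -
  have "\<kappa> 0 \<oplus> \<kappa> 0 = \<kappa> 0" using \<kappa>_add[of 0 0] by simp
  then show ?thesis using add.l_cancel_one \<kappa>_closed by blast
qed

lemma \<kappa>_uminus: "\<kappa> (- a) = \<ominus> \<kappa> a"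
proof -
  have "\<kappa> (- a) \<oplus> \<kappa> a = \<zero>" using \<kappa>_add[of "- a" a] \<kappa>_zero by simp
  then show ?thesis by (metis \<kappa>_closed minus_equality)
qed

text \<open>A partial functional is represented by its graph, to which Zorn's lemma applies directly.\<close>

lemma functional_extend:
  assumes N: "module B N" and L: "submodule L B N" and f: "functional N L f"
  obtains g where "functional N (carrier N) g" "\<And>x. x \<in> L \<Longrightarrow> g x = f x"
proof -
  interpret N: module B N by fact
  note LE = N.submoduleE[OF L]
  \<comment> \<open>Members are subspaces of \<open>N \<times> K\<close> that contain the graph of
    \<open>f\<close> and meet the fibre over zero only in zero. For a subspace the last condition
    amounts to being single-valued.\<close>
  define \<G> where "\<G> = {G. (\<lambda>x. (x, f x)) ` L \<subseteq> G \<and> G \<subseteq> carrier N \<times> UNIV \<and>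
    (\<forall>x a y b. (x, a) \<in> G \<longrightarrow> (y, b) \<in> G \<longrightarrow> (x \<oplus>\<^bsub>N\<^esub> y, a + b) \<in> G) \<and>
    (\<forall>x a c. (x, a) \<in> G \<longrightarrow> (\<kappa> c \<odot>\<^bsub>N\<^esub> x, c * a) \<in> G) \<and>
    (\<forall>a. (\<zero>\<^bsub>N\<^esub>, a) \<in> G \<longrightarrow> a = 0)}"
  have f0: "f \<zero>\<^bsub>N\<^esub> = 0"
  proof -
    obtain x where x: "x \<in> L" using LE(2) by blast
    then have "f (\<kappa> 0 \<odot>\<^bsub>N\<^esub> x) = 0" using f unfolding functional_def by auto
    then show ?thesis using x LE(1) \<kappa>_zero by (auto simp: subset_iff)
  qed
  have \<G>f: "(x, f x) \<in> G" if "G \<in> \<G>" "x \<in> L" for G x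
    using that unfolding \<G>_def by blast
  have \<G>c: "x \<in> carrier N" if "G \<in> \<G>" "(x, a) \<in> G" for G x a
    using that unfolding \<G>_def by blast
  have \<G>a: "(x \<oplus>\<^bsub>N\<^esub> y, a + b) \<in> G" if "G \<in> \<G>" "(x, a) \<in> G" "(y, b) \<in> G" for G x a y b
    using that unfolding \<G>_def by simp
  have \<G>s: "(\<kappa> c \<odot>\<^bsub>N\<^esub> x, c * a) \<in> G" if "G \<in> \<G>" "(x, a) \<in> G" for G x a c
    using that unfolding \<G>_def by simp
  have \<G>z: "a = 0" if "G \<in> \<G>" "(\<zero>\<^bsub>N\<^esub>, a) \<in> G" for G a
    using that unfolding \<G>_def by simp
  have \<G>I: "G \<in> \<G>" if "\<And>x. x \<in> L \<Longrightarrow> (x, f x) \<in> G" "\<And>x a. (x, a) \<in> G \<Longrightarrow> x \<in> carrier N"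
    "\<And>x a y b. (x, a) \<in> G \<Longrightarrow> (y, b) \<in> G \<Longrightarrow> (x \<oplus>\<^bsub>N\<^esub> y, a + b) \<in> G"
    "\<And>x a c. (x, a) \<in> G \<Longrightarrow> (\<kappa> c \<odot>\<^bsub>N\<^esub> x, c * a) \<in> G"
    "\<And>a. (\<zero>\<^bsub>N\<^esub>, a) \<in> G \<Longrightarrow> a = 0" for G
  proof -
    have "(\<lambda>x. (x, f x)) ` L \<subseteq> G" using that(1) by (rule image_subsetI)
    moreover have "G \<subseteq> carrier N \<times> UNIV" using that(2) by (simp add: subset_iff)
    ultimately show ?thesis unfolding \<G>_def mem_Collect_eq using that(3-5) by simp
  qed
  let ?G = "(\<lambda>x. (x, f x)) ` L"
  have graph: "?G \<in> \<G>"
  proof (rule \<G>I)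
    show "x \<in> carrier N" if "(x, a) \<in> ?G" for x a
      using that LE(1) by auto
    show "(x \<oplus>\<^bsub>N\<^esub> y, a + b) \<in> ?G"
      if "(x, a) \<in> ?G" "(y, b) \<in> ?G" for x a y b
    proof -
      have *: "x \<in> L" "a = f x" "y \<in> L" "b = f y" using that by auto
      then have "f (x \<oplus>\<^bsub>N\<^esub> y) = a + b" using f by (simp add: functional_def)
      then show ?thesis using LE(5)[OF *(1,3)] by (intro image_eqI[of _ _ "x \<oplus>\<^bsub>N\<^esub> y"]) simp_all
    qed
    show "(\<kappa> c \<odot>\<^bsub>N\<^esub> x, c * a) \<in> ?G"
      if "(x, a) \<in> ?G" for x a c
    proof -
      have *: "x \<in> L" "a = f x" using that by auto
      then have "f (\<kappa> c \<odot>\<^bsub>N\<^esub> x) = c * a" using f by (simp add: functional_def)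
      then show ?thesis using LE(4)[OF \<kappa>_closed *(1), of c]
        by (intro image_eqI[of _ _ "\<kappa> c \<odot>\<^bsub>N\<^esub> x"]) simp_all
    qed
    show "(x, f x) \<in> ?G" if "x \<in> L" for x using that by auto
    show "a = 0" if "(\<zero>\<^bsub>N\<^esub>, a) \<in> ?G" for a using that f0 by auto
  qed
  have "\<exists>G\<in>\<G>. \<forall>X\<in>\<G>. G \<subseteq> X \<longrightarrow> X = G"
  proof (rule subset_Zorn_nonempty)
    show "\<G> \<noteq> {}" using graph by blast
    fix C assume C: "C \<noteq> {}" "subset.chain \<G> C"
    have C\<G>: "G \<in> \<G>" if "G \<in> C" for G using C(2) that by (auto simp: subset_chain_def)
    show "\<Union>C \<in> \<G>"
    proof (rule \<G>I)
      fix x a y b assume xy: "(x, a) \<in> \<Union>C" "(y, b) \<in> \<Union>C"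
      from xy obtain G H where GH: "G \<in> C" "H \<in> C" "(x, a) \<in> G" "(y, b) \<in> H"
        by (elim UnionE)
      then have "G \<subseteq> H \<or> H \<subseteq> G" using C(2) by (auto simp: subset_chain_def)
      then have "\<exists>K. K \<in> C \<and> (x, a) \<in> K \<and> (y, b) \<in> K"
      proof
        assume "G \<subseteq> H"
        then show ?thesis using GH by (intro exI[of _ H]) (simp add: subsetD)
      next
        assume "H \<subseteq> G"
        then show ?thesis using GH by (intro exI[of _ G]) (simp add: subsetD)
      qed
      then show "(x \<oplus>\<^bsub>N\<^esub> y, a + b) \<in> \<Union>C" using \<G>a[OF C\<G>] by (meson UnionI)
    next
      fix x assume "x \<in> L"
      then show "(x, f x) \<in> \<Union>C" using C(1) \<G>f[OF C\<G>] by (meson UnionI ex_in_conv)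
    next
      fix x a assume "(x, a) \<in> \<Union>C"
      then show "x \<in> carrier N" using \<G>c[OF C\<G>] by (meson UnionE)
    next
      fix x a c assume "(x, a) \<in> \<Union>C"
      then show "(\<kappa> c \<odot>\<^bsub>N\<^esub> x, c * a) \<in> \<Union>C" using \<G>s[OF C\<G>] by (meson UnionE UnionI)
    next
      fix a assume "(\<zero>\<^bsub>N\<^esub>, a) \<in> \<Union>C"
      then show "a = 0" using \<G>z[OF C\<G>] by (meson UnionE)
    qed
  qed
  then obtain G where G: "G \<in> \<G>" and max: "\<forall>X\<in>\<G>. G \<subseteq> X \<longrightarrow> X = G" ..
  note Gf = \<G>f[OF G] and Gc = \<G>c[OF G] and Ga = \<G>a[OF G] and Gs = \<G>s[OF G] and Gz = \<G>z[OF G]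
  have "\<zero>\<^bsub>N\<^esub> \<in> L" using L by (metis submodule_def subgroup.one_closed monoid.simps(2))
  then have G0: "(\<zero>\<^bsub>N\<^esub>, 0) \<in> G" using Gf f0 by metis
  have minus1: "\<kappa> (-1) \<odot>\<^bsub>N\<^esub> x = \<ominus>\<^bsub>N\<^esub> x" if "x \<in> carrier N" for x
    using that by (simp add: \<kappa>_uminus \<kappa>_one N.smult_l_minus)
  have single_valued: "a = b" if "(x, a) \<in> G" "(x, b) \<in> G" for x a b
  proof -
    have "(x \<oplus>\<^bsub>N\<^esub> \<ominus>\<^bsub>N\<^esub> x, a + (-1) * b) \<in> G"
      using Ga[OF that(1) Gs[OF that(2), of "-1"]] minus1[OF Gc[OF that(1)]] by simp
    then have "(\<zero>\<^bsub>N\<^esub>, a - b) \<in> G" using Gc[OF that(1)] by (simp add: N.r_neg)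
    then show ?thesis using Gz by fastforce
  qed
  have total: "\<exists>a. (n, a) \<in> G" if n: "n \<in> carrier N" for n
  proof (rule ccontr)
    assume nG: "\<nexists>a. (n, a) \<in> G"
    \<comment> \<open>The missing vector \<open>n\<close> is adjoined with the value 0.\<close>
    define G' where "G' = {(x \<oplus>\<^bsub>N\<^esub> \<kappa> c \<odot>\<^bsub>N\<^esub> n, a) | x c a. (x, a) \<in> G}"
    have G'I: "(x \<oplus>\<^bsub>N\<^esub> \<kappa> c \<odot>\<^bsub>N\<^esub> n, a) \<in> G'" if "(x, a) \<in> G" for x c a
      unfolding G'_def mem_Collect_eq using that by (intro exI conjI) (rule refl)
    have G'E: "\<exists>y c. (y, a) \<in> G \<and> x = y \<oplus>\<^bsub>N\<^esub> \<kappa> c \<odot>\<^bsub>N\<^esub> n" if "(x, a) \<in> G'" for x a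
      using that unfolding G'_def by auto
    have GG': "G \<subseteq> G'"
    proof
      fix p assume p: "p \<in> G"
      obtain x a where xa: "p = (x, a)" by force
      then have "p = (x \<oplus>\<^bsub>N\<^esub> \<kappa> 0 \<odot>\<^bsub>N\<^esub> n, a)" using p n Gc by (simp add: \<kappa>_zero)
      then show "p \<in> G'" using p xa G'I by metis
    qed
    have "G' \<in> \<G>"
    proof (rule \<G>I)
      show "(x, f x) \<in> G'" if "x \<in> L" for x using Gf[OF that] GG' by blast
      show "x \<in> carrier N" if "(x, a) \<in> G'" for x a using that Gc n unfolding G'_def by auto
    next
      fix x a y b assume "(x, a) \<in> G'" "(y, b) \<in> G'"
      then obtain x' c y' e where *: "(x', a) \<in> G" "x = x' \<oplus>\<^bsub>N\<^esub> \<kappa> c \<odot>\<^bsub>N\<^esub> n"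
        "(y', b) \<in> G" "y = y' \<oplus>\<^bsub>N\<^esub> \<kappa> e \<odot>\<^bsub>N\<^esub> n" using G'E by meson
      then have "x \<oplus>\<^bsub>N\<^esub> y = (x' \<oplus>\<^bsub>N\<^esub> y') \<oplus>\<^bsub>N\<^esub> \<kappa> (c + e) \<odot>\<^bsub>N\<^esub> n"
        using n Gc[OF *(1)] Gc[OF *(3)]
        by (simp add: \<kappa>_add N.smult_l_distr N.add.m_assoc N.add.m_lcomm)
      then show "(x \<oplus>\<^bsub>N\<^esub> y, a + b) \<in> G'" using G'I[OF Ga[OF *(1,3)]] by simp
    next
      fix x a c assume "(x, a) \<in> G'"
      then obtain x' e where *: "(x', a) \<in> G" "x = x' \<oplus>\<^bsub>N\<^esub> \<kappa> e \<odot>\<^bsub>N\<^esub> n"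
        using G'E by meson
      then have "\<kappa> c \<odot>\<^bsub>N\<^esub> x = \<kappa> c \<odot>\<^bsub>N\<^esub> x' \<oplus>\<^bsub>N\<^esub> \<kappa> (c * e) \<odot>\<^bsub>N\<^esub> n"
        using n Gc[OF *(1)] by (simp add: \<kappa>_mult N.smult_r_distr N.smult_assoc1)
      then show "(\<kappa> c \<odot>\<^bsub>N\<^esub> x, c * a) \<in> G'" using G'I[OF Gs[OF *(1)]] by simp
    next
      fix a assume "(\<zero>\<^bsub>N\<^esub>, a) \<in> G'"
      then obtain x c where *: "(x, a) \<in> G" "\<zero>\<^bsub>N\<^esub> = x \<oplus>\<^bsub>N\<^esub> \<kappa> c \<odot>\<^bsub>N\<^esub> n"
        using G'E by meson
      have x: "x \<in> carrier N" using Gc[OF *(1)] .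
      have "x = \<ominus>\<^bsub>N\<^esub> (\<kappa> c \<odot>\<^bsub>N\<^esub> n)"
        using *(2) x n N.minus_equality[of x "\<kappa> c \<odot>\<^bsub>N\<^esub> n"] by simp
      then have xc: "x = \<kappa> (- c) \<odot>\<^bsub>N\<^esub> n" using n by (simp add: \<kappa>_uminus N.smult_l_minus)
      show "a = 0"
      proof (cases "c = 0")
        case True
        then have "x = \<zero>\<^bsub>N\<^esub>" using xc n by (simp add: \<kappa>_zero)
        then show ?thesis using *(1) Gz by simp
      next
        case False
        \<comment> \<open>With \<open>c\<close> nonzero, the relation \<open>x + c n = 0\<close>
          puts \<open>n\<close> itself into the domain of \<open>G\<close>, a contradiction.\<close>
        have "\<kappa> (- 1 / c) \<odot>\<^bsub>N\<^esub> x = \<kappa> (- 1 / c * - c) \<odot>\<^bsub>N\<^esub> n"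
          unfolding xc using n by (simp only: \<kappa>_mult N.smult_assoc1 \<kappa>_closed)
        also have "\<dots> = n" using False n by (simp add: \<kappa>_one)
        finally show ?thesis using Gs[OF *(1)] nG by metis
      qed
    qed
    then have "G' = G" using max GG' by simp
    moreover have "n = \<zero>\<^bsub>N\<^esub> \<oplus>\<^bsub>N\<^esub> \<kappa> 1 \<odot>\<^bsub>N\<^esub> n" using n by (simp add: \<kappa>_one)
    then have "(n, 0) \<in> G'" using G'I[OF G0] by metis
    ultimately show False using nG by simp
  qed
  define g where "g n = (SOME a. (n, a) \<in> G)" for n
  have g: "(n, g n) \<in> G" if "n \<in> carrier N" for n
    unfolding g_def using total[OF that] by (rule someI_ex)
  have "functional N (carrier N) g"
    unfolding functional_def
  proof (intro conjI ballI allI)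
    fix x y assume "x \<in> carrier N" "y \<in> carrier N"
    then show "g (x \<oplus>\<^bsub>N\<^esub> y) = g x + g y" using single_valued[OF g Ga[OF g g]] by simp
  next
    fix a x assume "x \<in> carrier N"
    then show "g (\<kappa> a \<odot>\<^bsub>N\<^esub> x) = a * g x" using single_valued[OF g Gs[OF g]] by simp
  qed
  moreover have "g x = f x" if "x \<in> L" for x using single_valued[OF g Gf] that LE(1) by blast
  ultimately show ?thesis by (rule that)
qed

text \<open>With a functional as below, \<open>Hom\<^sub>B(N, B)\<close> is the \<open>K\<close>-dual of \<open>N\<close>, for every module \<open>N\<close>.\<close>

lemma injective_list_module:
  assumes tr: "functional (self_module B) (carrier B) tr"
    and nondegenerate: "\<And>x. x \<in> carrier B \<Longrightarrow> (\<And>y. y \<in> carrier B \<Longrightarrow> tr (y \<otimes> x) = 0) \<Longrightarrow> x = \<zero>"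
    and represented: "\<And>\<psi>. functional (self_module B) (carrier B) \<psi> \<Longrightarrow>
      \<exists>x\<in>carrier B. \<forall>y\<in>carrier B. \<psi> y = tr (y \<otimes> x)"
  shows "injective_module B (list_module B)"
  unfolding injective_module_def
proof (intro conjI allI impI; (elim conjE)?)
  show "module B (list_module B)" by (rule module_list_module)
  fix N :: "('a, 'a list) module" and L f
  assume N: "module B N" and L: "submodule L B N"
    and f: "f \<in> module_homs B (N\<lparr>carrier := L\<rparr>) (list_module B)"
  interpret N: module B N by fact
  note LE = N.submoduleE[OF L]
  have tr_add: "tr (x \<oplus> y) = tr x + tr y" if "x \<in> carrier B" "y \<in> carrier B" for x y
    using tr that by (simp add: functional_def)
  have tr_scale: "tr (\<kappa> a \<otimes> x) = a * tr x" if "x \<in> carrier B" for a x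
    using tr that by (simp add: functional_def)
  \<comment> \<open>An element is determined by its pairings under \<open>tr\<close>. The identities
    for \<open>g\<close> below are all obtained by comparing pairings.\<close>
  have unique: "x = y" if xy: "x \<in> carrier B" "y \<in> carrier B"
    and eq: "\<And>z. z \<in> carrier B \<Longrightarrow> tr (z \<otimes> x) = tr (z \<otimes> y)" for x y
  proof -
    have "tr (z \<otimes> (x \<oplus> \<kappa> (-1) \<otimes> y)) = 0" if z: "z \<in> carrier B" for z
    proof -
      have "z \<otimes> (x \<oplus> \<kappa> (-1) \<otimes> y) = z \<otimes> x \<oplus> \<kappa> (-1) \<otimes> (z \<otimes> y)"
        using xy z by (simp add: r_distr m_lcomm)
      then show ?thesis using eq[OF z] xy z by (simp add: tr_add tr_scale)
    qed
    then have "x \<oplus> \<kappa> (-1) \<otimes> y = \<zero>" using xy by (intro nondegenerate) auto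
    then have "x \<ominus> y = \<zero>" using xy by (simp add: \<kappa>_uminus \<kappa>_one l_minus minus_eq)
    then show ?thesis using xy by simp
  qed
  define h where "h x = hd (f x)" for x
  have fh: "f x = [h x]" "h x \<in> carrier B" if "x \<in> L" for x
  proof -
    have "f x \<in> (\<lambda>x. [x]) ` carrier B"
      using f that unfolding module_homs_def by (simp add: Pi_iff)
    then show "f x = [h x]" "h x \<in> carrier B" by (auto simp: h_def)
  qed
  have h_add: "h (x \<oplus>\<^bsub>N\<^esub> y) = h x \<oplus> h y" if "x \<in> L" "y \<in> L" for x y
    using f that fh unfolding module_homs_def h_def by auto
  have h_smult: "h (b \<odot>\<^bsub>N\<^esub> x) = b \<otimes> h x" if "b \<in> carrier B" "x \<in> L" for b x
    using f that fh unfolding module_homs_def h_def by auto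
  have "functional N L (\<lambda>x. tr (h x))"
    unfolding functional_def by (auto simp: h_add h_smult fh tr_add tr_scale)
  \<comment> \<open>The extension problem is now one of vector spaces: \<open>tr\<close> composed
    with \<open>h\<close> extends to \<open>N\<close>, and for each \<open>n\<close> the functional
    \<open>y \<mapsto> \<mu> (y n)\<close> on \<open>B\<close> is represented by an element
    \<open>g n\<close>.\<close>
  then obtain \<mu> where \<mu>: "functional N (carrier N) \<mu>" "\<And>x. x \<in> L \<Longrightarrow> \<mu> x = tr (h x)"
    using functional_extend[OF N L] by blast
  have \<mu>_add: "\<mu> (x \<oplus>\<^bsub>N\<^esub> y) = \<mu> x + \<mu> y" if "x \<in> carrier N" "y \<in> carrier N" for x y
    using \<mu>(1) that by (simp add: functional_def)
  have \<mu>_scale: "\<mu> (\<kappa> a \<odot>\<^bsub>N\<^esub> x) = a * \<mu> x" if "x \<in> carrier N" for a x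
    using \<mu>(1) that by (simp add: functional_def)
  define g where "g n = (SOME x. x \<in> carrier B \<and> (\<forall>y\<in>carrier B. \<mu> (y \<odot>\<^bsub>N\<^esub> n) = tr (y \<otimes> x)))" for n
  have gP: "g n \<in> carrier B \<and> (\<forall>y\<in>carrier B. \<mu> (y \<odot>\<^bsub>N\<^esub> n) = tr (y \<otimes> g n))" if n: "n \<in> carrier N" for n
  proof -
    have "functional (self_module B) (carrier B) (\<lambda>y. \<mu> (y \<odot>\<^bsub>N\<^esub> n))"
      unfolding functional_def using n
      by (simp add: N.smult_l_distr N.smult_assoc1 \<mu>_add \<mu>_scale)
    from represented[OF this]
    have "\<exists>x. x \<in> carrier B \<and> (\<forall>y\<in>carrier B. \<mu> (y \<odot>\<^bsub>N\<^esub> n) = tr (y \<otimes> x))" by (simp only: Bex_def)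
    then show ?thesis unfolding g_def by (rule someI_ex)
  qed
  have g: "g n \<in> carrier B" "y \<in> carrier B \<Longrightarrow> tr (y \<otimes> g n) = \<mu> (y \<odot>\<^bsub>N\<^esub> n)"
    if "n \<in> carrier N" for n y
    using gP[OF that] by simp_all
  have "(\<lambda>n. [g n]) \<in> module_homs B N (list_module B)"
    unfolding module_homs_def
  proof (intro CollectI conjI ballI)
    show "(\<lambda>n. [g n]) \<in> carrier N \<rightarrow> carrier (list_module B)" using g by auto
  next
    fix x y assume xy: "x \<in> carrier N" "y \<in> carrier N"
    have "g (x \<oplus>\<^bsub>N\<^esub> y) = g x \<oplus> g y"
      by (rule unique) (use xy g in \<open>simp_all add: r_distr tr_add N.smult_r_distr \<mu>_add\<close>)
    then show "[g (x \<oplus>\<^bsub>N\<^esub> y)] = [g x] \<oplus>\<^bsub>list_module B\<^esub> [g y]" by simp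
  next
    fix b x assume bx: "b \<in> carrier B" "x \<in> carrier N"
    have "g (b \<odot>\<^bsub>N\<^esub> x) = b \<otimes> g x"
    proof (rule unique)
      fix z assume z: "z \<in> carrier B"
      have "tr (z \<otimes> (b \<otimes> g x)) = tr ((z \<otimes> b) \<otimes> g x)" using z bx g by (simp add: m_assoc)
      then show "tr (z \<otimes> g (b \<odot>\<^bsub>N\<^esub> x)) = tr (z \<otimes> (b \<otimes> g x))"
        using z bx g by (simp add: N.smult_assoc1)
    qed (use bx g in auto)
    then show "[g (b \<odot>\<^bsub>N\<^esub> x)] = b \<odot>\<^bsub>list_module B\<^esub> [g x]" by simp
  qed
  moreover have "[g x] = f x" if x: "x \<in> L" for x
  proof -
    have "g x = h x"
      by (rule unique) (use x fh g LE(1,4) in \<open>auto simp: \<mu>(2) h_smult subset_iff\<close>)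
    then show ?thesis using fh x by simp
  qed
  ultimately show "\<exists>g\<in>module_homs B N (list_module B). \<forall>x\<in>L. g x = f x"
    by (intro bexI[of _ "\<lambda>n. [g n]"] ballI)
qed

end

section \<open>The resolution of a self-injective ring\<close>

definition trivial_module :: "('a, 'a list) module" where
  "trivial_module = \<lparr>carrier = {[]}, monoid.mult = (\<lambda>x y. []), one = [], zero = [],
    add = (\<lambda>x y. []), smult = (\<lambda>a x. [])\<rparr>"

lemma injective_trivial_module:
  assumes "cring B"
  shows "injective_module B (trivial_module :: ('a, 'a list) module)"
proof -
  have "abelian_group (trivial_module :: ('a, 'a list) module)"
    by (rule abelian_groupI) (simp_all add: trivial_module_def)
  then have "module B (trivial_module :: ('a, 'a list) module)"
    by (rule moduleI[OF assms]) (simp_all add: trivial_module_def)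
  then show ?thesis
    by (auto simp: injective_module_def module_homs_def trivial_module_def Pi_def
      intro!: exI[of _ "\<lambda>_. []"])
qed

text \<open>The resolution has a single nonzero place, occupied by the list copy of
  \<open>B\<close>, with the singleton map as augmentation. The constant \<open>[]\<close> serves as
  every differential, being the zero of \<open>trivial_module\<close>.\<close>

lemma finite_injective_dimension_self_injective:
  assumes "cring B" "injective_module B (list_module B)"
  shows "finite_injective_dimension B (self_module B)"
proof -
  interpret cring B by fact
  let ?E = "\<lambda>i. case i of 0 \<Rightarrow> list_module B | Suc _ \<Rightarrow> trivial_module"
  let ?\<delta> = "\<lambda>(i::nat) (x::'a list). [] :: 'a list"
  have "injective_module B (?E i)" for i
    using assms(2) injective_trivial_module[OF assms(1)] by (simp split: nat.split)
  moreover have "(\<lambda>x. [x]) \<in> module_homs B (self_module B) (?E 0)"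
    by (simp add: module_homs_def)
  moreover have "?\<delta> i \<in> module_homs B (?E i) (?E (Suc i))" for i
    by (simp add: module_homs_def trivial_module_def)
  moreover have "(\<lambda>x. [x]) ` carrier (self_module B) = a_kernel (?E 0) (?E 1) (?\<delta> 0)"
    by (simp add: a_kernel_def' trivial_module_def)
  moreover have "?\<delta> i ` carrier (?E i) = a_kernel (?E (Suc i)) (?E (Suc (Suc i))) (?\<delta> (Suc i))" for i
    by (auto simp: a_kernel_def' trivial_module_def split: nat.split)
  ultimately have "injective_resolution B (self_module B) (\<lambda>x. [x]) ?E ?\<delta>"
    unfolding injective_resolution_def by (simp add: inj_on_def)
  moreover have "\<forall>i>0. carrier (?E i) = {\<zero>\<^bsub>?E i\<^esub>}"
    by (auto simp: trivial_module_def split: nat.split)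
  ultimately show ?thesis unfolding finite_injective_dimension_def by blast
qed

section \<open>Polynomials\<close>

abbreviation monom :: "'a \<Rightarrow> 'b \<Rightarrow> ('a \<Rightarrow>\<^sub>0 'b::zero)" where "monom \<equiv> Poly_Mapping.single"
abbreviation supp :: "('a \<Rightarrow>\<^sub>0 'b::zero) \<Rightarrow> 'a set" where "supp \<equiv> Poly_Mapping.keys"
abbreviation coef :: "('a \<Rightarrow>\<^sub>0 'b::zero) \<Rightarrow> 'a \<Rightarrow> 'b" where "coef \<equiv> Poly_Mapping.lookup"

section \<open>Exponent vectors, constants and variables\<close>

definition unit_exp :: "nat \<Rightarrow> nat \<Rightarrow>\<^sub>0 nat" where "unit_exp i = monom i 1"

lemma coef_unit_exp: "coef (unit_exp i) j = (if i = j then 1 else 0)"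
  by (simp add: unit_exp_def lookup_single when_def)

lemma keys_unit_exp [simp]: "supp (unit_exp i) = {i}"
  by (simp add: unit_exp_def)

lemma var_altdef: "var i = monom (unit_exp i) 1"
  by (simp add: var_def unit_exp_def)

lemma const_add: "const (a + b) = const a + const b"
  by (simp add: const_def single_add)

lemma const_mult: "const (a * b) = const a * const b"
  by (simp add: const_def mult_single)

lemma const_0 [simp]: "const 0 = 0"
  by (simp add: const_def)

lemma const_1 [simp]: "const 1 = 1"
  by (simp add: const_def)

lemma const_uminus: "const (- a) = - const a"
  by (simp add: const_def single_uminus)

lemma coef_const: "coef (const c) m = (if m = 0 then c else 0)"
  by (simp add: const_def lookup_single when_def)

lemma coef_var: "coef (var i) m = (if m = unit_exp i then 1 else 0)"
  by (auto simp: var_altdef lookup_single when_def)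

lemma coef_const_mult [simp]: "coef (const c * p) m = c * coef p m"
proof -
  have "const c * p = Poly_Mapping.map ((*) c) p" by (simp add: const_def mult_map_scale_conv_mult)
  then show ?thesis by (simp add: map.rep_eq when_def)
qed

lemma unit_exp_nonzero [simp]: "unit_exp i \<noteq> 0" "0 \<noteq> unit_exp i"
  by (metis coef_unit_exp lookup_zero zero_neq_one)+

lemma unit_exp_inject [simp]: "unit_exp i = unit_exp j \<longleftrightarrow> i = j"
  by (metis coef_unit_exp zero_neq_one)

lemma exp_split:
  fixes m :: "nat \<Rightarrow>\<^sub>0 nat"
  assumes "i \<in> supp m"
  shows "m = unit_exp i + (m - unit_exp i)"
proof (rule poly_mapping_eqI)
  fix j show "coef m j = coef (unit_exp i + (m - unit_exp i)) j"
    using assms by (auto simp: lookup_add lookup_minus coef_unit_exp in_keys_iff)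
qed

lemma exp_keys_add: "supp (m + n) = supp m \<union> supp n"
  for m n :: "nat \<Rightarrow>\<^sub>0 nat"
  by (auto simp: in_keys_iff lookup_add)

definition deg :: "(nat \<Rightarrow>\<^sub>0 nat) \<Rightarrow> nat" where
  "deg m = (\<Sum>i\<in>supp m. coef m i)"

lemma deg_add: "deg (m + n) = deg m + deg n"
  unfolding deg_def by (rule setsum_keys_plus_distrib) auto

lemma deg_single [simp]: "deg (monom i k) = k"
  by (simp add: deg_def)

lemma deg_unit_exp [simp]: "deg (unit_exp i) = 1"
  by (simp add: unit_exp_def)

lemma deg_zero [simp]: "deg 0 = 0"
  by (simp add: deg_def)

lemma deg_Suc:
  assumes "deg m = Suc n"
  obtains i k where "i \<in> supp m" "m = unit_exp i + k" "deg k = n"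
proof -
  have "m \<noteq> 0" using assms by auto
  then obtain i where i: "i \<in> supp m" by (metis keys_eq_empty equals0I)
  have "deg (m - unit_exp i) = n"
    using assms exp_split[OF i] by (metis deg_add deg_unit_exp add_left_cancel plus_1_eq_Suc)
  then show ?thesis using that i exp_split[OF i] by blast
qed

lemma deg_0_iff: "deg m = 0 \<longleftrightarrow> m = 0"
  by (auto simp: deg_def in_keys_iff intro!: poly_mapping_eqI)

lemma deg_1: "deg m = 1 \<Longrightarrow> \<exists>i. m = unit_exp i"
  by (metis One_nat_def add.right_neutral deg_0_iff deg_Suc)

lemma deg_2: "deg m = 2 \<Longrightarrow> \<exists>i j. m = unit_exp i + unit_exp j"
  by (metis Suc_1 deg_1 deg_Suc)

lemma exp_add_eq_single:
  fixes a b :: "nat \<Rightarrow>\<^sub>0 nat"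
  assumes "a + b = monom i n"
  obtains k where "k \<le> n" "a = monom i k" "b = monom i (n - k)"
proof (rule that)
  have *: "coef a j + coef b j = (n when i = j)" for j
    using assms by (metis lookup_add lookup_single)
  show "coef a i \<le> n" using *[of i] by simp
  show "a = monom i (coef a i)"
    by (rule poly_mapping_eqI) (metis * add_is_0 lookup_single lookup_single_not_eq when_def)
  show "b = monom i (n - coef a i)"
  proof (rule poly_mapping_eqI)
    fix j show "coef b j = coef (monom i (n - coef a i)) j"
      using *[of j] by (cases "i = j") (auto simp: lookup_single)
  qed
qed

section \<open>Coefficients of products in low degree\<close>

lemma poly_mapping_sum_single:
  fixes p :: "'a \<Rightarrow>\<^sub>0 'b::comm_monoid_add"
  shows "p = (\<Sum>m\<in>supp p. monom m (coef p m))"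
  by (rule poly_mapping_eqI)
    (simp add: lookup_sum lookup_single when_def sum.delta in_keys_iff)

lemma poly_single_induct [case_names single zero add]:
  fixes p :: "'a \<Rightarrow>\<^sub>0 'b::comm_monoid_add"
  assumes single: "\<And>m c. m \<in> supp p \<Longrightarrow> P (monom m c)"
    and zero: "P 0" and add: "\<And>q r. P q \<Longrightarrow> P r \<Longrightarrow> P (q + r)"
  shows "P p"
proof -
  have "P (\<Sum>m\<in>A. monom m (coef p m))"
    if "finite A" "A \<subseteq> supp p" for A
    using that by (induction A rule: finite_induct) (auto intro: single zero add)
  from this[OF finite_keys order_refl] show ?thesis using poly_mapping_sum_single[of p] by simp
qed

text \<open>Both sides of a product formula are additive in each factor, so comparing them on
  monomials suffices. This replaces expansions of the convolution product.\<close>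

lemma bilinear_eqI:
  fixes F G :: "('a \<Rightarrow>\<^sub>0 'k::ab_group_add) \<Rightarrow> ('a \<Rightarrow>\<^sub>0 'k) \<Rightarrow> 'b::ab_group_add"
  assumes F: "\<And>p q r. F (p + q) r = F p r + F q r" "\<And>p q r. F p (q + r) = F p q + F p r"
    and G: "\<And>p q r. G (p + q) r = G p r + G q r" "\<And>p q r. G p (q + r) = G p q + G p r"
    and eq: "\<And>a b c e. F (monom a c) (monom b e) =
      G (monom a c) (monom b e)"
  shows "F p q = G p q"
proof -
  have z: "F 0 r = 0" "F r 0 = 0" "G 0 r = 0" "G r 0 = 0" for r
    using F(1)[of 0 0 r] F(2)[of r 0 0] G(1)[of 0 0 r] G(2)[of r 0 0] by simp_all
  have "F (monom a c) q = G (monom a c) q" for a c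
    by (induction q rule: poly_single_induct) (simp_all add: eq z F G)
  then show ?thesis
    by (induction p rule: poly_single_induct) (simp_all add: z F G)
qed

lemma coef_mult_0: "coef (p * q) 0 = coef p 0 * coef q 0"
  for p q :: "'k::field mpoly"
proof (rule bilinear_eqI[of "\<lambda>p q. coef (p * q) 0"])
  fix a b :: "nat \<Rightarrow>\<^sub>0 nat" and c e :: 'k
  have "a + b = 0 \<longleftrightarrow> a = 0 \<and> b = 0"
    by (metis add_eq_0_iff_both_eq_0 deg_0_iff deg_add add.right_neutral)
  then show "coef (monom a c * monom b e) 0 =
      coef (monom a c) 0 * coef (monom b e) 0"
    by (simp add: mult_single lookup_single when_def)
qed (simp_all add: algebra_simps lookup_add)

text \<open>The Leibniz rule at the origin: the exponent \<open>unit_exp i\<close> splits in only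
  two ways.\<close>

lemma coef_mult_unit_exp:
  "coef (p * q) (unit_exp i) = coef p 0 * coef q (unit_exp i) + coef p (unit_exp i) * coef q 0"
  for p q :: "'k::field mpoly"
proof (rule bilinear_eqI[of "\<lambda>p q. coef (p * q) (unit_exp i)"])
  fix a b :: "nat \<Rightarrow>\<^sub>0 nat" and c e :: 'k
  have "a + b = unit_exp i \<longleftrightarrow> a = 0 \<and> b = unit_exp i \<or> a = unit_exp i \<and> b = 0"
  proof
    assume "a + b = unit_exp i"
    then show "a = 0 \<and> b = unit_exp i \<or> a = unit_exp i \<and> b = 0"
      unfolding unit_exp_def by (elim exp_add_eq_single) (auto simp: le_Suc_eq)
  qed auto
  then show "coef (monom a c * monom b e) (unit_exp i) =
      coef (monom a c) 0 * coef (monom b e) (unit_exp i) +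
      coef (monom a c) (unit_exp i) * coef (monom b e) 0"
    by (auto simp: mult_single lookup_single when_def)
qed (simp_all add: algebra_simps lookup_add)

text \<open>Among the coefficients of degree two only those of pure squares are needed, because the
  functional attached to the ideals with signs ignores mixed products.\<close>

lemma coef_mult_square:
  "coef (p * q) (monom i 2) =
    coef p 0 * coef q (monom i 2) + coef p (unit_exp i) * coef q (unit_exp i) +
    coef p (monom i 2) * coef q 0"
  for p q :: "'k::field mpoly"
proof (rule bilinear_eqI[of "\<lambda>p q. coef (p * q) (monom i 2)"])
  fix a b :: "nat \<Rightarrow>\<^sub>0 nat" and c e :: 'k
  let ?s = "monom i 2 :: nat \<Rightarrow>\<^sub>0 nat"
  have "a + b = ?s \<longleftrightarrow>
      a = 0 \<and> b = ?s \<or> a = unit_exp i \<and> b = unit_exp i \<or> a = ?s \<and> b = 0"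
  proof
    assume "a + b = ?s"
    then obtain k where k: "k \<le> 2" "a = monom i k" "b = monom i (2 - k)"
      by (rule exp_add_eq_single)
    then have "k = 0 \<or> k = 1 \<or> k = 2" by linarith
    then show "a = 0 \<and> b = ?s \<or> a = unit_exp i \<and> b = unit_exp i \<or> a = ?s \<and> b = 0"
      using k by (auto simp: unit_exp_def)
  next
    assume "a = 0 \<and> b = ?s \<or> a = unit_exp i \<and> b = unit_exp i \<or> a = ?s \<and> b = 0"
    moreover have "unit_exp i + unit_exp i = ?s"
      by (simp add: unit_exp_def numeral_2_eq_2 flip: single_add)
    ultimately show "a + b = ?s" by auto
  qed
  moreover have "?s \<noteq> 0" "0 \<noteq> ?s" "unit_exp i \<noteq> ?s" "?s \<noteq> unit_exp i"
    by (metis deg_single deg_unit_exp deg_zero one_eq_numeral_iff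
        semiring_norm(85) zero_neq_numeral)+
  ultimately show "coef (monom a c * monom b e) ?s =
      coef (monom a c) 0 * coef (monom b e) ?s +
      coef (monom a c) (unit_exp i) * coef (monom b e) (unit_exp i) +
      coef (monom a c) ?s * coef (monom b e) 0"
    by (auto simp: mult_single lookup_single when_def)
qed (simp_all add: algebra_simps lookup_add)

section \<open>Homogeneous components\<close>

definition hom_comp :: "nat \<Rightarrow> ('k::field) mpoly \<Rightarrow> 'k mpoly" where
  "hom_comp n p = Poly_Mapping.mapp (\<lambda>m c. c when deg m = n) p"

lemma coef_hom_comp: "coef (hom_comp n p) m = (if deg m = n then coef p m else 0)"
  by (simp add: hom_comp_def lookup_mapp when_def in_keys_iff)

lemma hom_comp_add: "hom_comp n (p + q) = hom_comp n p + hom_comp n q"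
  by (rule poly_mapping_eqI) (simp add: coef_hom_comp lookup_add)

lemma hom_comp_single:
  "hom_comp n (monom m c) = (if deg m = n then monom m c else 0)"
  by (rule poly_mapping_eqI) (auto simp: coef_hom_comp lookup_single when_def)

lemma hom_comp_mult: "hom_comp n (p * q) = (\<Sum>i\<le>n. hom_comp i p * hom_comp (n - i) q)"
  for p q :: "'k::field mpoly"
proof (rule bilinear_eqI[of "\<lambda>p q. hom_comp n (p * q)"])
  fix a b :: "nat \<Rightarrow>\<^sub>0 nat" and c e :: 'k
  have "(\<Sum>i\<le>n. hom_comp i (monom a c) * hom_comp (n - i) (monom b e)) =
    (\<Sum>i\<le>n. if deg a = i then
      (if deg b = n - i then monom (a + b) (c * e) else 0) else 0)"
    by (rule sum.cong) (auto simp: hom_comp_single mult_single)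
  also have "\<dots> = hom_comp n (monom a c * monom b e)"
    by (auto simp: mult_single hom_comp_single deg_add)
  finally show "hom_comp n (monom a c * monom b e) =
      (\<Sum>i\<le>n. hom_comp i (monom a c) * hom_comp (n - i) (monom b e))" ..
qed (simp_all add: algebra_simps hom_comp_add sum.distrib)

lemma quadric_iff: "quadric p \<longleftrightarrow> hom_comp 2 p = p"
proof
  assume q: "quadric p"
  show "hom_comp 2 p = p"
  proof (rule poly_mapping_eqI)
    fix m show "coef (hom_comp 2 p) m = coef p m"
      using q unfolding quadric_def deg_def[symmetric] coef_hom_comp
      by (metis not_in_keys_iff_lookup_eq_zero)
  qed
next
  assume "hom_comp 2 p = p"
  then show "quadric p"
    unfolding quadric_def deg_def[symmetric] by (metis coef_hom_comp in_keys_iff)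
qed

section \<open>The polynomial ring in d variables and its ideals\<close>

abbreviation polys :: "nat \<Rightarrow> ('k::field) mpoly set" where "polys d \<equiv> carrier (poly_ring d)"

lemma poly_ring_simps [simp]:
  "p \<otimes>\<^bsub>poly_ring d\<^esub> q = p * q" "\<one>\<^bsub>poly_ring d\<^esub> = 1" "\<zero>\<^bsub>poly_ring d\<^esub> = 0"
  "p \<oplus>\<^bsub>poly_ring d\<^esub> q = p + q"
  by (simp_all add: poly_ring_def)

lemma polys_iff: "p \<in> polys d \<longleftrightarrow> (\<forall>m\<in>supp p. supp m \<subseteq> {1..d})"
  by (simp add: poly_ring_def)

lemma polys_add [simp]: "p \<in> polys d \<Longrightarrow> q \<in> polys d \<Longrightarrow> p + q \<in> polys d"
  unfolding polys_iff using keys_add[of p q] by blast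

lemma polys_mult [simp]: "p \<in> polys d \<Longrightarrow> q \<in> polys d \<Longrightarrow> p * q \<in> polys d"
  unfolding polys_iff using keys_mult[of p q] exp_keys_add by (fastforce simp: subset_iff)

lemma polys_const [simp]: "const c \<in> polys d"
  by (auto simp: polys_iff const_def)

lemma polys_0 [simp]: "0 \<in> polys d"
  by (simp add: polys_iff)

lemma polys_1 [simp]: "1 \<in> polys d"
  using polys_const[of 1] by simp

lemma polys_var [simp]: "i \<in> {1..d} \<Longrightarrow> var i \<in> polys d"
  by (simp add: polys_iff var_def)

lemma polys_uminus [simp]: "p \<in> polys d \<Longrightarrow> - p \<in> polys d"
  using polys_mult[OF polys_const[of "-1"], of p d] by (simp add: const_uminus)

lemma polys_diff [simp]: "p \<in> polys d \<Longrightarrow> q \<in> polys d \<Longrightarrow> p - q \<in> polys d"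
  using polys_add[of p d "- q"] by simp

lemma polys_sum [simp]: "(\<And>i. i \<in> A \<Longrightarrow> f i \<in> polys d) \<Longrightarrow> sum f A \<in> polys d"
  by (induction A rule: infinite_finite_induct) auto

lemma polys_power [simp]: "p \<in> polys d \<Longrightarrow> p ^ n \<in> polys d"
  by (induction n) auto

lemma cring_poly_ring: "cring (poly_ring d)"
proof (rule cringI)
  show "abelian_group (poly_ring d)"
  proof (rule abelian_groupI)
    fix p assume "p \<in> polys d"
    then show "\<exists>q\<in>polys d. q \<oplus>\<^bsub>poly_ring d\<^esub> p = \<zero>\<^bsub>poly_ring d\<^esub>"
      by (intro bexI[of _ "- p"]) simp_all
  qed (simp_all add: algebra_simps)
  show "comm_monoid (poly_ring d)"
    by (rule comm_monoidI) (simp_all add: algebra_simps)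
qed (simp_all add: algebra_simps)

interpretation poly: cring "poly_ring d"
  by (rule cring_poly_ring)

lemma poly_ring_a_inv [simp]: "p \<in> polys d \<Longrightarrow> \<ominus>\<^bsub>poly_ring d\<^esub> p = - p"
  by (rule poly.minus_equality) simp_all

lemma ideal_poly_ringI:
  fixes J :: "'k::field mpoly set"
  assumes "J \<subseteq> polys d" "0 \<in> J" "\<And>p q. p \<in> J \<Longrightarrow> q \<in> J \<Longrightarrow> p + q \<in> J"
    "\<And>r p. r \<in> polys d \<Longrightarrow> p \<in> J \<Longrightarrow> r * p \<in> J"
  shows "ideal J (poly_ring d)"
proof (rule idealI)
  show "ring (poly_ring d)" by (rule poly.ring_axioms)
  show "subgroup J (add_monoid (poly_ring d))"
  proof (rule poly.add.subgroupI)
    show "\<ominus>\<^bsub>poly_ring d\<^esub> p \<in> J" if "p \<in> J" for p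
      using assms(1) assms(4)[of "const (-1)" p] that by (auto simp: const_uminus)
  qed (use assms in auto)
next
  fix p r :: "'k mpoly" assume "p \<in> J" "r \<in> polys d"
  then show "r \<otimes>\<^bsub>poly_ring d\<^esub> p \<in> J" "p \<otimes>\<^bsub>poly_ring d\<^esub> r \<in> J"
    using assms(4)[of r p] by (simp_all add: mult.commute[of p r])
qed

lemma ideal_poly_ringD:
  assumes "ideal J (poly_ring d)"
  shows "p \<in> J \<Longrightarrow> p \<in> polys d" "0 \<in> J" "p \<in> J \<Longrightarrow> q \<in> J \<Longrightarrow> p + q \<in> J"
    "r \<in> polys d \<Longrightarrow> p \<in> J \<Longrightarrow> r * p \<in> J" "p \<in> J \<Longrightarrow> - p \<in> J"
    "p \<in> J \<Longrightarrow> q \<in> J \<Longrightarrow> p - q \<in> J"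
proof -
  interpret J: ideal J "poly_ring d" by fact
  show 1: "p \<in> J \<Longrightarrow> p \<in> polys d" for p by (rule J.Icarr)
  show "0 \<in> J" using J.zero_closed by simp
  show 2: "p \<in> J \<Longrightarrow> q \<in> J \<Longrightarrow> p + q \<in> J" for p q using J.a_closed by simp
  show "r \<in> polys d \<Longrightarrow> p \<in> J \<Longrightarrow> r * p \<in> J" for r using J.I_l_closed by simp
  show 3: "p \<in> J \<Longrightarrow> - p \<in> J" for p using J.a_inv_closed[of p] 1 by simp
  show "p \<in> J \<Longrightarrow> q \<in> J \<Longrightarrow> p - q \<in> J" using 2[of p "- q"] 3[of q] by simp
qed

lemma ideal_poly_ring_sum:
  assumes "ideal J (poly_ring d)" "\<And>i. i \<in> A \<Longrightarrow> f i \<in> J"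
  shows "sum f A \<in> J"
  using assms by (induction A rule: infinite_finite_induct) (auto simp: ideal_poly_ringD)

section \<open>Induction over polynomials\<close>

lemma monomial_induct:
  assumes "supp m \<subseteq> X"
    and const: "P (const c)"
    and var: "\<And>i n. i \<in> X \<Longrightarrow> supp n \<subseteq> X \<Longrightarrow> P (monom n c) \<Longrightarrow>
      P (var i * monom n c)"
  shows "P (monom m c)"
  using assms(1)
proof (induction "deg m" arbitrary: m)
  case 0
  then show ?case using const deg_0_iff[of m] by (simp add: const_def)
next
  case (Suc n)
  then obtain i k where k: "i \<in> supp m" "m = unit_exp i + k" "deg k = n"
    by (metis deg_Suc)
  then have "monom m c = var i * monom k c"
    by (simp add: var_altdef mult_single)
  moreover have "i \<in> X" "supp k \<subseteq> X" using Suc.prems k by (auto simp: exp_keys_add)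
  ultimately show ?case using var[of i k] Suc.hyps(1)[of k] k by simp
qed

lemma polys_induct [consumes 1, case_names const add var]:
  assumes p: "p \<in> polys d"
    and const: "\<And>c. P (const c)"
    and add: "\<And>p q. p \<in> polys d \<Longrightarrow> q \<in> polys d \<Longrightarrow> P p \<Longrightarrow> P q \<Longrightarrow> P (p + q)"
    and var: "\<And>i p. i \<in> {1..d} \<Longrightarrow> p \<in> polys d \<Longrightarrow> P p \<Longrightarrow> P (var i * p)"
  shows "P p"
proof -
  have "p \<in> polys d \<and> P p"
  proof (induction p rule: poly_single_induct)
    case (single m c)
    then have "supp m \<subseteq> {1..d}" using p by (auto simp: polys_iff)
    then have "monom m c \<in> polys d \<and> P (monom m c)"
      by (rule monomial_induct) (use const var in auto)
    then show ?case .
  next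
    case zero
    then show ?case using const[of 0] by simp
  next
    case (add q r)
    then show ?case using assms by simp
  qed
  then show ?thesis ..
qed

text \<open>In contrast to \<open>polys_induct\<close> the variable index is unrestricted:
  substitutions that fix the variables beyond \<open>d\<close> are compared on the whole
  type.\<close>

lemma mpoly_induct [case_names const add var]:
  fixes p :: "'k::field mpoly"
  assumes const: "\<And>c. P (const c)"
    and add: "\<And>p q. P p \<Longrightarrow> P q \<Longrightarrow> P (p + q)"
    and var: "\<And>i p. P p \<Longrightarrow> P (var i * p)"
  shows "P p"
proof (induction p rule: poly_single_induct)
  case (single m c)
  show ?case by (rule monomial_induct[of _ UNIV]) (use const var in auto)
next
  case zero
  then show ?case using const[of 0] by simp
next
  case (add q r)
  then show ?case using assms by simp
qed

section \<open>Substitution homomorphisms\<close>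

definition exp_eval :: "(nat \<Rightarrow> ('k::field) mpoly) \<Rightarrow> (nat \<Rightarrow>\<^sub>0 nat) \<Rightarrow> 'k mpoly" where
  "exp_eval g m = (\<Prod>i\<in>supp m. g i ^ coef m i)"

definition subst :: "(nat \<Rightarrow> ('k::field) mpoly) \<Rightarrow> 'k mpoly \<Rightarrow> 'k mpoly" where
  "subst g p = (\<Sum>m\<in>supp p. const (coef p m) * exp_eval g m)"

lemma exp_eval_superset:
  assumes "finite A" "supp m \<subseteq> A"
  shows "exp_eval g m = (\<Prod>i\<in>A. g i ^ coef m i)"
  unfolding exp_eval_def using assms
  by (intro prod.mono_neutral_left) (auto simp: in_keys_iff)

lemma exp_eval_add: "exp_eval g (m + n) = exp_eval g m * exp_eval g n"
  by (simp add: exp_eval_superset[of "supp m \<union> supp n"] exp_keys_add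
    lookup_add power_add prod.distrib)

lemma subst_single: "subst g (monom m c) = const c * exp_eval g m"
  by (simp add: subst_def)

lemma subst_const [simp]: "subst g (const c) = const c"
  unfolding const_def subst_single by (simp add: exp_eval_def)

lemma subst_var [simp]: "subst g (var i) = g i"
  unfolding var_def subst_single by (simp add: exp_eval_def)

lemma subst_add: "subst g (p + q) = subst g p + subst g q"
  unfolding subst_def by (rule setsum_keys_plus_distrib) (simp_all add: const_add algebra_simps)

lemma subst_mult: "subst g (p * q) = subst g p * subst g q"
  by (rule bilinear_eqI[of "\<lambda>p q. subst g (p * q)"])
    (simp_all add: subst_add algebra_simps mult_single subst_single exp_eval_add const_mult)

lemma subst_sum: "subst g (sum f A) = (\<Sum>i\<in>A. subst g (f i))"
  using subst_const[of g 0] by (induction A rule: infinite_finite_induct) (auto simp: subst_add)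

lemma subst_closed:
  assumes "p \<in> polys d" "\<And>i. i \<in> {1..d} \<Longrightarrow> g i \<in> polys d"
  shows "subst g p \<in> polys d"
  using assms(1) by (induction p rule: polys_induct) (auto simp: subst_add subst_mult assms(2))

section \<open>The local ring at the origin\<close>

lemma (in cring) multiplicative_set_complement_prime:
  assumes "primeideal P R"
  shows "multiplicative_set R (carrier R - P)"
proof -
  interpret P: primeideal P R by fact
  show ?thesis
  proof (unfold_locales, goal_cases)
    case 1 then show ?case by blast
  next
    case 2 then show ?case using P.one_imp_carrier P.I_notcarr by blast
  next
    case (3 s t) then show ?case using P.I_prime[of s t] by auto
  qed
qed

lemma (in comm_monoid) Units_r_invI:
  assumes "x \<otimes> y = \<one>" "x \<in> carrier G" "y \<in> carrier G"
  shows "x \<in> Units G"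
  using assms unfolding Units_def mem_Collect_eq by (intro conjI bexI[of _ y]) (simp_all add: m_comm)

text \<open>Used to clear denominators: an element \<open>a\<close> of the local ring is handled
  through an equation \<open>a s = p\<close> between images of polynomials.\<close>

lemma (in cring) common_denominator:
  assumes "a \<in> carrier R" "b \<in> carrier R" "s \<in> carrier R" "t \<in> carrier R"
  shows "(a \<oplus> b) \<otimes> (s \<otimes> t) = (a \<otimes> s) \<otimes> t \<oplus> (b \<otimes> t) \<otimes> s"
    "(a \<otimes> b) \<otimes> (s \<otimes> t) = (a \<otimes> s) \<otimes> (b \<otimes> t)" "(a \<otimes> s) \<otimes> t = (a \<otimes> t) \<otimes> s"
  using assms by algebra+

text \<open>The origin is a zero of \<open>I\<close>. The constant coefficient is therefore well
  defined on the quotient, and its kernel \<open>origin\<close> is the maximal ideal of that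
  point.\<close>

locale centered_ideal =
  fixes d :: nat and I :: "('k::field) mpoly set"
  assumes I: "ideal I (poly_ring d)" and coef_0: "p \<in> I \<Longrightarrow> coef p 0 = 0"
begin

sublocale I: ideal I "poly_ring d" by (rule I)

abbreviation "quot \<equiv> poly_ring d Quot I"

abbreviation coset :: "'k mpoly \<Rightarrow> 'k mpoly set" where "coset p \<equiv> I +>\<^bsub>poly_ring d\<^esub> p"

sublocale quot: cring quot by (rule I.quotient_is_cring[OF cring_poly_ring])

lemma coset_eq_iff: "p \<in> polys d \<Longrightarrow> q \<in> polys d \<Longrightarrow> coset p = coset q \<longleftrightarrow> p - q \<in> I"
  using poly.quotient_eq_iff_same_a_r_cos[OF I, of p q] by (simp add: a_minus_def)

lemma carrier_quot: "carrier quot = coset ` polys d"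
  by (auto simp: FactRing_def A_RCOSETS_def')

lemma coset_hom:
  "p \<in> polys d \<Longrightarrow> q \<in> polys d \<Longrightarrow> coset (p + q) = coset p \<oplus>\<^bsub>quot\<^esub> coset q"
  "p \<in> polys d \<Longrightarrow> q \<in> polys d \<Longrightarrow> coset (p * q) = coset p \<otimes>\<^bsub>quot\<^esub> coset q"
  "coset 1 = \<one>\<^bsub>quot\<^esub>"
  "p \<in> polys d \<Longrightarrow> coset p \<in> carrier quot"
  using I.rcos_ring_hom unfolding ring_hom_def by auto

lemma coset_0: "coset 0 = \<zero>\<^bsub>quot\<^esub>"
  using poly.a_coset_add_zero[of I] I.a_subset coset_hom(1)[of 0 0] coset_hom(4)[of 0]
  by (metis add_0 polys_0 quot.add.l_cancel_one)

lemma coset_eq_0_iff: "p \<in> polys d \<Longrightarrow> coset p = \<zero>\<^bsub>quot\<^esub> \<longleftrightarrow> p \<in> I"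
  using coset_eq_iff[of p 0] coset_0 by simp

lemma coset_unit:
  assumes "c \<noteq> 0" shows "coset (const c) \<in> Units quot"
proof -
  have "const c * const (1 / c) = (1 :: 'k mpoly)"
    using assms by (simp flip: const_mult)
  then have "coset (const c) \<otimes>\<^bsub>quot\<^esub> coset (const (1 / c)) = \<one>\<^bsub>quot\<^esub>"
    by (simp flip: coset_hom)
  then show ?thesis by (rule quot.Units_r_invI) (simp_all add: coset_hom)
qed

definition origin :: "'k mpoly set set" where
  "origin = coset ` {p \<in> polys d. coef p 0 = 0}"

lemma originE:
  assumes "a \<in> origin"
  obtains p where "p \<in> polys d" "coef p 0 = 0" "a = coset p"
  using assms unfolding origin_def by auto

lemma coset_in_origin_iff: "p \<in> polys d \<Longrightarrow> coset p \<in> origin \<longleftrightarrow> coef p 0 = 0"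
proof
  assume p: "p \<in> polys d" and "coset p \<in> origin"
  then obtain q where q: "q \<in> polys d" "coef q 0 = 0" "coset p = coset q"
    by (auto simp: origin_def)
  then show "coef p 0 = 0" using coef_0[of "p - q"] p by (simp add: coset_eq_iff lookup_minus)
qed (auto simp: origin_def)

lemma ideal_origin: "ideal origin quot"
proof (rule idealI[OF quot.ring_axioms])
  have carr: "x \<in> carrier quot" if "x \<in> origin" for x
    using that by (auto simp: origin_def carrier_quot)
  have mult: "x \<otimes>\<^bsub>quot\<^esub> a \<in> origin" if "a \<in> origin" "x \<in> carrier quot" for a x
  proof -
    obtain p where "p \<in> polys d" "coef p 0 = 0" "a = coset p" by (rule originE[OF \<open>a \<in> origin\<close>])
    moreover obtain q where "q \<in> polys d" "x = coset q" using \<open>x \<in> carrier quot\<close> by (auto simp: carrier_quot)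
    ultimately show ?thesis using coset_in_origin_iff[of "q * p"] by (simp add: coset_hom coef_mult_0)
  qed
  then show "x \<otimes>\<^bsub>quot\<^esub> a \<in> origin" "a \<otimes>\<^bsub>quot\<^esub> x \<in> origin"
    if "a \<in> origin" "x \<in> carrier quot" for a x
    using that quot.m_comm[of a x] carr by auto
  show "subgroup origin (add_monoid quot)"
  proof (rule quot.add.subgroupI)
    show "origin \<subseteq> carrier quot" using carr by auto
    show "origin \<noteq> {}" using coset_in_origin_iff[of 0] by auto
    show "\<ominus>\<^bsub>quot\<^esub> a \<in> origin" if "a \<in> origin" for a
    proof -
      have "\<ominus>\<^bsub>quot\<^esub> a = (\<ominus>\<^bsub>quot\<^esub> \<one>\<^bsub>quot\<^esub>) \<otimes>\<^bsub>quot\<^esub> a"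
        using carr[OF that] by (simp add: quot.l_minus)
      then show ?thesis using mult[OF that, of "\<ominus>\<^bsub>quot\<^esub> \<one>\<^bsub>quot\<^esub>"] by simp
    qed
    show "a \<oplus>\<^bsub>quot\<^esub> b \<in> origin" if "a \<in> origin" "b \<in> origin" for a b
    proof -
      obtain p where "p \<in> polys d" "coef p 0 = 0" "a = coset p" by (rule originE[OF \<open>a \<in> origin\<close>])
      moreover obtain q where "q \<in> polys d" "coef q 0 = 0" "b = coset q" by (rule originE[OF \<open>b \<in> origin\<close>])
      ultimately show ?thesis using coset_in_origin_iff[of "p + q"] by (simp add: coset_hom lookup_add)
    qed
  qed
qed

text \<open>An element outside \<open>origin\<close> differs from its nonzero constant term by an
  element of \<open>origin\<close>, so a larger ideal contains a unit.\<close>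

lemma maximalideal_origin: "maximalideal origin quot"
proof (rule maximalidealI[OF ideal_origin])
  have "\<one>\<^bsub>quot\<^esub> \<notin> origin" using coset_in_origin_iff[of 1] by (simp add: coset_hom)
  then show "carrier quot \<noteq> origin" using quot.one_closed by metis
  fix J assume J: "ideal J quot" "origin \<subseteq> J" "J \<subseteq> carrier quot"
  show "J = origin \<or> J = carrier quot"
  proof (cases "J \<subseteq> origin")
    case False
    interpret J: ideal J quot by fact
    from False obtain x where x: "x \<in> J" "x \<notin> origin" by blast
    then obtain p where p: "x = coset p" "p \<in> polys d" using J(3) by (auto simp: carrier_quot)
    let ?c = "const (coef p 0) :: 'k mpoly"
    have ne: "coef p 0 \<noteq> 0" using x p coset_in_origin_iff by auto
    have "coset (?c - p) \<in> J"
      using p J(2) coset_in_origin_iff[of "?c - p"] by (auto simp: lookup_minus coef_const)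
    then have "coset p \<oplus>\<^bsub>quot\<^esub> coset (?c - p) \<in> J" using x p J.a_closed by blast
    then have "coset ?c \<in> J" using p coset_hom(1)[of p "?c - p"] by simp
    moreover have u: "coset ?c \<in> Units quot" by (rule coset_unit[OF ne])
    ultimately have "inv\<^bsub>quot\<^esub> (coset ?c) \<otimes>\<^bsub>quot\<^esub> coset ?c \<in> J"
      by (intro J.I_l_closed quot.Units_inv_closed)
    then have "\<one>\<^bsub>quot\<^esub> \<in> J" using u by simp
    then show ?thesis using J.one_imp_carrier by blast
  qed (use J in blast)
qed

section \<open>The localization at the origin\<close>

sublocale loc: multiplicative_set quot "carrier quot - origin"
  by (rule quot.multiplicative_set_complement_prime[OF quot.maximalideal_prime[OF maximalideal_origin]])

abbreviation "Loc \<equiv> localization quot (carrier quot - origin)"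

definition to_loc :: "'k mpoly \<Rightarrow> ('k mpoly set \<times> 'k mpoly set) set" where
  "to_loc p = fraction quot (carrier quot - origin) (coset p) \<one>\<^bsub>quot\<^esub>"

lemma to_loc_hom:
  "p \<in> polys d \<Longrightarrow> q \<in> polys d \<Longrightarrow> to_loc (p + q) = to_loc p \<oplus>\<^bsub>Loc\<^esub> to_loc q"
  "p \<in> polys d \<Longrightarrow> q \<in> polys d \<Longrightarrow> to_loc (p * q) = to_loc p \<otimes>\<^bsub>Loc\<^esub> to_loc q"
  "to_loc 1 = \<one>\<^bsub>Loc\<^esub>"
  "p \<in> polys d \<Longrightarrow> to_loc p \<in> carrier Loc"
  using loc.fraction_hom coset_hom unfolding ring_hom_def to_loc_def by auto

lemma to_loc_eq_0:
  assumes "p \<in> polys d"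
  shows "to_loc p = \<zero>\<^bsub>Loc\<^esub> \<longleftrightarrow> (\<exists>t\<in>polys d. coef t 0 \<noteq> 0 \<and> t * p \<in> I)"
proof -
  have "to_loc p = \<zero>\<^bsub>Loc\<^esub> \<longleftrightarrow>
      (\<exists>x\<in>carrier quot - origin. x \<otimes>\<^bsub>quot\<^esub> coset p = \<zero>\<^bsub>quot\<^esub>)"
    unfolding to_loc_def using assms by (intro loc.fraction_eq_zero_iff) (simp add: coset_hom)
  also have "\<dots> \<longleftrightarrow> (\<exists>t\<in>polys d. coef t 0 \<noteq> 0 \<and> coset t \<otimes>\<^bsub>quot\<^esub> coset p = \<zero>\<^bsub>quot\<^esub>)"
    unfolding carrier_quot using coset_in_origin_iff by auto
  also have "\<dots> \<longleftrightarrow> (\<exists>t\<in>polys d. coef t 0 \<noteq> 0 \<and> t * p \<in> I)"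
    using assms by (intro bex_cong refl conj_cong) (simp add: coset_eq_0_iff flip: coset_hom(2))
  finally show ?thesis .
qed

lemma loc_ring_fraction:
  assumes "b \<in> carrier Loc"
  obtains p s where "p \<in> polys d" "s \<in> polys d" "coef s 0 \<noteq> 0" "b \<otimes>\<^bsub>Loc\<^esub> to_loc s = to_loc p"
proof -
  obtain x y where xy: "x \<in> carrier quot" "y \<in> carrier quot - origin"
    "b = fraction quot (carrier quot - origin) x y"
    using assms by (auto simp: loc.localization_carrier)
  then obtain p s where ps: "p \<in> polys d" "x = coset p" "s \<in> polys d" "y = coset s"
    by (auto simp: carrier_quot)
  then have "coef s 0 \<noteq> 0" using xy coset_in_origin_iff by auto
  moreover have "b \<otimes>\<^bsub>Loc\<^esub> to_loc s = to_loc p"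
    unfolding to_loc_def using xy ps loc.fraction_mult_denominator by auto
  ultimately show ?thesis using that ps by blast
qed

lemma to_loc_unit:
  assumes "cring Loc" "s \<in> polys d" "coef s 0 \<noteq> 0"
  shows "to_loc s \<in> Units Loc"
proof -
  interpret B: cring Loc by fact
  have s: "coset s \<in> carrier quot - origin" using assms coset_in_origin_iff by (auto simp: coset_hom)
  let ?i = "fraction quot (carrier quot - origin) \<one>\<^bsub>quot\<^esub> (coset s)"
  have "to_loc s \<otimes>\<^bsub>Loc\<^esub> ?i = \<one>\<^bsub>Loc\<^esub>"
    unfolding to_loc_def by (rule loc.fraction_inverse[OF s])
  moreover have "?i \<in> carrier Loc" unfolding loc.localization_carrier using s by blast
  ultimately show ?thesis using to_loc_hom(4)[OF assms(2)] by (intro B.Units_r_invI)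
qed

end

section \<open>Value and gradient on the local ring\<close>

locale singular_ideal = centered_ideal d I for d and I :: "('k::field) mpoly set" +
  assumes coef_1: "p \<in> I \<Longrightarrow> coef p (unit_exp i) = 0"
    and loc_cring: "cring Loc"
begin

sublocale B: cring Loc by (rule loc_cring)

text \<open>If \<open>t p\<close> lies in \<open>I\<close> and \<open>t\<close> is nonzero at the
  origin, then \<open>p\<close> has no constant term, and the Leibniz rule leaves
  \<open>t(0)\<close> times each linear coefficient of \<open>p\<close>. This is where
  \<open>I\<close> must have no terms of degree below two.\<close>

lemma to_loc_eq_0D:
  assumes "p \<in> polys d" "to_loc p = \<zero>\<^bsub>Loc\<^esub>"
  shows "coef p 0 = 0" "coef p (unit_exp i) = 0"
proof -
  obtain t where t: "coef t 0 \<noteq> 0" "t * p \<in> I" using assms to_loc_eq_0 by auto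
  show 0: "coef p 0 = 0" using coef_0[OF t(2)] t(1) by (simp add: coef_mult_0)
  show "coef p (unit_exp i) = 0" using coef_1[OF t(2), of i] t(1) 0 by (simp add: coef_mult_unit_exp)
qed

definition represents where
  "represents b p s \<longleftrightarrow> b \<in> carrier Loc \<and> p \<in> polys d \<and> s \<in> polys d \<and> coef s 0 \<noteq> 0 \<and>
    b \<otimes>\<^bsub>Loc\<^esub> to_loc s = to_loc p"

text \<open>Two representations \<open>p/s\<close> and \<open>q/t\<close> of \<open>b\<close> give
  polynomials \<open>p t\<close> and \<open>q s\<close> with the same image in \<open>Loc\<close>.
  Well-definedness of \<open>ev\<close> and \<open>pd\<close> rests on this.\<close>

lemma represents_cross:
  assumes "represents b p s" "represents b q t"
  shows "coef (p * t) 0 = coef (q * s) 0" "coef (p * t) (unit_exp i) = coef (q * s) (unit_exp i)"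
proof -
  note * = assms[unfolded represents_def]
  have "to_loc (p * t) = b \<otimes>\<^bsub>Loc\<^esub> to_loc s \<otimes>\<^bsub>Loc\<^esub> to_loc t"
    using * by (simp add: to_loc_hom)
  also have "\<dots> = b \<otimes>\<^bsub>Loc\<^esub> to_loc t \<otimes>\<^bsub>Loc\<^esub> to_loc s"
    using * by (intro B.common_denominator(3)[where b = b]) (simp_all add: to_loc_hom)
  also have "\<dots> = to_loc (q * s)" using * by (simp add: to_loc_hom)
  finally have e: "to_loc (p * t) = to_loc (q * s)" .
  have "to_loc (p * t - q * s) \<oplus>\<^bsub>Loc\<^esub> to_loc (q * s) = to_loc (p * t)"
    using * by (simp flip: to_loc_hom)
  then have "to_loc (p * t - q * s) = \<zero>\<^bsub>Loc\<^esub>"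
    using * unfolding e by (metis B.add.r_cancel_one polys_diff polys_mult to_loc_hom(4))
  then show "coef (p * t) 0 = coef (q * s) 0" "coef (p * t) (unit_exp i) = coef (q * s) (unit_exp i)"
    using to_loc_eq_0D[of "p * t - q * s"] * by (auto simp: lookup_minus)
qed

text \<open>Evaluation at the origin and the partial derivatives there extend to the localization.\<close>

definition ev :: "('k mpoly set \<times> 'k mpoly set) set \<Rightarrow> 'k" where
  "ev b = (SOME v. \<exists>p s. represents b p s \<and> v = coef p 0 / coef s 0)"

definition pd :: "nat \<Rightarrow> ('k mpoly set \<times> 'k mpoly set) set \<Rightarrow> 'k" where
  "pd i b = (SOME v. \<exists>p s. represents b p s \<and>
    v = (coef p (unit_exp i) * coef s 0 - coef p 0 * coef s (unit_exp i)) / (coef s 0)\<^sup>2)"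

lemma ev_eq:
  assumes "represents b p s"
  shows "ev b = coef p 0 / coef s 0"
  unfolding ev_def
proof (rule some_equality)
  show "\<exists>q t. represents b q t \<and> coef p 0 / coef s 0 = coef q 0 / coef t 0" using assms by blast
  fix v assume "\<exists>q t. represents b q t \<and> v = coef q 0 / coef t 0"
  then obtain q t where qt: "represents b q t" "v = coef q 0 / coef t 0" by blast
  then show "v = coef p 0 / coef s 0"
    using represents_cross(1)[OF assms qt(1)] assms qt(1)
    by (simp add: represents_def coef_mult_0 frac_eq_eq)
qed

text \<open>The formula is the quotient rule at the origin.\<close>

lemma pd_eq:
  assumes "represents b p s"
  shows "pd i b = (coef p (unit_exp i) * coef s 0 - coef p 0 * coef s (unit_exp i)) / (coef s 0)\<^sup>2"
  unfolding pd_def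
proof (rule some_equality)
  fix v assume "\<exists>q t. represents b q t \<and>
    v = (coef q (unit_exp i) * coef t 0 - coef q 0 * coef t (unit_exp i)) / (coef t 0)\<^sup>2"
  then obtain q t where qt: "represents b q t"
    and v: "v = (coef q (unit_exp i) * coef t 0 - coef q 0 * coef t (unit_exp i)) / (coef t 0)\<^sup>2"
    by blast
  define p0 p1 s0 s1 q0 q1 t0 t1 where
    "p0 = coef p 0" "p1 = coef p (unit_exp i)" "s0 = coef s 0" "s1 = coef s (unit_exp i)"
    "q0 = coef q 0" "q1 = coef q (unit_exp i)" "t0 = coef t 0" "t1 = coef t (unit_exp i)"
  note defs = this
  have ne: "s0 \<noteq> 0" "t0 \<noteq> 0" using assms qt by (auto simp: represents_def defs)
  have e: "p0 * t0 = q0 * s0" "p0 * t1 + p1 * t0 = q0 * s1 + q1 * s0"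
    using represents_cross(1)[OF assms qt] represents_cross(2)[OF assms qt, of i]
    by (simp_all add: defs coef_mult_0 coef_mult_unit_exp)
  \<comment> \<open>The value and the derivative of \<open>p t = q s\<close> at the origin are
    solved for \<open>p0\<close> and \<open>p1\<close> and substituted.\<close>
  have p0: "p0 = q0 * s0 / t0" and p1: "p1 = (q0 * s1 + q1 * s0 - p0 * t1) / t0"
    using e ne by (simp_all add: field_simps)
  have "(q1 * t0 - q0 * t1) / t0\<^sup>2 = (p1 * s0 - p0 * s1) / s0\<^sup>2"
    unfolding p1 p0 using ne by (simp add: field_simps power2_eq_square)
  then show "v = (coef p (unit_exp i) * coef s 0 - coef p 0 * coef s (unit_exp i)) / (coef s 0)\<^sup>2"
    by (simp add: v defs)
qed (use assms in blast)

lemma represents_ex: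
  assumes "b \<in> carrier Loc"
  obtains p s where "represents b p s"
  using assms loc_ring_fraction unfolding represents_def by metis

lemma represents_to_loc: "p \<in> polys d \<Longrightarrow> represents (to_loc p) p 1"
  by (simp add: represents_def to_loc_hom)

lemma ev_to_loc [simp]: "p \<in> polys d \<Longrightarrow> ev (to_loc p) = coef p 0"
  by (simp add: ev_eq[OF represents_to_loc])

lemma pd_to_loc [simp]: "p \<in> polys d \<Longrightarrow> pd i (to_loc p) = coef p (unit_exp i)"
  by (simp add: pd_eq[OF represents_to_loc] lookup_one)

lemma represents_add:
  assumes "represents a p s" "represents b q t"
  shows "represents (a \<oplus>\<^bsub>Loc\<^esub> b) (p * t + q * s) (s * t)"
proof -
  note * = assms[unfolded represents_def]
  have "(a \<oplus>\<^bsub>Loc\<^esub> b) \<otimes>\<^bsub>Loc\<^esub> (to_loc s \<otimes>\<^bsub>Loc\<^esub> to_loc t) =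
    (a \<otimes>\<^bsub>Loc\<^esub> to_loc s) \<otimes>\<^bsub>Loc\<^esub> to_loc t \<oplus>\<^bsub>Loc\<^esub> (b \<otimes>\<^bsub>Loc\<^esub> to_loc t) \<otimes>\<^bsub>Loc\<^esub> to_loc s"
    using * by (intro B.common_denominator(1)) (simp_all add: to_loc_hom)
  then show ?thesis using * unfolding represents_def by (simp add: to_loc_hom coef_mult_0)
qed

lemma represents_mult:
  assumes "represents a p s" "represents b q t"
  shows "represents (a \<otimes>\<^bsub>Loc\<^esub> b) (p * q) (s * t)"
proof -
  note * = assms[unfolded represents_def]
  have "(a \<otimes>\<^bsub>Loc\<^esub> b) \<otimes>\<^bsub>Loc\<^esub> (to_loc s \<otimes>\<^bsub>Loc\<^esub> to_loc t) =
    (a \<otimes>\<^bsub>Loc\<^esub> to_loc s) \<otimes>\<^bsub>Loc\<^esub> (b \<otimes>\<^bsub>Loc\<^esub> to_loc t)"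
    using * by (intro B.common_denominator(2)) (simp_all add: to_loc_hom)
  then show ?thesis using * unfolding represents_def by (simp add: to_loc_hom coef_mult_0)
qed

lemma ev_pd_hom:
  assumes "a \<in> carrier Loc" "b \<in> carrier Loc"
  shows "ev (a \<oplus>\<^bsub>Loc\<^esub> b) = ev a + ev b" "ev (a \<otimes>\<^bsub>Loc\<^esub> b) = ev a * ev b"
    "pd i (a \<oplus>\<^bsub>Loc\<^esub> b) = pd i a + pd i b"
    "pd i (a \<otimes>\<^bsub>Loc\<^esub> b) = ev a * pd i b + pd i a * ev b"
proof -
  obtain p s where r1: "represents a p s" by (rule represents_ex[OF assms(1)])
  obtain q t where r2: "represents b q t" by (rule represents_ex[OF assms(2)])
  have ne: "coef s 0 \<noteq> 0" "coef t 0 \<noteq> 0" using r1 r2 by (auto simp: represents_def)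
  note r = represents_add[OF r1 r2] represents_mult[OF r1 r2]
  show "ev (a \<oplus>\<^bsub>Loc\<^esub> b) = ev a + ev b" "ev (a \<otimes>\<^bsub>Loc\<^esub> b) = ev a * ev b"
    unfolding ev_eq[OF r(1)] ev_eq[OF r(2)] ev_eq[OF r1] ev_eq[OF r2]
    using ne by (simp_all add: coef_mult_0 lookup_add field_simps)
  show "pd i (a \<oplus>\<^bsub>Loc\<^esub> b) = pd i a + pd i b"
    unfolding pd_eq[OF r(1)] pd_eq[OF r1] pd_eq[OF r2]
    using ne by (simp add: coef_mult_0 coef_mult_unit_exp lookup_add field_simps power2_eq_square)
  show "pd i (a \<otimes>\<^bsub>Loc\<^esub> b) = ev a * pd i b + pd i a * ev b"
    unfolding pd_eq[OF r(2)] pd_eq[OF r1] pd_eq[OF r2] ev_eq[OF r1] ev_eq[OF r2]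
    using ne by (simp add: coef_mult_0 coef_mult_unit_exp field_simps power2_eq_square)
qed

lemma ev_minus:
  assumes "a \<in> carrier Loc" "b \<in> carrier Loc"
  shows "ev (a \<ominus>\<^bsub>Loc\<^esub> b) = ev a - ev b"
proof -
  have "(a \<ominus>\<^bsub>Loc\<^esub> b) \<oplus>\<^bsub>Loc\<^esub> b = a" using assms by (simp add: B.minus_eq B.a_assoc B.l_neg)
  then show ?thesis using ev_pd_hom(1)[of "a \<ominus>\<^bsub>Loc\<^esub> b" b] assms by simp
qed

lemma ev_0: "ev \<zero>\<^bsub>Loc\<^esub> = 0"
  using ev_pd_hom(1)[of "\<zero>\<^bsub>Loc\<^esub>" "\<zero>\<^bsub>Loc\<^esub>"]
  by (metis B.l_zero B.zero_closed add_cancel_right_right)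

lemma ev_unit:
  assumes "a \<in> carrier Loc" "ev a \<noteq> 0"
  shows "a \<in> Units Loc"
proof -
  obtain p s where r: "represents a p s" by (rule represents_ex[OF assms(1)])
  then have "coef p 0 \<noteq> 0" using ev_eq[OF r] assms by auto
  then have p: "to_loc p \<in> Units Loc"
    using r to_loc_unit[OF loc_cring] by (simp add: represents_def)
  have s: "to_loc s \<in> carrier Loc" "a \<otimes>\<^bsub>Loc\<^esub> to_loc s = to_loc p"
    using r by (simp_all add: represents_def to_loc_hom)
  have "a \<otimes>\<^bsub>Loc\<^esub> (to_loc s \<otimes>\<^bsub>Loc\<^esub> inv\<^bsub>Loc\<^esub> to_loc p) = \<one>\<^bsub>Loc\<^esub>"
    using p s assms(1) by (metis B.Units_inv_closed B.Units_r_inv B.m_assoc)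
  then show ?thesis by (rule B.Units_r_invI) (use p s assms(1) in simp_all)
qed

definition M where "M = {b \<in> carrier Loc. ev b = 0}"

lemma outside_M_unit: "carrier Loc - M \<subseteq> Units Loc"
proof
  fix b assume "b \<in> carrier Loc - M"
  then have "b \<in> carrier Loc" "ev b \<noteq> 0" unfolding M_def by blast+
  then show "b \<in> Units Loc" by (rule ev_unit)
qed

lemma ideal_M: "ideal M Loc"
proof (rule idealI[OF B.ring_axioms])
  show "subgroup M (add_monoid Loc)"
  proof (rule B.add.subgroupI)
    show "\<ominus>\<^bsub>Loc\<^esub> a \<in> M" if "a \<in> M" for a
      using that ev_minus[of "\<zero>\<^bsub>Loc\<^esub>" a] by (simp add: M_def B.minus_eq ev_0)
    show "M \<noteq> {}" using ev_0 by (auto simp: M_def)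
  qed (auto simp: M_def ev_pd_hom)
qed (auto simp: M_def ev_pd_hom)

text \<open>The derivative in direction \<open>i\<close>, which is nonzero on \<open>u\<close>,
  splits off the residue field spanned by \<open>u\<close>. The variable \<open>j\<close> lies in
  \<open>M\<close>, is nonzero in \<open>Loc\<close>, and has component zero along
  \<open>u\<close>.\<close>

lemma not_finite_injective_dimension:
  assumes u: "u \<in> polys d" "coef u 0 = 0" "coef u (unit_exp i) \<noteq> 0"
    and uI: "\<And>j. j \<in> {1..d} \<Longrightarrow> u * var j \<in> I"
    and j: "j \<in> {1..d}" "j \<noteq> i"
  shows "\<not> finite_injective_dimension Loc (self_module Loc)"
proof -
  \<comment> \<open>Multiplication by \<open>u\<close> sees only the constant term:
    \<open>u p\<close> is congruent to \<open>p(0) u\<close> modulo \<open>I\<close>.\<close>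
  have uI': "u * (p - const (coef p 0)) \<in> I" if "p \<in> polys d" for p
    using that
  proof (induction p rule: polys_induct)
    case (const c)
    then show ?case using ideal_poly_ringD(2)[OF I] by (simp add: coef_const)
  next
    case (add p q)
    then have "u * (p - const (coef p 0)) + u * (q - const (coef q 0)) \<in> I"
      by (intro ideal_poly_ringD(3)[OF I])
    then show ?case by (simp add: lookup_add const_add algebra_simps)
  next
    case (var i p)
    then have "p * (u * var i) \<in> I" by (intro ideal_poly_ringD(4)[OF I] uI)
    then show ?case by (simp add: coef_mult_0 coef_var algebra_simps)
  qed
  \<comment> \<open>Dividing by the derivative of \<open>u\<close> normalizes the component of
    \<open>u\<close> to 1.\<close>
  define c where "c b = to_loc (const (pd i b / coef u (unit_exp i)))" for b
  have cc: "c b \<in> carrier Loc" for b unfolding c_def by (rule to_loc_hom(4)) simp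
  have ev_c: "ev (c b) = pd i b / coef u (unit_exp i)" for b
    unfolding c_def by (simp add: coef_const)
  have y_in_M: "to_loc (var j) \<in> M" "c (to_loc (var j)) \<in> M"
    using cc[of "to_loc (var j)"] j by (simp_all add: M_def to_loc_hom coef_var ev_c)
  note hu = u
  interpret residue_summand Loc M "to_loc u" c
  proof (intro residue_summand.intro residue_summand_axioms.intro loc_cring, goal_cases)
    case 1 show ?case by (rule ideal_M)
  next
    case 2 show ?case using u by (simp add: M_def to_loc_hom)
  next
    case (3 a)
    then have a: "a \<in> carrier Loc" "ev a = 0" by (auto simp: M_def)
    obtain p s where r: "represents a p s" by (rule represents_ex[OF a(1)])
    then have r': "p \<in> polys d" "s \<in> polys d" "coef s 0 \<noteq> 0" "a \<otimes>\<^bsub>Loc\<^esub> to_loc s = to_loc p"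
      by (auto simp: represents_def)
    \<comment> \<open>From \<open>a s = p\<close> with \<open>p\<close> vanishing at the origin,
      \<open>a u s = p u = 0\<close>, and the unit \<open>s\<close> cancels.\<close>
    have "coef p 0 = 0" using ev_eq[OF r] a r' by simp
    then have "u * p \<in> I" using uI'[OF r'(1)] by simp
    then have "to_loc (u * p) = \<zero>\<^bsub>Loc\<^esub>"
      using to_loc_eq_0[of "u * p"] u r' by (auto intro!: bexI[of _ 1])
    moreover have "(a \<otimes>\<^bsub>Loc\<^esub> to_loc u) \<otimes>\<^bsub>Loc\<^esub> to_loc s = to_loc p \<otimes>\<^bsub>Loc\<^esub> to_loc u"
      using B.common_denominator(3)[of a _ "to_loc u" "to_loc s"] a r' u to_loc_hom(4) by metis
    ultimately have "(a \<otimes>\<^bsub>Loc\<^esub> to_loc u) \<otimes>\<^bsub>Loc\<^esub> to_loc s = \<zero>\<^bsub>Loc\<^esub>"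
      using u r' to_loc_hom(2)[of p u] by (simp add: mult.commute)
    moreover have "to_loc s \<in> Units Loc" using to_loc_unit[OF loc_cring r'(2,3)] .
    moreover have "a \<otimes>\<^bsub>Loc\<^esub> to_loc u \<in> carrier Loc" using a u by (simp add: to_loc_hom)
    ultimately show ?case by (metis B.Units_closed B.Units_inv_closed B.Units_r_inv B.l_null B.m_assoc B.r_one)
  next
    case (4 a) show ?case by (rule cc)
  next
    case (5 a b) then show ?case
      using cc by (simp add: M_def ev_minus ev_pd_hom ev_c add_divide_distrib)
  next
    \<comment> \<open>By the Leibniz rule the derivative of \<open>a b\<close> is the value of
      \<open>a\<close> times the derivative of \<open>b\<close>, since \<open>b\<close> vanishes at
      the origin.\<close>
    case (6 a b) then show ?case
      using cc by (simp add: M_def ev_minus ev_pd_hom ev_c)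
  next
    case 7 show ?case
      using cc u to_loc_hom(3) ev_to_loc[of 1] by (simp add: M_def ev_minus ev_c)
  qed
  show ?thesis
  proof (rule infinite_injective_dimension)
    show "carrier Loc - M \<subseteq> Units Loc" by (rule outside_M_unit)
    show "to_loc u \<noteq> \<zero>\<^bsub>Loc\<^esub>" using to_loc_eq_0D(2)[OF hu(1)] hu(3) by metis
    show "to_loc (var j) \<in> M" "c (to_loc (var j)) \<in> M" by (fact y_in_M)+
    show "to_loc (var j) \<noteq> \<zero>\<^bsub>Loc\<^esub>"
      using to_loc_eq_0D(2)[OF polys_var[OF j(1)]] by (metis coef_var zero_neq_one)
  qed
qed

end

text \<open>The predicate \<open>module\<close> includes that the scalars form a commutative ring.
  So for \<open>Loc\<close> the ring axioms come with the assumed resolution.\<close>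

lemma finite_injective_dimension_cring:
  assumes "finite_injective_dimension B N" shows "cring B"
proof -
  obtain \<eta> and E :: "nat \<Rightarrow> ('a, 'a list) module" and \<delta> where "injective_resolution B N \<eta> E \<delta>"
    using assms unfolding finite_injective_dimension_def by blast
  then have "module B (E 0)" by (simp add: injective_resolution_def injective_module_def)
  then show ?thesis by (rule module.axioms(1))
qed

text \<open>The second variable \<open>j\<close> is essential: \<open>K[x]/(x^2)\<close> is
  Gorenstein although its element \<open>x\<close> is killed by \<open>x\<close>.\<close>

lemma not_gorenstein_ideal:
  fixes I :: "'k::field mpoly set"
  assumes I: "ideal I (poly_ring d)"
    and low: "\<And>p. p \<in> I \<Longrightarrow> coef p 0 = 0" "\<And>p i. p \<in> I \<Longrightarrow> coef p (unit_exp i) = 0"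
    and u: "u \<in> polys d" "coef u 0 = 0" "coef u (unit_exp i) \<noteq> 0"
    and uI: "\<And>j. j \<in> {1..d} \<Longrightarrow> u * var j \<in> I"
    and j: "j \<in> {1..d}" "j \<noteq> i"
  shows "\<not> gorenstein_ideal (poly_ring d) I"
proof
  assume g: "gorenstein_ideal (poly_ring d) I"
  interpret centered_ideal d I by (rule centered_ideal.intro[OF I low(1)])
  have fin: "finite_injective_dimension Loc (self_module Loc)"
    using g maximalideal_origin by (simp add: gorenstein_ideal_def gorenstein_ring_def Let_def)
  interpret singular_ideal d I
    by (intro singular_ideal.intro singular_ideal_axioms.intro centered_ideal_axioms low(2)
      finite_injective_dimension_cring[OF fin])
  show False using not_finite_injective_dimension[OF u uI j] fin by blast
qed

section \<open>A criterion for Gorenstein ideals\<close>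

interpretation vec: vector_space "(\<lambda>c p. const c * p) :: 'k::field \<Rightarrow> 'k mpoly \<Rightarrow> 'k mpoly"
  by unfold_locales (simp_all add: const_add const_mult algebra_simps)

lemma subspace_polysI:
  assumes "0 \<in> W" "\<And>p q. p \<in> W \<Longrightarrow> q \<in> W \<Longrightarrow> p + q \<in> W" "\<And>c p. p \<in> W \<Longrightarrow> const c * p \<in> W"
  shows "vec.subspace W"
  unfolding vec.subspace_def using assms by blast

lemma subspace_ideal: "ideal J (poly_ring d) \<Longrightarrow> vec.subspace J"
  by (rule subspace_polysI) (auto simp: ideal_poly_ringD)

text \<open>The quotient is a Frobenius algebra with trace \<open>tr\<close>: the map from the
  quotient to its dual is injective by \<open>nondegenerate\<close> and onto by
  \<open>represented\<close>. Furthermore \<open>nilpotent\<close> makes the quotient local, and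
  \<open>spanning\<close> makes it finite-dimensional.\<close>

locale frobenius_ideal = centered_ideal d I for d and I :: "('k::field) mpoly set" +
  fixes tr :: "'k mpoly \<Rightarrow> 'k" and D :: "'k mpoly set"
  assumes tr_add: "tr (p + q) = tr p + tr q"
    and tr_scale: "tr (const c * p) = c * tr p"
    and tr_I: "p \<in> I \<Longrightarrow> tr p = 0"
    and nondegenerate: "p \<in> polys d \<Longrightarrow> (\<And>q. q \<in> polys d \<Longrightarrow> tr (q * p) = 0) \<Longrightarrow> p \<in> I"
    and represented: "(\<And>p q. p \<in> polys d \<Longrightarrow> q \<in> polys d \<Longrightarrow> \<psi> (p + q) = \<psi> p + \<psi> q) \<Longrightarrow>
      (\<And>c p. p \<in> polys d \<Longrightarrow> \<psi> (const c * p) = c * \<psi> p) \<Longrightarrow> (\<And>p. p \<in> I \<Longrightarrow> \<psi> p = 0) \<Longrightarrow>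
      \<exists>p\<in>polys d. \<forall>q\<in>polys d. \<psi> q = tr (q * p)"
    and nilpotent: "p \<in> polys d \<Longrightarrow> coef p 0 = 0 \<Longrightarrow> p ^ 3 \<in> I"
    and finite_D: "finite D"
    and spanning: "p \<in> polys d \<Longrightarrow> \<exists>v\<in>vec.span D. p - v \<in> I"
begin

text \<open>A prime contains the nilpotent classes of all polynomials vanishing at the origin, so a
  class outside \<open>P\<close> has a nonzero constant term.\<close>

lemma outside_maximal_unit:
  assumes "maximalideal P quot"
  shows "carrier quot - P \<subseteq> Units quot"
proof
  fix x assume x: "x \<in> carrier quot - P"
  then obtain p where p: "p \<in> polys d" "x = coset p" by (auto simp: carrier_quot)
  interpret P: primeideal P quot by (rule quot.maximalideal_prime[OF assms])
  define c where "c = coef p 0"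
  have "c \<noteq> 0"
  proof
    assume "c = 0"
    then have "p ^ 3 \<in> I" using nilpotent p by (simp add: c_def)
    then have "coset (p * (p * p)) = \<zero>\<^bsub>quot\<^esub>"
      using p by (simp add: coset_eq_0_iff power3_eq_cube mult.assoc)
    then have "x \<otimes>\<^bsub>quot\<^esub> (x \<otimes>\<^bsub>quot\<^esub> x) \<in> P"
      using p P.zero_closed by (simp add: coset_hom)
    then have "x \<in> P" using x P.I_prime[of x "x \<otimes>\<^bsub>quot\<^esub> x"] P.I_prime[of x x] by auto
    then show False using x by simp
  qed
  define n where "n = const c - p"
  have n: "n \<in> polys d" "coef n 0 = 0" using p by (simp_all add: n_def lookup_minus coef_const c_def)
  \<comment> \<open>With \<open>p = c - n\<close> and \<open>n^3\<close> in \<open>I\<close> this is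
    a truncated geometric series: \<open>(c - n) (c^2 + c n + n^2) = c^3 - n^3\<close>.\<close>
  define q where "q = const c ^ 2 + const c * n + n ^ 2"
  have q: "q \<in> polys d" using n by (simp add: q_def)
  have pn: "p = const c - n" by (simp add: n_def)
  have "const (c ^ 3) - p * q = n ^ 3"
  proof -
    have "k ^ 3 - (k - n) * (k ^ 2 + k * n + n ^ 2) = n ^ 3" for k :: "'k mpoly"
      by (simp add: power2_eq_square power3_eq_cube algebra_simps)
    moreover have "const (c ^ 3) = const c ^ 3" by (simp add: power3_eq_cube const_mult)
    ultimately show ?thesis unfolding q_def pn by simp
  qed
  then have "coset (const (c ^ 3)) = coset (p * q)"
    using nilpotent[OF n] p q by (subst coset_eq_iff) simp_all
  then have eq: "coset (const (c ^ 3)) = x \<otimes>\<^bsub>quot\<^esub> coset q" using p q by (simp add: coset_hom)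
  have u: "coset (const (c ^ 3)) \<in> Units quot" using coset_unit[of "c ^ 3"] \<open>c \<noteq> 0\<close> by simp
  have qc: "coset q \<in> carrier quot" using q by (rule coset_hom(4))
  have "x \<otimes>\<^bsub>quot\<^esub> (coset q \<otimes>\<^bsub>quot\<^esub> inv\<^bsub>quot\<^esub> coset (const (c ^ 3))) = \<one>\<^bsub>quot\<^esub>"
    using u qc x eq quot.Units_r_inv[OF u] quot.m_assoc[of x "coset q" "inv\<^bsub>quot\<^esub> coset (const (c ^ 3))"]
    by simp
  then show "x \<in> Units quot" by (rule quot.Units_r_invI) (use u qc x in simp_all)
qed

text \<open>An ideal of the quotient is a subspace of a finite-dimensional space, so finitely many
  elements span it. They are chosen among representatives in the span of \<open>D\<close>.\<close>

lemma noetherian_quot: "noetherian_ring quot"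
proof (rule quot.noetherian_ringI)
  fix J assume J: "ideal J quot"
  interpret J: ideal J quot by fact
  define J' where "J' = {p \<in> polys d. coset p \<in> J}"
  have J'_diff: "p - q \<in> J'" if "p \<in> J'" "q \<in> I" for p q
  proof -
    have "q \<in> polys d" using that ideal_poly_ringD(1)[OF I] by blast
    moreover from this have "coset (p - q) = coset p"
      using that by (subst coset_eq_iff) (auto simp: J'_def ideal_poly_ringD(5)[OF I])
    ultimately show ?thesis using that by (simp add: J'_def)
  qed
  obtain B where B: "B \<subseteq> J' \<inter> vec.span D" "vec.independent B" "J' \<inter> vec.span D \<subseteq> vec.span B"
    by (rule vec.maximal_independent_subset)
  have fin: "finite B" using vec.independent_span_bound[OF finite_D B(2)] B(1) by blast
  have sub: "coset ` B \<subseteq> carrier quot" using B(1) by (auto simp: J'_def intro: coset_hom(4))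
  have "J = Idl\<^bsub>quot\<^esub> (coset ` B)"
  proof
    show "Idl\<^bsub>quot\<^esub> (coset ` B) \<subseteq> J"
      by (rule quot.genideal_minimal[OF J]) (use B(1) in \<open>auto simp: J'_def\<close>)
    interpret G: ideal "Idl\<^bsub>quot\<^esub> (coset ` B)" quot by (rule quot.genideal_ideal[OF sub])
    have G0: "coset ` B \<subseteq> Idl\<^bsub>quot\<^esub> (coset ` B)" by (rule quot.genideal_self[OF sub])
    define W where "W = {p \<in> polys d. coset p \<in> Idl\<^bsub>quot\<^esub> (coset ` B)}"
    have "vec.subspace W"
      by (rule subspace_polysI)
        (auto simp: W_def coset_hom coset_0 G.zero_closed intro: G.a_closed G.I_l_closed coset_hom(4))
    moreover have "B \<subseteq> W" using B(1) G0 by (auto simp: W_def J'_def)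
    ultimately have W: "vec.span B \<subseteq> W" by (intro vec.span_minimal)
    show "J \<subseteq> Idl\<^bsub>quot\<^esub> (coset ` B)"
    proof
      fix x assume x: "x \<in> J"
      then obtain p where p: "p \<in> polys d" "x = coset p" using J.Icarr[OF x] by (auto simp: carrier_quot)
      then obtain v where v: "v \<in> vec.span D" "p - v \<in> I" using spanning by blast
      have "p - (p - v) \<in> J'" using p x v(2) by (intro J'_diff) (auto simp: J'_def)
      then have "v \<in> J'" by simp
      then have "v \<in> W" using v(1) B(3) W by blast
      moreover have "coset p = coset v"
        using v(2) p \<open>v \<in> J'\<close> by (subst coset_eq_iff) (auto simp: J'_def)
      ultimately show "x \<in> Idl\<^bsub>quot\<^esub> (coset ` B)" using p by (simp add: W_def)
    qed
  qed
  then show "\<exists>A\<subseteq>carrier quot. finite A \<and> J = Idl\<^bsub>quot\<^esub> A" using sub fin by blast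
qed

text \<open>Stated for every isomorphic copy of the quotient, so that it applies directly to the
  localizations, which live on another type.\<close>

lemma self_injective_iso:
  assumes B: "cring B" and h: "h \<in> ring_iso quot B"
  shows "finite_injective_dimension B (self_module B)"
proof -
  interpret B: cring B by fact
  define \<phi> where "\<phi> p = h (coset p)" for p
  have \<phi>_closed: "\<phi> p \<in> carrier B" if "p \<in> polys d" for p
    using h that coset_hom(4) by (auto simp: \<phi>_def ring_iso_def ring_hom_def)
  have \<phi>_hom: "\<phi> (p + q) = \<phi> p \<oplus>\<^bsub>B\<^esub> \<phi> q" "\<phi> (p * q) = \<phi> p \<otimes>\<^bsub>B\<^esub> \<phi> q"
    if "p \<in> polys d" "q \<in> polys d" for p q
    using h that coset_hom by (simp_all add: \<phi>_def ring_iso_def ring_hom_def)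
  have \<phi>_1: "\<phi> 1 = \<one>\<^bsub>B\<^esub>" using h coset_hom(3) by (simp add: \<phi>_def ring_iso_def ring_hom_def)
  have \<phi>_eq: "\<phi> p = \<phi> q \<longleftrightarrow> p - q \<in> I" if "p \<in> polys d" "q \<in> polys d" for p q
  proof -
    have "inj_on h (carrier quot)" using h by (simp add: ring_iso_def bij_betw_def)
    then have "\<phi> p = \<phi> q \<longleftrightarrow> coset p = coset q"
      unfolding \<phi>_def using coset_hom(4) that by (simp add: inj_on_eq_iff)
    then show ?thesis using coset_eq_iff that by simp
  qed
  have \<phi>_0: "\<phi> p = \<zero>\<^bsub>B\<^esub> \<longleftrightarrow> p \<in> I" if "p \<in> polys d" for p
  proof -
    have "\<phi> 0 \<oplus>\<^bsub>B\<^esub> \<phi> 0 = \<phi> 0" using \<phi>_hom(1)[of 0 0] by simp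
    then have "\<phi> 0 = \<zero>\<^bsub>B\<^esub>" using \<phi>_closed[of 0] by simp
    then show ?thesis using \<phi>_eq[OF that, of 0] by simp
  qed
  have surj: "\<exists>p\<in>polys d. b = \<phi> p" if "b \<in> carrier B" for b
  proof -
    have "carrier B = h ` coset ` polys d"
      using h carrier_quot by (simp add: ring_iso_def bij_betw_def)
    then show ?thesis using that by (auto simp: \<phi>_def)
  qed
  interpret scalars B "\<lambda>c. \<phi> (const c)"
  proof (intro scalars.intro scalars_axioms.intro B)
    show "\<phi> (const c) \<in> carrier B" for c by (rule \<phi>_closed) simp
    show "\<phi> (const (a + b)) = \<phi> (const a) \<oplus>\<^bsub>B\<^esub> \<phi> (const b)" for a b
      by (simp add: const_add \<phi>_hom)
    show "\<phi> (const (a * b)) = \<phi> (const a) \<otimes>\<^bsub>B\<^esub> \<phi> (const b)" for a b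
      by (simp add: const_mult \<phi>_hom)
    show "\<phi> (const 1) = \<one>\<^bsub>B\<^esub>" by (simp add: \<phi>_1)
  qed
  \<comment> \<open>The trace is carried to \<open>B\<close> through arbitrary representatives;
    since \<open>tr\<close> vanishes on \<open>I\<close>, the choice does not matter.\<close>
  define T where "T b = tr (SOME p. p \<in> polys d \<and> b = \<phi> p)" for b
  have T: "T (\<phi> p) = tr p" if p: "p \<in> polys d" for p
  proof -
    let ?q = "SOME q. q \<in> polys d \<and> \<phi> p = \<phi> q"
    have q: "?q \<in> polys d \<and> \<phi> p = \<phi> ?q" by (rule someI[of _ p]) (use p in simp)
    then have "p - ?q \<in> I" using \<phi>_eq p by blast
    then have "tr (p - ?q) = 0" by (rule tr_I)
    then show ?thesis using tr_add[of "p - ?q" ?q] by (simp add: T_def)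
  qed
  have "injective_module B (list_module B)"
  proof (rule injective_list_module[of T])
    show "functional (self_module B) (carrier B) T"
      unfolding functional_def self_module_simps
    proof (intro conjI ballI allI)
      fix x y assume "x \<in> carrier B" "y \<in> carrier B"
      then obtain p q where pq: "p \<in> polys d" "x = \<phi> p" "q \<in> polys d" "y = \<phi> q" using surj by metis
      then have "T (\<phi> (p + q)) = T (\<phi> p) + T (\<phi> q)" by (simp only: T polys_add tr_add)
      then show "T (x \<oplus>\<^bsub>B\<^esub> y) = T x + T y" using pq by (simp only: \<phi>_hom)
    next
      fix c x assume "x \<in> carrier B"
      then obtain p where p: "p \<in> polys d" "x = \<phi> p" using surj by metis
      then have "T (\<phi> (const c * p)) = c * T (\<phi> p)" by (simp only: T polys_mult polys_const tr_scale)
      then show "T (\<phi> (const c) \<otimes>\<^bsub>B\<^esub> x) = c * T x" using p by (simp only: \<phi>_hom polys_const)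
    qed
  next
    fix x assume x: "x \<in> carrier B" and z: "\<And>y. y \<in> carrier B \<Longrightarrow> T (y \<otimes>\<^bsub>B\<^esub> x) = 0"
    obtain p where p: "p \<in> polys d" "x = \<phi> p" using surj x by metis
    have "tr (q * p) = 0" if "q \<in> polys d" for q
      using z[OF \<phi>_closed[OF that]] p that T[of "q * p"] by (simp add: \<phi>_hom)
    then have "p \<in> I" using p nondegenerate by blast
    then show "x = \<zero>\<^bsub>B\<^esub>" using \<phi>_0 p by blast
  next
    fix \<psi> assume \<psi>: "functional (self_module B) (carrier B) \<psi>"
    have "\<exists>p\<in>polys d. \<forall>q\<in>polys d. \<psi> (\<phi> q) = tr (q * p)"
    proof (rule represented)
      show "\<psi> (\<phi> (p + q)) = \<psi> (\<phi> p) + \<psi> (\<phi> q)" if "p \<in> polys d" "q \<in> polys d" for p q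
        using \<psi> that \<phi>_closed by (simp add: functional_def \<phi>_hom)
      show sc: "\<psi> (\<phi> (const c * p)) = c * \<psi> (\<phi> p)" if "p \<in> polys d" for c p
        using \<psi> that \<phi>_closed by (simp add: functional_def \<phi>_hom)
      show "\<psi> (\<phi> p) = 0" if "p \<in> I" for p
      proof -
        have p: "p \<in> polys d" using that ideal_poly_ringD(1)[OF I] by blast
        have "\<phi> p = \<phi> (const 0 * p)" using \<phi>_0[OF p] \<phi>_0[of 0] that ideal_poly_ringD(2)[OF I] by simp
        then show ?thesis using sc[OF p, of 0] by simp
      qed
    qed
    then obtain p where p: "p \<in> polys d" "\<forall>q\<in>polys d. \<psi> (\<phi> q) = tr (q * p)" by blast
    have "\<psi> y = T (y \<otimes>\<^bsub>B\<^esub> \<phi> p)" if y: "y \<in> carrier B" for y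
    proof -
      obtain q where q: "q \<in> polys d" "y = \<phi> q" using surj y by metis
      then have "\<psi> y = T (\<phi> (q * p))" using p T[of "q * p"] by simp
      then show ?thesis using p q by (simp add: \<phi>_hom)
    qed
    then show "\<exists>x\<in>carrier B. \<forall>y\<in>carrier B. \<psi> y = T (y \<otimes>\<^bsub>B\<^esub> x)"
      by (intro bexI[of _ "\<phi> p"] ballI \<phi>_closed[OF p(1)])
  qed
  then show ?thesis by (rule finite_injective_dimension_self_injective[OF B])
qed

lemma gorenstein: "gorenstein_ideal (poly_ring d) I"
proof -
  have "finite_injective_dimension (localization quot (carrier quot - P))
      (self_module (localization quot (carrier quot - P)))" if P: "maximalideal P quot" for P
  proof -
    interpret L: multiplicative_set quot "carrier quot - P"
      by (rule quot.multiplicative_set_complement_prime[OF quot.maximalideal_prime[OF P]])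
    show ?thesis
      using self_injective_iso L.localization_at_units[OF outside_maximal_unit[OF P]] by blast
  qed
  then show ?thesis
    using I quot.is_cring noetherian_quot
    by (simp add: gorenstein_ideal_def gorenstein_ring_def Let_def)
qed

end

section \<open>The ideals with signs\<close>

lemma coef_var_simps [simp]:
  "coef (var i) 0 = 0" "coef (var i) (unit_exp j) = (if i = j then 1 else 0)"
  "coef (var i) (monom j 2) = 0"
proof -
  show "coef (var i) (monom j 2) = 0"
    unfolding coef_var by (metis deg_single deg_unit_exp one_eq_numeral_iff semiring_norm(85))
qed (auto simp: coef_var)

lemma coef_const_simps [simp]:
  "coef (const c) 0 = c" "coef (const c) (unit_exp j) = 0"
  "coef (const c) (monom j 2) = 0"
proof -
  show "coef (const c) (monom j 2) = 0"
    unfolding coef_const by (metis deg_single deg_zero zero_neq_numeral)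
qed (auto simp: coef_const)

text \<open>The functional on quadrics that vanishes on the generators of the ideal with signs
  \<open>\<epsilon> k = - e k\<close> and is \<open>1\<close> at \<open>var 1 ^ 2\<close>.\<close>

definition square_functional :: "nat \<Rightarrow> (nat \<Rightarrow> 'k::field) \<Rightarrow> 'k mpoly \<Rightarrow> 'k" where
  "square_functional d e p = (\<Sum>i\<in>{1..d}. e i * coef p (monom i 2))"

lemma square_functional_add:
  "square_functional d e (p + q) = square_functional d e p + square_functional d e q"
  by (simp add: square_functional_def lookup_add algebra_simps sum.distrib)

lemma square_functional_scale: "square_functional d e (const c * p) = c * square_functional d e p"
  by (simp add: square_functional_def sum_distrib_left mult.left_commute)

text \<open>In the trace form the constants are paired with the degree-two part, and the variables
  are mutually orthogonal with \<open>e i\<close> on the diagonal.\<close>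

lemma square_functional_mult:
  "square_functional d e (p * q) = coef p 0 * square_functional d e q +
    (\<Sum>i\<in>{1..d}. e i * coef p (unit_exp i) * coef q (unit_exp i)) +
    coef q 0 * square_functional d e p"
  by (simp add: square_functional_def coef_mult_square algebra_simps sum.distrib sum_distrib_left)

lemma square_functional_var_mult:
  assumes "i \<in> {1..d}"
  shows "square_functional d e (var i * p) = e i * coef p (unit_exp i)"
proof -
  have "(\<Sum>k\<in>{1..d}. e k * coef (var i) (unit_exp k) * coef p (unit_exp k)) =
      (\<Sum>k\<in>{1..d}. if k = i then e i * coef p (unit_exp i) else 0)"
    by (rule sum.cong) auto
  then show ?thesis using assms
    by (simp add: square_functional_mult) (simp add: square_functional_def)
qed

lemma square_functional_const: "square_functional d e (const c) = 0"
  by (simp add: square_functional_def)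

text \<open>Modulo an ideal with signs, mixed products vanish and \<open>var i ^ 2\<close> is
  \<open>e i\<close> times \<open>var 1 ^ 2\<close>. So 1, the variables and
  \<open>var 1 ^ 2\<close> form a basis of the quotient, and the functional is the last
  coordinate.\<close>

definition normal_form :: "nat \<Rightarrow> (nat \<Rightarrow> 'k::field) \<Rightarrow> 'k mpoly \<Rightarrow> 'k mpoly" where
  "normal_form d e p = const (coef p 0) + (\<Sum>i\<in>{1..d}. const (coef p (unit_exp i)) * var i) +
    const (square_functional d e p) * var 1 ^ 2"

text \<open>A second variable is needed to put the cube of the first one into the ideal; with one
  variable there would be no generators at all.\<close>

locale sign_ideal =
  fixes d :: nat and \<epsilon> :: "nat \<Rightarrow> 'k::field"
  assumes d: "2 \<le> d" and sign: "sign_choice d \<epsilon>"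
begin

definition e :: "nat \<Rightarrow> 'k" where "e i = (if i = 1 then 1 else - \<epsilon> i)"

abbreviation "s \<equiv> square_functional d e"

lemma e_1 [simp]: "e 1 = 1" "e (Suc 0) = 1" by (simp_all add: e_def)

lemma e_square: "i \<in> {1..d} \<Longrightarrow> e i * e i = 1"
proof (cases "i = 1")
  case False
  assume "i \<in> {1..d}"
  with False have "i \<in> {2..d}" by auto
  then have "\<epsilon> i = 1 \<or> \<epsilon> i = - 1" using sign by (auto simp: sign_choice_def)
  then show ?thesis using False by (auto simp: e_def)
qed simp

lemma e_nonzero: "i \<in> {1..d} \<Longrightarrow> e i \<noteq> 0"
  using e_square[of i] by auto

lemma var_square_functional: "i \<in> {1..d} \<Longrightarrow> s (var i ^ 2) = e i"
  using square_functional_var_mult[of i d e "var i"] by (simp add: power2_eq_square)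

text \<open>Once this is shown to be the ideal with signs, membership is checked by reading off
  coefficients.\<close>

definition J where
  "J = {p \<in> polys d. coef p 0 = 0 \<and> (\<forall>i\<in>{1..d}. coef p (unit_exp i) = 0) \<and> s p = 0}"

text \<open>If \<open>p\<close> has no constant and no linear part, the functional takes on
  \<open>r p\<close> the value \<open>r(0)\<close> times its value on \<open>p\<close>.\<close>

lemma ideal_J: "ideal J (poly_ring d)"
proof (rule ideal_poly_ringI)
  show "0 \<in> J" by (simp add: J_def square_functional_def)
  show "p + q \<in> J" if "p \<in> J" "q \<in> J" for p q
    using that by (simp add: J_def square_functional_add lookup_add)
  show "r * p \<in> J" if "r \<in> polys d" "p \<in> J" for r p
    using that by (simp add: J_def coef_mult_0 coef_mult_unit_exp square_functional_mult)
qed (auto simp: J_def)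

abbreviation gens :: "'k mpoly set" where
  "gens \<equiv> {var i * var j | i j. 1 \<le> i \<and> i < j \<and> j \<le> d} \<union>
     {var 1 ^ 2 + const (\<epsilon> k) * var k ^ 2 | k. 2 \<le> k \<and> k \<le> d}"

lemma gens_polys: "gens \<subseteq> polys d"
  using d by auto

lemma ideal_signed: "ideal (signed_ideal d \<epsilon>) (poly_ring d)"
  unfolding signed_ideal_def by (rule poly.genideal_ideal[OF gens_polys])

lemma gens_signed: "gens \<subseteq> signed_ideal d \<epsilon>"
  unfolding signed_ideal_def by (rule poly.genideal_self[OF gens_polys])

lemma product_signed: "1 \<le> i \<Longrightarrow> i < j \<Longrightarrow> j \<le> d \<Longrightarrow> var i * var j \<in> signed_ideal d \<epsilon>"
  by (rule subsetD[OF gens_signed], rule UnI1, intro CollectI exI conjI) (rule refl)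

lemma squares_signed:
  "2 \<le> k \<Longrightarrow> k \<le> d \<Longrightarrow> var 1 ^ 2 + const (\<epsilon> k) * var k ^ 2 \<in> signed_ideal d \<epsilon>"
  by (rule subsetD[OF gens_signed], rule UnI2, intro CollectI exI conjI) (rule refl)

lemma signed_subset_J: "signed_ideal d \<epsilon> \<subseteq> J"
  unfolding signed_ideal_def
proof (rule poly.genideal_minimal[OF ideal_J], rule subsetI)
  fix p assume "p \<in> gens"
  then consider i j where "1 \<le> i" "i < j" "j \<le> d" "p = var i * var j"
    | k where "2 \<le> k" "k \<le> d" "p = var 1 ^ 2 + const (\<epsilon> k) * var k ^ 2"
    by blast
  then show "p \<in> J"
  proof cases
    case 1
    then show ?thesis using square_functional_var_mult[of i d e "var j"]
      by (simp add: J_def coef_mult_0 coef_mult_unit_exp)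
  next
    case 2
    have "s p = 1 + \<epsilon> k * e k"
      using 2 d var_square_functional[of k] var_square_functional[of 1]
      by (simp add: square_functional_add square_functional_scale)
    also have "\<dots> = 0" using e_square[of k] 2 by (simp add: e_def)
    finally show ?thesis using 2 d
      by (simp add: J_def lookup_add coef_mult_0 coef_mult_unit_exp power2_eq_square)
  qed
qed

lemma var_mult_signed:
  assumes "i \<in> {1..d}" "j \<in> {1..d}" "i \<noteq> j"
  shows "var i * var j \<in> signed_ideal d \<epsilon>"
proof (cases "i < j")
  case True
  then show ?thesis using assms by (intro product_signed) auto
next
  case False
  then have "var j * var i \<in> signed_ideal d \<epsilon>" using assms by (intro product_signed) auto
  then show ?thesis by (simp add: mult.commute)
qed

lemmas signed_D = ideal_poly_ringD[OF ideal_signed]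

lemma square_diff_signed:
  assumes i: "i \<in> {1..d}"
  shows "var i ^ 2 - const (e i) * var 1 ^ 2 \<in> signed_ideal d \<epsilon>"
proof (cases "i = 1")
  case True
  then show ?thesis using signed_D(2) by simp
next
  case False
  then have "var 1 ^ 2 + const (\<epsilon> i) * var i ^ 2 \<in> signed_ideal d \<epsilon>"
    using i by (intro squares_signed) auto
  then have "const (\<epsilon> i) * (var 1 ^ 2 + const (\<epsilon> i) * var i ^ 2) \<in> signed_ideal d \<epsilon>"
    by (intro signed_D(4)) simp
  moreover have "const (\<epsilon> i) * const (\<epsilon> i) = (1 :: 'k mpoly)"
    using e_square[OF i] False by (simp add: e_def flip: const_mult)
  then have "const (\<epsilon> i) * (w + const (\<epsilon> i) * v) = v - const (e i) * w" for v w :: "'k mpoly"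
    using False by (simp add: e_def const_uminus distrib_left flip: mult.assoc)
  ultimately show ?thesis by simp
qed

lemma var_mult_square_signed:
  assumes i: "i \<in> {1..d}"
  shows "var i * var 1 ^ 2 \<in> signed_ideal d \<epsilon>"
proof (cases "i = 1")
  case True
  have 2: "(2::nat) \<in> {1..d}" "(1::nat) \<in> {1..d}" using d by auto
  \<comment> \<open>The cube of the first variable is this multiple of the relation for
    \<open>k = 2\<close>, minus a multiple of the mixed product of the first two variables.\<close>
  have "var 1 * (var 1 ^ 2 + const (\<epsilon> 2) * var 2 ^ 2) \<in> signed_ideal d \<epsilon>"
    using d by (intro signed_D(4) squares_signed) auto
  moreover have "(const (\<epsilon> 2) * var 2) * (var 1 * var 2) \<in> signed_ideal d \<epsilon>"
    using 2 by (intro signed_D(4) var_mult_signed) auto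
  ultimately have "var 1 * (var 1 ^ 2 + const (\<epsilon> 2) * var 2 ^ 2) -
      (const (\<epsilon> 2) * var 2) * (var 1 * var 2) \<in> signed_ideal d \<epsilon>" by (rule signed_D(6))
  then show ?thesis using True by (simp add: power2_eq_square algebra_simps)
next
  case False
  then have "var 1 * (var i * var 1) \<in> signed_ideal d \<epsilon>"
    using i d by (intro signed_D(4) var_mult_signed) auto
  then show ?thesis by (simp add: power2_eq_square algebra_simps)
qed

lemma normal_form_var_mult:
  assumes i: "i \<in> {1..d}"
  shows "normal_form d e (var i * p) = const (coef p 0) * var i +
    const (e i * coef p (unit_exp i)) * var 1 ^ 2"
proof -
  have "(\<Sum>k\<in>{1..d}. const (coef (var i * p) (unit_exp k)) * var k) =
      (\<Sum>k\<in>{1..d}. if k = i then const (coef p 0) * var i else 0)"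
    by (rule sum.cong) (auto simp: coef_mult_unit_exp)
  then show ?thesis
    using i by (simp add: normal_form_def coef_mult_0 square_functional_var_mult)
qed

text \<open>Multiplying a normal form by \<open>x_i\<close> leaves the span of the basis only
  through products \<open>x_i x_k\<close> and \<open>x_i x_1^2\<close>, which the preceding lemmas
  reduce. So the claim passes from \<open>p\<close> to \<open>x_i p\<close>.\<close>

lemma normal_form_cong: "p \<in> polys d \<Longrightarrow> p - normal_form d e p \<in> signed_ideal d \<epsilon>"
proof (induction p rule: polys_induct)
  case (const c)
  then show ?case using signed_D(2) by (simp add: normal_form_def square_functional_const)
next
  case (add p q)
  have "normal_form d e (p + q) = normal_form d e p + normal_form d e q"
    by (simp add: normal_form_def lookup_add const_add square_functional_add algebra_simps sum.distrib)
  then show ?case using signed_D(3)[OF add.IH] by (simp add: algebra_simps)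
next
  case (var i p)
  let ?c = "\<lambda>k. coef p (unit_exp k)"
  have split: "(\<Sum>k\<in>{1..d}. const (?c k) * (var i * var k)) =
      const (?c i) * var i ^ 2 + (\<Sum>k\<in>{1..d} - {i}. const (?c k) * (var i * var k))"
    using var(1) by (subst sum.remove[of _ i]) (auto simp: power2_eq_square)
  have "var i * normal_form d e p - normal_form d e (var i * p) =
      (\<Sum>k\<in>{1..d}. const (?c k) * (var i * var k)) - const (e i * ?c i) * var 1 ^ 2 +
      const (s p) * (var i * var 1 ^ 2)"
    unfolding normal_form_var_mult[OF var(1)]
    by (simp add: normal_form_def algebra_simps sum_distrib_left)
  also have "\<dots> = (\<Sum>k\<in>{1..d} - {i}. const (?c k) * (var i * var k)) +
      const (?c i) * (var i ^ 2 - const (e i) * var 1 ^ 2) + const (s p) * (var i * var 1 ^ 2)"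
  proof -
    have "c * v + S - (c * b) * w + C = S + c * (v - b * w) + C" for c v b w S C :: "'k mpoly"
      by (simp add: algebra_simps)
    then show ?thesis unfolding split mult.commute[of "e i"] const_mult by blast
  qed
  also have "\<dots> \<in> signed_ideal d \<epsilon>"
    using var(1)
    by (intro signed_D(3) ideal_poly_ring_sum[OF ideal_signed] signed_D(4) var_mult_signed
      square_diff_signed var_mult_square_signed) auto
  finally have "var i * normal_form d e p - normal_form d e (var i * p) \<in> signed_ideal d \<epsilon>" .
  moreover have "var i * (p - normal_form d e p) \<in> signed_ideal d \<epsilon>"
    using var by (intro signed_D(4)) auto
  ultimately have "var i * (p - normal_form d e p) +
      (var i * normal_form d e p - normal_form d e (var i * p)) \<in> signed_ideal d \<epsilon>"
    by (intro signed_D(3))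
  then show ?case by (simp add: algebra_simps)
qed

lemma signed_ideal_eq: "signed_ideal d \<epsilon> = J"
proof
  show "J \<subseteq> signed_ideal d \<epsilon>"
  proof
    fix p assume p: "p \<in> J"
    then have "normal_form d e p = 0" by (simp add: J_def normal_form_def)
    then show "p \<in> signed_ideal d \<epsilon>" using normal_form_cong[of p] p by (simp add: J_def)
  qed
qed (rule signed_subset_J)

lemma signedI:
  assumes "p \<in> polys d" "coef p 0 = 0" "\<And>i. i \<in> {1..d} \<Longrightarrow> coef p (unit_exp i) = 0" "s p = 0"
  shows "p \<in> signed_ideal d \<epsilon>"
  unfolding signed_ideal_eq J_def using assms by blast

lemma cube_signed:
  assumes "p \<in> polys d" "coef p 0 = 0"
  shows "p ^ 3 \<in> signed_ideal d \<epsilon>"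
proof -
  have 2: "coef (p * p) 0 = 0" "coef (p * p) (unit_exp i) = 0" for i
    using assms(2) by (simp_all add: coef_mult_0 coef_mult_unit_exp)
  have "s (p * (p * p)) = 0" unfolding square_functional_mult[of d e p] using 2 assms(2) by simp
  moreover have "coef (p * (p * p)) 0 = 0" unfolding coef_mult_0[of p] using assms(2) by simp
  moreover have "coef (p * (p * p)) (unit_exp i) = 0" for i
    unfolding coef_mult_unit_exp[of p] using 2 assms(2) by simp
  moreover have "p * (p * p) \<in> polys d" using assms by simp
  ultimately show ?thesis
    unfolding signed_ideal_eq J_def power3_eq_cube mult.assoc by blast
qed

sublocale centered_ideal d "signed_ideal d \<epsilon>"
  by (rule centered_ideal.intro[OF ideal_signed]) (simp add: signed_ideal_eq J_def)

text \<open>For the trace form the basis consisting of 1, \<open>x_i\<close> and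
  \<open>x_1^2\<close> has the dual basis \<open>x_1^2\<close>, \<open>e_i x_i\<close> and 1.
  Nondegeneracy and the representing elements are read off from this.\<close>

sublocale frobenius_ideal d "signed_ideal d \<epsilon>" s "insert 1 (insert (var 1 ^ 2) (var ` {1..d}))"
proof (intro frobenius_ideal.intro frobenius_ideal_axioms.intro centered_ideal_axioms)
  show "s p = 0" if "p \<in> signed_ideal d \<epsilon>" for p using that unfolding signed_ideal_eq J_def by blast
  show "p ^ 3 \<in> signed_ideal d \<epsilon>" if "p \<in> polys d" "coef p 0 = 0" for p
    using that by (rule cube_signed)
  show "p \<in> signed_ideal d \<epsilon>" if p: "p \<in> polys d" and z: "\<And>q. q \<in> polys d \<Longrightarrow> s (q * p) = 0" for p
  proof -
    have "s p = 0" using z[of 1] by simp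
    moreover have "coef p (unit_exp i) = 0" if i: "i \<in> {1..d}" for i
      using z[OF polys_var[OF i]] square_functional_var_mult[OF i, of e p] e_nonzero[OF i] by simp
    moreover have "coef p 0 = 0"
      using z[of "var 1 * var 1"] d square_functional_var_mult[of 1 d e "var 1 * p"]
      by (simp add: mult.assoc coef_mult_unit_exp)
    ultimately show ?thesis by (intro signedI[OF p])
  qed
  show "\<exists>v\<in>vec.span (insert 1 (insert (var 1 ^ 2) (var ` {1..d}))). p - v \<in> signed_ideal d \<epsilon>"
    if "p \<in> polys d" for p
  proof (rule bexI[of _ "normal_form d e p"])
    show "p - normal_form d e p \<in> signed_ideal d \<epsilon>" by (rule normal_form_cong[OF that])
    have "const (coef p 0) * 1 \<in> vec.span (insert 1 (insert (var 1 ^ 2) (var ` {1..d})))"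
      by (intro vec.span_scale vec.span_base) simp
    then show "normal_form d e p \<in> vec.span (insert 1 (insert (var 1 ^ 2) (var ` {1..d})))"
      unfolding normal_form_def
      by (intro vec.span_add vec.span_sum vec.span_scale[OF vec.span_base]) auto
  qed
  fix \<psi> :: "'k mpoly \<Rightarrow> 'k"
  assume add: "\<And>p q. p \<in> polys d \<Longrightarrow> q \<in> polys d \<Longrightarrow> \<psi> (p + q) = \<psi> p + \<psi> q"
    and scale: "\<And>c p. p \<in> polys d \<Longrightarrow> \<psi> (const c * p) = c * \<psi> p"
    and zero: "\<And>p. p \<in> signed_ideal d \<epsilon> \<Longrightarrow> \<psi> p = 0"
  \<comment> \<open>The expansion of \<open>\<psi>\<close> in the dual basis. The factor
    \<open>e i\<close> is its own inverse and undoes the diagonal entry of the form.\<close>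
  define p where "p = const (\<psi> 1) * var 1 ^ 2 + (\<Sum>i\<in>{1..d}. const (\<psi> (var i) * e i) * var i) +
    const (\<psi> (var 1 ^ 2))"
  have \<psi>0: "\<psi> 0 = 0" using scale[of 0 0] by simp
  have \<psi>_sum: "\<psi> (sum f A) = (\<Sum>i\<in>A. \<psi> (f i))" if "\<And>i. i \<in> A \<Longrightarrow> f i \<in> polys d" for f and A :: "nat set"
    using that by (induction A rule: infinite_finite_induct) (auto simp: \<psi>0 add)
  have v1: "(var 1 :: 'k mpoly) \<in> polys d" using d by simp
  have p: "p \<in> polys d" unfolding p_def using v1 by (intro polys_add polys_mult polys_sum polys_power) auto
  have p0: "coef p 0 = \<psi> (var 1 ^ 2)"
    by (simp add: p_def lookup_add lookup_sum power2_eq_square coef_mult_0)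
  have pi: "coef p (unit_exp i) = \<psi> (var i) * e i" if "i \<in> {1..d}" for i
  proof -
    have "(\<Sum>k\<in>{1..d}. \<psi> (var k) * e k * (if k = i then 1 else 0)) =
      (\<Sum>k\<in>{1..d}. if k = i then \<psi> (var i) * e i else 0)"
      by (rule sum.cong) auto
    then show ?thesis using that
      by (simp add: p_def lookup_add lookup_sum power2_eq_square coef_mult_unit_exp)
  qed
  have "s (\<Sum>i\<in>{1..d}. const (\<psi> (var i) * e i) * var i) = 0"
    by (simp add: square_functional_def lookup_sum)
  then have sp: "s p = \<psi> 1"
    using var_square_functional[of 1] d
    by (simp add: p_def square_functional_add square_functional_scale square_functional_const)
  have "\<psi> q = s (q * p)" if q: "q \<in> polys d" for q
  proof -
    have nf: "normal_form d e q \<in> polys d"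
      unfolding normal_form_def using v1 by (intro polys_add polys_mult polys_sum polys_power) auto
    have "\<psi> q = \<psi> (q - normal_form d e q) + \<psi> (normal_form d e q)"
      using add[of "q - normal_form d e q" "normal_form d e q"] q nf by simp
    also have "\<dots> = \<psi> (normal_form d e q)" using zero[OF normal_form_cong[OF q]] by simp
    also have "\<dots> = \<psi> (const (coef q 0) * 1) + \<psi> (\<Sum>i\<in>{1..d}. const (coef q (unit_exp i)) * var i) +
        \<psi> (const (s q) * var 1 ^ 2)"
    proof -
      have lin: "(\<Sum>i\<in>{1..d}. const (coef q (unit_exp i)) * var i) \<in> polys d"
        by (intro polys_sum polys_mult) auto
      have sq: "const (s q) * var 1 ^ 2 \<in> polys d" using v1 by simp
      show ?thesis
        unfolding normal_form_def mult_1_right add[OF polys_add[OF polys_const lin] sq]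
          add[OF polys_const lin] ..
    qed
    also have "\<dots> = coef q 0 * \<psi> 1 + (\<Sum>i\<in>{1..d}. coef q (unit_exp i) * \<psi> (var i)) +
        s q * \<psi> (var 1 ^ 2)"
      using v1 by (simp only: scale \<psi>_sum polys_mult polys_const polys_var polys_1 polys_power cong: sum.cong)
    also have "\<dots> = s (q * p)"
    proof -
      have "(\<Sum>i\<in>{1..d}. e i * coef q (unit_exp i) * coef p (unit_exp i)) =
          (\<Sum>i\<in>{1..d}. coef q (unit_exp i) * \<psi> (var i))"
      proof (rule sum.cong[OF refl])
        fix i assume i: "i \<in> {1..d}"
        have "e i * coef q (unit_exp i) * coef p (unit_exp i) =
          (e i * e i) * (coef q (unit_exp i) * \<psi> (var i))"
          by (simp add: pi[OF i])
        then show "e i * coef q (unit_exp i) * coef p (unit_exp i) = coef q (unit_exp i) * \<psi> (var i)"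
          by (simp add: e_square[OF i])
      qed
      then show ?thesis by (simp add: square_functional_mult p0 sp)
    qed
    finally show ?thesis .
  qed
  then show "\<exists>p\<in>polys d. \<forall>q\<in>polys d. \<psi> q = s (q * p)" using p by blast
qed (simp_all add: square_functional_add square_functional_scale)

end

section \<open>Quadrics\<close>

lemma hom_comp_scale: "hom_comp n (const c * p) = const c * hom_comp n p"
  by (rule poly_mapping_eqI) (simp add: coef_hom_comp)

lemma hom_comp_0_eq: "hom_comp 0 p = const (coef p 0)"
  by (rule poly_mapping_eqI) (simp add: coef_hom_comp coef_const deg_0_iff)

lemma hom_comp_1_eq_0:
  assumes "\<And>i. coef p (unit_exp i) = 0"
  shows "hom_comp 1 p = 0"
proof (rule poly_mapping_eqI)
  fix m show "coef (hom_comp 1 p) m = coef 0 m"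
    using assms deg_1[of m] by (auto simp: coef_hom_comp)
qed

definition quadrics :: "nat \<Rightarrow> ('k::field) mpoly set" where
  "quadrics d = {p \<in> polys d. quadric p}"

definition linear_forms :: "nat \<Rightarrow> ('k::field) mpoly set" where
  "linear_forms d = vec.span (var ` {1..d})"

lemma subspace_quadrics: "vec.subspace (quadrics d)"
proof (rule subspace_polysI)
  show "0 \<in> quadrics d" by (simp add: quadrics_def quadric_def)
qed (simp_all add: quadrics_def quadric_iff hom_comp_add hom_comp_scale)

lemma subspace_linear_forms: "vec.subspace (linear_forms d)"
  by (simp add: linear_forms_def)

lemma var_linear_form [simp]: "i \<in> {1..d} \<Longrightarrow> var i \<in> linear_forms d"
  unfolding linear_forms_def by (intro vec.span_base) simp

lemma quadric_var_mult: "quadric (var i * var j)"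
  unfolding quadric_iff
  by (simp add: var_altdef mult_single hom_comp_single deg_add)

lemma var_mult_quadrics: "i \<in> {1..d} \<Longrightarrow> j \<in> {1..d} \<Longrightarrow> var i * var j \<in> quadrics d"
  unfolding quadrics_def using quadric_var_mult polys_mult[OF polys_var polys_var] by blast

text \<open>The finite spanning set makes every independent set of quadrics finite, which the
  dimension counts rely on.\<close>

lemma quadrics_eq_span:
  "(quadrics d :: 'k::field mpoly set) = vec.span ((\<lambda>(i, j). var i * var j) ` ({1..d} \<times> {1..d}))"
  (is "_ = vec.span ?D")
proof
  show "vec.span ?D \<subseteq> quadrics d"
    by (rule vec.span_minimal[OF _ subspace_quadrics]) (auto intro: var_mult_quadrics)
  show "quadrics d \<subseteq> vec.span ?D"
  proof
    fix p :: "'k mpoly" assume p: "p \<in> quadrics d"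
    have "monom m (coef p m) \<in> vec.span ?D" if m: "m \<in> supp p" for m
    proof -
      have "deg m = 2" using p m by (simp add: quadrics_def quadric_def deg_def)
      then obtain i j where ij: "m = unit_exp i + unit_exp j" using deg_2 by blast
      have "supp m \<subseteq> {1..d}" using p m by (simp add: quadrics_def polys_iff)
      then have "i \<in> {1..d}" "j \<in> {1..d}" unfolding ij exp_keys_add keys_unit_exp by auto
      then have "var i * var j \<in> ?D" by force
      moreover have "monom m (coef p m) = const (coef p m) * (var i * var j)"
        by (simp add: var_altdef const_def mult_single ij)
      ultimately show ?thesis by (simp add: vec.span_base vec.span_scale)
    qed
    then have "(\<Sum>m\<in>supp p. monom m (coef p m)) \<in> vec.span ?D"
      by (rule vec.span_sum)
    then show "p \<in> vec.span ?D" using poly_mapping_sum_single[of p] by simp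
  qed
qed

lemma quadrics_subset_subspace:
  assumes "vec.subspace W" "\<And>i j. i \<in> {1..d} \<Longrightarrow> j \<in> {1..d} \<Longrightarrow> var i * var j \<in> W"
  shows "quadrics d \<subseteq> W"
  unfolding quadrics_eq_span by (rule vec.span_minimal[OF _ assms(1)]) (auto intro: assms(2))

lemma linear_forms_subset_subspace:
  assumes "vec.subspace W" "\<And>i. i \<in> {1..d} \<Longrightarrow> var i \<in> W"
  shows "linear_forms d \<subseteq> W"
  unfolding linear_forms_def by (rule vec.span_minimal[OF _ assms(1)]) (auto intro: assms(2))

lemma linear_forms_mult:
  assumes "v \<in> linear_forms d" "w \<in> linear_forms d"
  shows "v * w \<in> quadrics d"
proof -
  note Q = subspace_quadrics[of d, unfolded vec.subspace_def]
  have "linear_forms d \<subseteq> {w. var i * w \<in> quadrics d}" if "i \<in> {1..d}" for i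
  proof (rule linear_forms_subset_subspace)
    show "vec.subspace {w. var i * w \<in> quadrics d}"
      by (rule subspace_polysI) (use Q in \<open>auto simp: distrib_left mult.left_commute\<close>)
  qed (use that var_mult_quadrics in blast)
  then have 1: "var i * w \<in> quadrics d" if "i \<in> {1..d}" for i using that assms(2) by blast
  have "linear_forms d \<subseteq> {v. v * w \<in> quadrics d}"
  proof (rule linear_forms_subset_subspace)
    show "vec.subspace {v. v * w \<in> quadrics d}"
      by (rule subspace_polysI) (use Q in \<open>auto simp: distrib_right mult.assoc\<close>)
  qed (use 1 in blast)
  then show ?thesis using assms(1) by blast
qed

lemma subspace_polys: "vec.subspace (polys d)"
  by (rule subspace_polysI) simp_all

lemma linear_forms_polys: "linear_forms d \<subseteq> polys d"
  by (rule linear_forms_subset_subspace[OF subspace_polys]) simp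

lemma linear_form_coef_0: "v \<in> linear_forms d \<Longrightarrow> coef v 0 = 0"
proof -
  have "linear_forms d \<subseteq> {v. coef v 0 = 0}"
    by (rule linear_forms_subset_subspace, rule subspace_polysI) (simp_all add: lookup_add)
  then show "v \<in> linear_forms d \<Longrightarrow> coef v 0 = 0" by blast
qed

lemma linear_form_eq:
  fixes v :: "'k::field mpoly"
  assumes "v \<in> linear_forms d"
  shows "v = (\<Sum>i\<in>{1..d}. const (coef v (unit_exp i)) * var i)"
proof -
  have "linear_forms d \<subseteq> {v :: 'k mpoly. v = (\<Sum>i\<in>{1..d}. const (coef v (unit_exp i)) * var i)}"
  proof (rule linear_forms_subset_subspace, rule subspace_polysI, goal_cases)
    case (4 i)
    have "(\<Sum>k\<in>{1..d}. const (coef (var i) (unit_exp k)) * var k) =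
        (\<Sum>k\<in>{1..d}. if k = i then var i else (0 :: 'k mpoly))"
      by (rule sum.cong) auto
    also have "\<dots> = var i" using 4 by simp
    finally show ?case by simp
  next
    case (2 p q)
    have e: "(\<Sum>i\<in>{1..d}. const (coef (p + q) (unit_exp i)) * var i) =
        (\<Sum>i\<in>{1..d}. const (coef p (unit_exp i)) * var i) +
        (\<Sum>i\<in>{1..d}. const (coef q (unit_exp i)) * var i)"
      by (simp add: lookup_add const_add distrib_right sum.distrib)
    show ?case
      unfolding mem_Collect_eq e 2(1)[unfolded mem_Collect_eq, symmetric]
        2(2)[unfolded mem_Collect_eq, symmetric] ..
  next
    case (3 c p)
    have e: "(\<Sum>i\<in>{1..d}. const (coef (const c * p) (unit_exp i)) * var i) =
        const c * (\<Sum>i\<in>{1..d}. const (coef p (unit_exp i)) * var i)"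
      unfolding sum_distrib_left
      by (rule sum.cong[OF refl]) (simp only: coef_const_mult const_mult mult.assoc)
    show ?case unfolding mem_Collect_eq e 3[unfolded mem_Collect_eq, symmetric] ..
  next
    case 1 show ?case unfolding mem_Collect_eq by simp
  qed
  from subsetD[OF this assms] show ?thesis unfolding mem_Collect_eq .
qed

lemma quadric_coefs:
  assumes "quadric q" shows "coef q 0 = 0" "coef q (unit_exp i) = 0"
  using assms unfolding quadric_iff by (metis coef_hom_comp deg_zero zero_neq_numeral,
    metis coef_hom_comp deg_unit_exp one_eq_numeral_iff semiring_norm(85))

section \<open>The square of the irrelevant ideal and its number of generators\<close>

definition no_linear_part :: "nat \<Rightarrow> ('k::field) mpoly set" where
  "no_linear_part d = {p \<in> polys d. coef p 0 = 0 \<and> (\<forall>i. coef p (unit_exp i) = 0)}"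

lemma ideal_no_linear_part: "ideal (no_linear_part d) (poly_ring d)"
  by (rule ideal_poly_ringI)
    (auto simp: no_linear_part_def lookup_add coef_mult_0 coef_mult_unit_exp)

lemma vars_polys: "var ` {1..d} \<subseteq> polys d" by auto

lemma ideal_irrelevant: "ideal (irrelevant_ideal d) (poly_ring d)"
  unfolding irrelevant_ideal_def by (rule poly.genideal_ideal[OF vars_polys])

lemma var_irrelevant: "i \<in> {1..d} \<Longrightarrow> var i \<in> irrelevant_ideal d"
  unfolding irrelevant_ideal_def by (rule subsetD[OF poly.genideal_self[OF vars_polys]]) simp

lemma irrelevant_subset_ideal:
  "ideal J (poly_ring d) \<Longrightarrow> (\<And>i. i \<in> {1..d} \<Longrightarrow> var i \<in> J) \<Longrightarrow> irrelevant_ideal d \<subseteq> J"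
  unfolding irrelevant_ideal_def by (rule poly.genideal_minimal) auto

abbreviation (input) irrelevant_square :: "nat \<Rightarrow> ('k::field) mpoly set" where
  "irrelevant_square d \<equiv> ideal_prod (poly_ring d) (irrelevant_ideal d) (irrelevant_ideal d)"

lemma irrelevant_coef_0: "p \<in> irrelevant_ideal d \<Longrightarrow> p \<in> polys d \<and> coef p 0 = 0"
proof -
  have "irrelevant_ideal d \<subseteq> {p \<in> polys d. coef p 0 = 0}"
    by (intro irrelevant_subset_ideal ideal_poly_ringI) (auto simp: lookup_add coef_mult_0)
  then show "p \<in> irrelevant_ideal d \<Longrightarrow> p \<in> polys d \<and> coef p 0 = 0" by blast
qed

lemma irrelevant_square_no_linear_part: "irrelevant_square d \<subseteq> no_linear_part d"
proof
  fix p assume "p \<in> irrelevant_square d"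
  then show "p \<in> no_linear_part d"
  proof induction
    case (prod i j)
    then show ?case using irrelevant_coef_0[OF prod(1)] irrelevant_coef_0[OF prod(2)]
      by (simp add: no_linear_part_def coef_mult_0 coef_mult_unit_exp)
  next
    case (sum p q)
    then show ?case by (simp add: no_linear_part_def lookup_add)
  qed
qed

lemma ideal_irrelevant_square: "ideal (irrelevant_square d) (poly_ring d)"
  by (rule poly.ideal_prod_is_ideal[OF ideal_irrelevant ideal_irrelevant])

lemma quadrics_irrelevant_square: "quadrics d \<subseteq> irrelevant_square d"
proof (rule quadrics_subset_subspace[OF subspace_ideal[OF ideal_irrelevant_square]])
  fix i j assume "i \<in> {1..d}" "j \<in> {1..d}"
  then show "var i * var j \<in> irrelevant_square d"
    using ideal_prod.prod[OF var_irrelevant var_irrelevant, of i d j d "poly_ring d"] by simp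
qed

text \<open>The irrelevant ideal is the least one containing the variables. This is applied twice:
  to the right factor with a variable on the left, and then to the left factor.\<close>

lemma irrelevant_square_subset:
  fixes J :: "'k::field mpoly set"
  assumes J: "ideal J (poly_ring d)" and q: "quadrics d \<subseteq> J"
  shows "irrelevant_square d \<subseteq> J"
proof
  note JD = ideal_poly_ringD[OF J]
  have 1: "irrelevant_ideal d \<subseteq> {q \<in> polys d. var i * q \<in> J}" (is "_ \<subseteq> ?K") if i: "i \<in> {1..d}" for i
  proof (intro irrelevant_subset_ideal ideal_poly_ringI)
    show "r * p \<in> ?K"
      if "r \<in> polys d" "p \<in> ?K" for r p
      using that JD(4)[of r "var i * p"] by (simp add: mult.left_commute)
    show "var j \<in> ?K" if "j \<in> {1..d}" for j
      using var_mult_quadrics[OF i that] q that by auto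
  qed (auto simp: JD distrib_left)
  have 2: "irrelevant_ideal d \<subseteq> {p \<in> polys d. \<forall>q\<in>irrelevant_ideal d. p * q \<in> J}" (is "_ \<subseteq> ?K")
  proof (intro irrelevant_subset_ideal ideal_poly_ringI)
    show "r * p \<in> ?K"
      if "r \<in> polys d" "p \<in> ?K" for r p
      using that JD(4)[of r] by (simp add: mult.assoc)
    show "var i \<in> ?K" if "i \<in> {1..d}" for i
      using 1[OF that] polys_var[OF that] by blast
  qed (auto simp: JD distrib_right)
  fix p :: "'k mpoly" assume "p \<in> irrelevant_square d"
  then show "p \<in> J"
  proof induction
    case (prod i j)
    then have "i * j \<in> J" using 2 by blast
    then show ?case by simp
  next
    case (sum p q)
    then show ?case using JD(3) by simp
  qed
qed

lemma finite_products: "finite ((\<lambda>(i, j). var i * var j) ` ({1..d} \<times> {1..d}))"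
  by simp

lemma span_subset_ideal: "ideal J (poly_ring d) \<Longrightarrow> B \<subseteq> J \<Longrightarrow> vec.span B \<subseteq> J"
  by (rule vec.span_minimal[OF _ subspace_ideal])

text \<open>A graded form of Nakayama's lemma: if \<open>p\<close> has no terms below degree two,
  the degree-two part of \<open>r p\<close> is \<open>r(0)\<close> times that of \<open>p\<close>.
  So the degree-two parts of any generating set span the quadrics. The dimension is never evaluated
  as a binomial coefficient, since only the count relative to it matters.\<close>

lemma min_num_gens_irrelevant_square:
  "min_num_gens (poly_ring d :: 'k::field mpoly ring) (irrelevant_square d) =
    vec.dim (quadrics d :: 'k mpoly set)"
  unfolding min_num_gens_def
proof (rule Least_equality)
  obtain B :: "'k mpoly set" where B: "B \<subseteq> quadrics d" "vec.independent B"
    "quadrics d \<subseteq> vec.span B" "card B = vec.dim (quadrics d :: 'k mpoly set)"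
    by (rule vec.basis_exists)
  have fin: "finite B"
    using vec.independent_span_bound[OF finite_products[of d] B(2)] B(1) quadrics_eq_span by blast
  have BC: "B \<subseteq> polys d" using B(1) by (auto simp: quadrics_def)
  have gen: "Idl\<^bsub>poly_ring d\<^esub> B = irrelevant_square d"
  proof
    show "Idl\<^bsub>poly_ring d\<^esub> B \<subseteq> irrelevant_square d"
      using B(1) quadrics_irrelevant_square by (intro poly.genideal_minimal ideal_irrelevant_square) auto
    have "quadrics d \<subseteq> Idl\<^bsub>poly_ring d\<^esub> B"
      using B(3) span_subset_ideal[OF poly.genideal_ideal[OF BC] poly.genideal_self[OF BC]] by blast
    then show "irrelevant_square d \<subseteq> Idl\<^bsub>poly_ring d\<^esub> B"
      by (rule irrelevant_square_subset[OF poly.genideal_ideal[OF BC]])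
  qed
  show "\<exists>S :: 'k mpoly set. S \<subseteq> polys d \<and> finite S \<and> card S = vec.dim (quadrics d :: 'k mpoly set) \<and>
      Idl\<^bsub>poly_ring d\<^esub> S = irrelevant_square d"
    by (intro exI[of _ B] conjI BC fin B(4) gen)
next
  fix n
  assume "\<exists>S. S \<subseteq> polys d \<and> finite S \<and> card S = n \<and>
    Idl\<^bsub>poly_ring d\<^esub> S = (irrelevant_square d :: 'k mpoly set)"
  then obtain S :: "'k mpoly set" where S: "S \<subseteq> polys d" "finite S" "card S = n"
    "Idl\<^bsub>poly_ring d\<^esub> S = irrelevant_square d" by blast
  let ?T = "vec.span (hom_comp 2 ` S)"
  \<comment> \<open>The condition on the degree-two part cuts out an ideal only because lower terms
    are excluded.\<close>
  let ?K = "{p \<in> no_linear_part d. hom_comp 2 p \<in> ?T}"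
  have "ideal ?K (poly_ring d)"
  proof (rule ideal_poly_ringI)
    note N = ideal_poly_ringD[OF ideal_no_linear_part]
    show "?K \<subseteq> polys d" by (auto simp: no_linear_part_def)
    have "hom_comp 2 0 = (0 :: 'k mpoly)" by (rule poly_mapping_eqI) (simp add: coef_hom_comp)
    then show "0 \<in> ?K" by (simp add: vec.span_zero N(2))
    show "p + q \<in> ?K" if "p \<in> ?K" "q \<in> ?K" for p q
      using that by (simp add: hom_comp_add vec.span_add N(3))
    show "r * p \<in> ?K" if "r \<in> polys d" "p \<in> ?K" for r p
    proof -
      have "hom_comp 0 p = 0" "hom_comp 1 p = 0"
        using that hom_comp_1_eq_0[of p] by (auto simp: no_linear_part_def hom_comp_0_eq)
      then have "hom_comp 2 (r * p) = const (coef r 0) * hom_comp 2 p"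
        by (simp add: hom_comp_mult numeral_2_eq_2 hom_comp_0_eq)
      then show ?thesis using that by (simp add: vec.span_scale N(4))
    qed
  qed
  moreover have "S \<subseteq> ?K"
  proof
    fix p assume p: "p \<in> S"
    then have "p \<in> irrelevant_square d" using poly.genideal_self[OF S(1)] S(4) by blast
    moreover have "hom_comp 2 p \<in> ?T" using p by (intro vec.span_base imageI)
    ultimately show "p \<in> ?K" using irrelevant_square_no_linear_part[of d] by blast
  qed
  ultimately have "irrelevant_square d \<subseteq> ?K"
    unfolding S(4)[symmetric] by (rule poly.genideal_minimal)
  then have "hom_comp 2 p \<in> ?T" if "p \<in> quadrics d" for p
    using that quadrics_irrelevant_square by blast
  then have "quadrics d \<subseteq> ?T" by (simp add: quadrics_def quadric_iff subset_iff)
  then have "vec.dim (quadrics d :: 'k mpoly set) \<le> card (hom_comp 2 ` S)"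
    using S(2) by (intro vec.dim_le_card) auto
  then show "vec.dim (quadrics d :: 'k mpoly set) \<le> n" using card_image_le[OF S(2), of "hom_comp 2"] S(3) by simp
qed

section \<open>Diagonalization\<close>

lemma ideal_vimage_poly:
  assumes "ideal J (poly_ring d)" "\<And>p. p \<in> polys d \<Longrightarrow> f p \<in> polys d"
    and "\<And>p q. f (p + q) = f p + f q" "\<And>p q. f (p * q) = f p * f q"
  shows "ideal {p \<in> polys d. f p \<in> J} (poly_ring d)"
proof -
  have "f 0 = 0" using assms(3)[of 0 0] by (metis add_0 add_cancel_right_right)
  then show ?thesis using assms by (intro ideal_poly_ringI) (auto simp: ideal_poly_ringD)
qed

text \<open>Setting \<open>L x = 1\<close> and \<open>L = 0\<close> on \<open>S\<close> makes
  \<open>L\<close> the coordinate of \<open>x\<close> on the span of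
  \<open>insert x S\<close>.\<close>

lemma functional_vanishing_exactly_on_span:
  fixes S :: "'k::field mpoly set"
  assumes S: "vec.independent S" and x: "x \<notin> vec.span S"
  obtains L :: "'k mpoly \<Rightarrow> 'k::field" where "\<forall>p q. L (p + q) = L p + L q" "\<forall>c p. L (const c * p) = c * L p"
    "\<forall>p\<in>vec.span (insert x S). L p = 0 \<longleftrightarrow> p \<in> vec.span S"
proof -
  interpret vp: vector_space_pair "(\<lambda>c p. const c * p) :: 'k \<Rightarrow> 'k mpoly \<Rightarrow> 'k mpoly"
    "(*) :: 'k \<Rightarrow> 'k \<Rightarrow> 'k"
    by unfold_locales (simp_all add: algebra_simps)
  have "vec.independent (insert x S)" by (rule vec.independent_insertI[OF x S])
  from vp.linear_independent_extend[OF this, of "\<lambda>p. if p = x then 1 else 0"]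
  obtain L where L: "Vector_Spaces.linear (\<lambda>c p. const c * p) (*) L"
    "\<forall>p\<in>insert x S. L p = (if p = x then 1 else 0)" by blast
  have add: "L (p + q) = L p + L q" and scale: "L (const c * p) = c * L p" for p q c
    using vp.linear_add[OF L(1)] vp.linear_scale[OF L(1)] by auto
  have xS: "x \<notin> S" using x vec.span_base by blast
  have sub: "vec.subspace {p. L p = 0}"
    by (rule subspace_polysI) (use scale[of 0 0] in \<open>simp_all add: add scale\<close>)
  have "S \<subseteq> {p. L p = 0}" using L(2) xS by auto
  then have 0: "L p = 0" if "p \<in> vec.span S" for p using vec.span_minimal[OF _ sub] that by blast
  have "L p = 0 \<longleftrightarrow> p \<in> vec.span S" if p: "p \<in> vec.span (insert x S)" for p
  proof -
    obtain k where k: "p - const k * x \<in> vec.span S" using p vec.span_insert[of x S] by auto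
    have "L p = L (p - const k * x) + L (const k * x)" by (simp flip: add)
    also have "\<dots> = k" using 0[OF k] L(2) by (simp add: scale)
    finally have "L p = k" .
    then show ?thesis using 0 k by auto
  qed
  then show ?thesis using that add scale by blast
qed

text \<open>A linear functional on quadrics, viewed as the symmetric bilinear form \<open>L (v * w)\<close> on linear
  forms.\<close>

locale quadratic_form =
  fixes d :: nat and L :: "real mpoly \<Rightarrow> real"
  assumes L_add: "L (p + q) = L p + L q" and L_scale: "L (const c * p) = c * L p"
    and nondegenerate: "u \<in> linear_forms d \<Longrightarrow> (\<And>w. w \<in> linear_forms d \<Longrightarrow> L (u * w) = 0) \<Longrightarrow> u = 0"
begin

lemma L_0: "L 0 = 0" using L_scale[of 0 0] by simp

lemma L_sum: "L (sum f A) = (\<Sum>i\<in>A. L (f i))"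
  by (induction A rule: infinite_finite_induct) (auto simp: L_add L_0)

lemma L_diff: "L (p - q) = L p - L q"
  using L_add[of "p - q" q] by simp

lemma subspace_orthogonal: "vec.subspace {w. L (v * w) = 0}"
proof (rule subspace_polysI)
  show "const c * p \<in> {w. L (v * w) = 0}" if "p \<in> {w. L (v * w) = 0}" for c p
    using that L_scale[of c "v * p"] by (simp add: mult.left_commute)
qed (simp_all add: L_0 L_add distrib_left)

definition orthonormal :: "real mpoly set \<Rightarrow> bool" where
  "orthonormal Q \<longleftrightarrow> Q \<subseteq> linear_forms d \<and> (\<forall>v\<in>Q. L (v * v) = 1 \<or> L (v * v) = - 1) \<and>
    (\<forall>v\<in>Q. \<forall>w\<in>Q. v \<noteq> w \<longrightarrow> L (v * w) = 0)"

text \<open>A vector in the span of the others would be orthogonal to itself. The bound on the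
  cardinality is what makes a largest orthonormal set exist.\<close>

lemma orthonormal_independent:
  assumes Q: "orthonormal Q"
  shows "vec.independent Q" "finite Q" "card Q \<le> d"
proof -
  show ind: "vec.independent Q"
  proof
    assume "vec.dependent Q"
    then obtain v where v: "v \<in> Q" "v \<in> vec.span (Q - {v})" unfolding vec.dependent_def by blast
    have "vec.span (Q - {v}) \<subseteq> {w. L (v * w) = 0}"
      using Q v(1) by (intro vec.span_minimal subspace_orthogonal) (auto simp: orthonormal_def)
    then have "L (v * v) = 0" using v(2) by blast
    then show False using Q v(1) by (auto simp: orthonormal_def)
  qed
  have "Q \<subseteq> vec.span (var ` {1..d})" using Q by (simp add: orthonormal_def linear_forms_def)
  then have "finite Q \<and> card Q \<le> card (var ` {1..d} :: real mpoly set)"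
    by (intro vec.independent_span_bound ind) auto
  moreover have "card (var ` {1..d} :: real mpoly set) \<le> d"
    using card_image_le[of "{1..d}" "var :: nat \<Rightarrow> real mpoly"] by simp
  ultimately show "finite Q" "card Q \<le> d" by auto
qed

text \<open>Gram-Schmidt for an indefinite form. If \<open>Q\<close> misses a vector, its orthogonal
  complement \<open>W\<close> is nonzero. A vector of \<open>W\<close> with nonzero square could be
  rescaled and added to \<open>Q\<close>, so all squares vanish on \<open>W\<close>; by polarization
  the form vanishes there, and a vector of \<open>W\<close> is orthogonal to everything.\<close>

lemma maximal_orthonormal_spans:
  assumes Q: "orthonormal Q" and max: "\<And>Q'. orthonormal Q' \<Longrightarrow> card Q' \<le> card Q"
  shows "linear_forms d \<subseteq> vec.span Q"
proof (rule ccontr)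
  assume "\<not> linear_forms d \<subseteq> vec.span Q"
  then obtain x where x: "x \<in> linear_forms d" "x \<notin> vec.span Q" by blast
  note fin = orthonormal_independent(2)[OF Q]
  note V = subspace_linear_forms[of d]
  have QV: "v \<in> linear_forms d" if "v \<in> Q" for v using Q that by (auto simp: orthonormal_def)
  \<comment> \<open>The factor \<open>L (v * v)\<close>, being 1 or -1, stands for its own inverse
    in the projection formula.\<close>
  define proj where "proj y = (\<Sum>v\<in>Q. const (L (v * v) * L (v * y)) * v)" for y
  have proj_V: "proj y \<in> linear_forms d" for y
    unfolding proj_def by (intro vec.subspace_sum[OF V] vec.subspace_scale[OF V] QV)
  have proj_span: "proj y \<in> vec.span Q" for y
    unfolding proj_def by (intro vec.span_sum vec.span_scale vec.span_base)
  have orth: "L (w * (y - proj y)) = 0" if w: "w \<in> Q" for w y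
  proof -
    have "L (w * proj y) = (\<Sum>v\<in>Q. (L (v * v) * L (v * y)) * L (w * v))"
      by (simp only: proj_def sum_distrib_left L_sum mult.left_commute[of w] L_scale)
    also have "\<dots> = (\<Sum>v\<in>Q. if v = w then L (w * y) else 0)"
    proof (rule sum.cong[OF refl])
      fix v assume v: "v \<in> Q"
      have "L (w * w) * L (w * w) = 1" using Q w by (auto simp: orthonormal_def)
      then show "L (v * v) * L (v * y) * L (w * v) = (if v = w then L (w * y) else 0)"
        using Q v w by (auto simp: orthonormal_def)
    qed
    also have "\<dots> = L (w * y)" using fin w by simp
    finally show ?thesis by (simp add: right_diff_distrib L_diff)
  qed
  define W where "W = {y \<in> linear_forms d. \<forall>v\<in>Q. L (v * y) = 0}"
  have W_proj: "y - proj y \<in> W" if "y \<in> linear_forms d" for y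
    using orth vec.subspace_diff[OF V that proj_V] by (simp add: W_def)
  have isotropic: "L (y * y) = 0" if y: "y \<in> W" for y
  proof (rule ccontr)
    assume ne: "L (y * y) \<noteq> 0"
    \<comment> \<open>Rescaling by a real square root leaves only the sign of
      \<open>L (y * y)\<close>.\<close>
    define z where "z = const (1 / sqrt \<bar>L (y * y)\<bar>) * y"
    have "L (z * z) = (1 / sqrt \<bar>L (y * y)\<bar>) * ((1 / sqrt \<bar>L (y * y)\<bar>) * L (y * y))"
      unfolding z_def by (simp only: mult.assoc mult.left_commute[of y] L_scale)
    then have zz: "L (z * z) = L (y * y) / \<bar>L (y * y)\<bar>" by simp
    then have zz1: "L (z * z) = 1 \<or> L (z * z) = - 1" using ne by (cases "L (y * y) > 0") auto
    have zQ: "L (v * z) = 0" if "v \<in> Q" for v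
      unfolding z_def mult.left_commute[of v] L_scale using y that by (simp add: W_def)
    have zV: "z \<in> linear_forms d"
      unfolding z_def using y by (intro vec.subspace_scale[OF V]) (simp add: W_def)
    have "z \<notin> Q" using zQ[of z] zz1 by auto
    have "orthonormal (insert z Q)"
      unfolding orthonormal_def
    proof (intro conjI ballI impI)
      show "insert z Q \<subseteq> linear_forms d" using zV QV by blast
      show "L (v * v) = 1 \<or> L (v * v) = - 1" if "v \<in> insert z Q" for v
        using that zz1 Q by (auto simp: orthonormal_def)
      show "L (v * w) = 0" if "v \<in> insert z Q" "w \<in> insert z Q" "v \<noteq> w" for v w
        using that Q zQ[of v] zQ[of w] by (auto simp: orthonormal_def mult.commute)
    qed
    from max[OF this] show False using fin \<open>z \<notin> Q\<close> by simp
  qed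
  define u where "u = x - proj x"
  have u: "u \<in> W" using W_proj x(1) by (simp add: u_def)
  have "u \<noteq> 0" using x(2) proj_span[of x] by (auto simp: u_def)
  moreover have "L (u * y) = 0" if y: "y \<in> linear_forms d" for y
  proof -
    define y' where "y' = y - proj y"
    have y': "y' \<in> W" using W_proj[OF y] by (simp add: y'_def)
    \<comment> \<open>Polarization: the squares of \<open>u\<close>, \<open>y'\<close> and
      \<open>u + y'\<close> vanish under \<open>L\<close>, hence
      \<open>2 L (u y') = 0\<close>.\<close>
    have "u + y' \<in> W"
      using u y' by (simp add: W_def vec.subspace_add[OF V] distrib_left L_add)
    then have "L ((u + y') * (u + y')) = 0" by (rule isotropic)
    moreover have "(u + y') * (u + y') = u * u + y' * y' + (u * y' + u * y')"
      by (simp add: algebra_simps)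
    ultimately have "L (u * y') + L (u * y') = 0"
      using isotropic[OF u] isotropic[OF y'] by (simp only: L_add)
    then have uy': "L (u * y') = 0" by simp
    have "L (u * proj y) = (\<Sum>v\<in>Q. (L (v * v) * L (v * y)) * L (v * u))"
      by (simp only: proj_def sum_distrib_left L_sum mult.left_commute[of u] L_scale) (simp only: mult.commute[of u])
    also have "\<dots> = 0" using u by (simp add: W_def)
    finally have "L (u * y) = L (u * y')" by (simp add: y'_def right_diff_distrib L_diff)
    then show ?thesis using uy' by simp
  qed
  ultimately show False using nondegenerate[of u] u by (simp add: W_def)
qed

lemma vars_independent: "vec.independent (var ` {1..d} :: real mpoly set)"
  and card_vars: "card (var ` {1..d} :: real mpoly set) = d"
proof -
  show "vec.independent (var ` {1..d} :: real mpoly set)"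
  proof
    assume "vec.dependent (var ` {1..d} :: real mpoly set)"
    then obtain i where i: "(var i :: real mpoly) \<in> vec.span (var ` {1..d} - {var i})"
      unfolding vec.dependent_def by blast
    have "vec.subspace {w :: real mpoly. coef w (unit_exp i) = 0}"
      by (rule subspace_polysI) (simp_all add: lookup_add)
    then have "vec.span (var ` {1..d} - {var i}) \<subseteq> {w :: real mpoly. coef w (unit_exp i) = 0}"
      by (intro vec.span_minimal) auto
    then have "coef (var i :: real mpoly) (unit_exp i) = 0" using i by blast
    then show False by simp
  qed
  have "inj_on (var :: nat \<Rightarrow> real mpoly) {1..d}"
  proof (rule inj_onI)
    fix i j assume "(var i :: real mpoly) = var j"
    then have "coef (var i :: real mpoly) (unit_exp i) = coef (var j) (unit_exp i)" by simp
    then show "i = j" by (simp split: if_splits)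
  qed
  then show "card (var ` {1..d} :: real mpoly set) = d" by (simp add: card_image)
qed

lemma orthonormal_basis:
  obtains Q where "orthonormal Q" "linear_forms d \<subseteq> vec.span Q" "card Q = d"
proof -
  \<comment> \<open>The bound in the maximum principle is strict, hence
    \<open>Suc d\<close>.\<close>
  have "\<exists>Q. orthonormal Q \<and> (\<forall>Q'. orthonormal Q' \<longrightarrow> card Q' \<le> card Q)"
    by (rule ex_has_greatest_nat[of orthonormal "{}" card "Suc d"])
      (simp add: orthonormal_def, meson le_imp_less_Suc orthonormal_independent(3))
  then obtain Q where Q: "orthonormal Q" "\<And>Q'. orthonormal Q' \<Longrightarrow> card Q' \<le> card Q" by blast
  have sp: "linear_forms d \<subseteq> vec.span Q" by (rule maximal_orthonormal_spans[OF Q])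
  have "card Q = vec.dim (linear_forms d :: real mpoly set)"
    using Q(1) sp orthonormal_independent(1)[OF Q(1)]
    by (intro vec.basis_card_eq_dim) (auto simp: orthonormal_def)
  also have "\<dots> = card (var ` {1..d} :: real mpoly set)"
    using vars_independent
    by (intro vec.basis_card_eq_dim[symmetric]) (auto simp: linear_forms_def intro: vec.span_base)
  finally show ?thesis using that Q(1) sp card_vars by simp
qed

text \<open>Any vector \<open>a\<close> of the basis can come first. The sign of another vector is
  minus the ratio of its square to that of \<open>a\<close>: vectors with the opposite square follow
  and get 1, those with the same square come last and get -1. So \<open>m\<close> counts the vectors
  other than \<open>a\<close> with the same square.\<close>

lemma enumerated_basis:
  assumes "1 \<le> d"
  obtains m v where "m < d" "bij_betw v {1..d} (v ` {1..d})" "orthonormal (v ` {1..d})"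
    "linear_forms d \<subseteq> vec.span (v ` {1..d})"
    "\<forall>k\<in>{2..d}. L (v k * v k) = - standard_signs d m k * L (v 1 * v 1)"
proof -
  obtain Q where Q: "orthonormal Q" "linear_forms d \<subseteq> vec.span Q" "card Q = d"
    by (rule orthonormal_basis)
  have fin: "finite Q" by (rule orthonormal_independent(2)[OF Q(1)])
  have "Q \<noteq> {}" using Q(3) assms by auto
  then obtain a where a: "a \<in> Q" by blast
  define Opp where "Opp = {b \<in> Q. L (b * b) = - L (a * a)}"
  define Same where "Same = {b \<in> Q - {a}. L (b * b) = L (a * a)}"
  have La: "L (a * a) = 1 \<or> L (a * a) = - 1" using Q(1) a by (auto simp: orthonormal_def)
  have Lb: "L (b * b) = L (a * a) \<or> L (b * b) = - L (a * a)" if "b \<in> Q" for b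
    using Q(1) that La by (force simp: orthonormal_def)
  have part: "Q = {a} \<union> (Opp \<union> Same)" "a \<notin> Opp \<union> Same" "Opp \<inter> Same = {}"
    using Lb a La by (auto simp: Opp_def Same_def)
  have fin': "finite Opp" "finite Same" using fin by (simp_all add: Opp_def Same_def)
  define m where "m = card Same"
  have card: "Suc (card Opp + m) = d"
    using Q(3) part(2,3) fin' by (subst (asm) part(1)) (simp add: card_Un_disjoint m_def)
  have "card {2..d - m} = card Opp" using card by simp
  then obtain f where f: "bij_betw f {2..d - m} Opp"
    using finite_same_card_bij[of "{2..d - m}" Opp] fin' by auto
  have "card {Suc (d - m)..d} = card Same" using card by (simp add: m_def)
  then obtain g where g: "bij_betw g {Suc (d - m)..d} Same"
    using finite_same_card_bij[of "{Suc (d - m)..d}" Same] fin' by auto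
  define v where "v k = (if k = 1 then a else if k \<le> d - m then f k else g k)" for k
  have dm: "1 \<le> d - m" using card by simp
  have v1: "bij_betw v {1} {a}" by (simp add: v_def bij_betw_def)
  have v2: "bij_betw v {2..d - m} Opp"
    using f by (rule bij_betw_cong[THEN iffD1, rotated]) (auto simp: v_def)
  have v3: "bij_betw v {Suc (d - m)..d} Same"
    using g by (rule bij_betw_cong[THEN iffD1, rotated]) (use dm in \<open>auto simp: v_def\<close>)
  have "bij_betw v ({1} \<union> ({2..d - m} \<union> {Suc (d - m)..d})) ({a} \<union> (Opp \<union> Same))"
    using part by (intro bij_betw_combine v1 v2 v3) auto
  moreover have "{1} \<union> ({2..d - m} \<union> {Suc (d - m)..d}) = {1..d}" using dm by auto
  ultimately have bij: "bij_betw v {1..d} Q" using part(1) by simp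
  then have vQ: "v ` {1..d} = Q" by (simp add: bij_betw_def)
  have "L (v k * v k) = - standard_signs d m k * L (v 1 * v 1)" if k: "k \<in> {2..d}" for k
  proof (cases "k \<le> d - m")
    case True
    then have "v k \<in> Opp" using v2 k by (auto simp: bij_betw_def)
    then show ?thesis using True by (simp add: Opp_def standard_signs_def v_def)
  next
    case False
    then have "v k \<in> Same" using v3 k by (auto simp: bij_betw_def)
    then show ?thesis using False by (simp add: Same_def standard_signs_def v_def)
  qed
  then show ?thesis using that[of m v] bij Q card vQ by simp
qed

text \<open>Substituting the basis vectors for the variables is the inverse of the change of variables.\<close>

lemma diagonalization:
  assumes d: "2 \<le> d"
  obtains m \<phi> where "m < d" "linear_change d \<phi>"
    "\<forall>I. ideal I (poly_ring d) \<and> {q \<in> quadrics d. L q = 0} \<subseteq> I \<and>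
      I \<subseteq> Idl\<^bsub>poly_ring d\<^esub> {q \<in> quadrics d. L q = 0} \<longrightarrow>
      \<phi> ` I = signed_ideal d (standard_signs d m)"
proof -
  obtain m v where m: "m < d" and v: "bij_betw v {1..d} (v ` {1..d})" "orthonormal (v ` {1..d})"
    "linear_forms d \<subseteq> vec.span (v ` {1..d})"
    and signs: "\<forall>k\<in>{2..d}. L (v k * v k) = - standard_signs d m k * L (v 1 * v 1)"
    by (rule enumerated_basis) (use d in simp)
  have inj: "inj_on v {1..d}" using v(1) by (simp add: bij_betw_def)
  note on = v(2)[unfolded orthonormal_def]
  have vV: "v i \<in> linear_forms d" if "i \<in> {1..d}" for i
    using conjunct1[OF on] imageI[OF that] by (rule subsetD)
  have Lvv: "L (v i * v i) \<noteq> 0" if "i \<in> {1..d}" for i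
    using bspec[OF conjunct1[OF conjunct2[OF on]] imageI[OF that]] by auto
  have Lvw: "L (v i * v j) = 0" if "i \<in> {1..d}" "j \<in> {1..d}" "i \<noteq> j" for i j
  proof -
    have "v i \<noteq> v j" using inj_on_eq_iff[OF inj that(1,2)] that(3) by simp
    then show ?thesis
      using bspec[OF bspec[OF conjunct2[OF conjunct2[OF on]] imageI[OF that(1)]] imageI[OF that(2)]] by simp
  qed
  have polysV: "p \<in> polys d" if "p \<in> linear_forms d" for p :: "real mpoly"
    using linear_forms_polys that by blast
  note V = subspace_linear_forms[of d]
  \<comment> \<open>Variables beyond \<open>d\<close> are fixed, so that \<open>\<psi>\<close> and
    the inverse \<open>\<phi>\<close> constructed below are mutually inverse on the whole
    type.\<close>
  define \<psi> where "\<psi> = subst (\<lambda>i. if i \<in> {1..d} then v i else var i)"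
  have \<psi>_var: "\<psi> (var i) = v i" if "i \<in> {1..d}" for i using that by (simp add: \<psi>_def)
  have \<psi>_add: "\<psi> (p + q) = \<psi> p + \<psi> q" and \<psi>_mult: "\<psi> (p * q) = \<psi> p * \<psi> q"
    and \<psi>_const: "\<psi> (const c) = const c" for p q c
    by (simp_all add: \<psi>_def subst_add subst_mult)
  have \<psi>_polys: "\<psi> p \<in> polys d" if "p \<in> polys d" for p
    unfolding \<psi>_def
  proof (rule subst_closed[OF that])
    fix i assume i: "i \<in> {1..d}"
    then show "(if i \<in> {1..d} then v i else var i) \<in> polys d" using polysV[OF vV[OF i]] by simp
  qed
  \<comment> \<open>The image is a subspace containing the basis, so each variable is the image of a
    linear form. These preimages define the inverse substitution.\<close>
  have "linear_forms d \<subseteq> \<psi> ` linear_forms d"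
  proof -
    have "vec.subspace (\<psi> ` linear_forms d)"
    proof (rule subspace_polysI)
      show "0 \<in> \<psi> ` linear_forms d"
        using \<psi>_const[of 0] vec.subspace_0[OF V] by (intro image_eqI[of _ _ 0]) simp_all
      show "p + q \<in> \<psi> ` linear_forms d" if "p \<in> \<psi> ` linear_forms d" "q \<in> \<psi> ` linear_forms d" for p q
      proof -
        obtain p' q' where "p' \<in> linear_forms d" "p = \<psi> p'" "q' \<in> linear_forms d" "q = \<psi> q'"
          using \<open>p \<in> _\<close> \<open>q \<in> _\<close> by (elim imageE) simp
        then show ?thesis
          using vec.subspace_add[OF V, of p' q'] by (intro image_eqI[of _ _ "p' + q'"]) (simp_all only: \<psi>_add)
      qed
      show "const c * p \<in> \<psi> ` linear_forms d" if "p \<in> \<psi> ` linear_forms d" for c p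
      proof -
        from that obtain q where q: "q \<in> linear_forms d" "p = \<psi> q" by (elim imageE) simp
        then have "const c * p = \<psi> (const c * q)" by (simp add: \<psi>_mult \<psi>_const)
        then show ?thesis using vec.subspace_scale[OF V q(1)] by blast
      qed
    qed
    moreover have "v ` {1..d} \<subseteq> \<psi> ` linear_forms d"
    proof (rule image_subsetI)
      fix i assume "i \<in> {1..d}"
      then show "v i \<in> \<psi> ` linear_forms d"
        using \<psi>_var[of i] by (intro image_eqI[of _ _ "var i"] var_linear_form) simp_all
    qed
    ultimately have "vec.span (v ` {1..d}) \<subseteq> \<psi> ` linear_forms d" by (intro vec.span_minimal)
    then show ?thesis using v(3) by blast
  qed
  then have "\<exists>b. b \<in> linear_forms d \<and> \<psi> b = var i" if "i \<in> {1..d}" for i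
    using subsetD[OF _ var_linear_form[OF that], of "\<psi> ` linear_forms d"] by auto
  then obtain b where b: "\<And>i. i \<in> {1..d} \<Longrightarrow> b i \<in> linear_forms d" "\<And>i. i \<in> {1..d} \<Longrightarrow> \<psi> (b i) = var i"
    by metis
  define \<phi> where "\<phi> = subst (\<lambda>i. if i \<in> {1..d} then b i else var i)"
  have \<phi>_var: "\<phi> (var i) = b i" if "i \<in> {1..d}" for i using that by (simp add: \<phi>_def)
  have \<phi>_add: "\<phi> (p + q) = \<phi> p + \<phi> q" and \<phi>_mult: "\<phi> (p * q) = \<phi> p * \<phi> q"
    and \<phi>_const: "\<phi> (const c) = const c" for p q c
    by (simp_all add: \<phi>_def subst_add subst_mult)
  have \<phi>_polys: "\<phi> p \<in> polys d" if "p \<in> polys d" for p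
    unfolding \<phi>_def
  proof (rule subst_closed[OF that])
    fix i assume i: "i \<in> {1..d}"
    then show "(if i \<in> {1..d} then b i else var i) \<in> polys d" using polysV[OF b(1)[OF i]] by simp
  qed
  have \<psi>\<phi>: "\<psi> (\<phi> p) = p" for p
  proof (induction p rule: mpoly_induct)
    case (var i p)
    have "\<psi> (\<phi> (var i)) = var i"
    proof (cases "i \<in> {1..d}")
      case True
      then show ?thesis using \<phi>_var b(2) by simp
    next
      case False
      then show ?thesis unfolding \<psi>_def \<phi>_def by (simp only: subst_var if_False)
    qed
    then show ?case using var by (simp add: \<phi>_mult \<psi>_mult)
  qed (simp_all add: \<phi>_const \<psi>_const \<phi>_add \<psi>_add)
  have \<phi>_linear: "\<phi> p \<in> linear_forms d" if "p \<in> linear_forms d" for p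
  proof -
    have "linear_forms d \<subseteq> {p. \<phi> p \<in> linear_forms d}"
    proof (rule linear_forms_subset_subspace, rule subspace_polysI)
      show "0 \<in> {p. \<phi> p \<in> linear_forms d}"
        using \<phi>_const[of 0] vec.subspace_0[OF V] by simp
    qed (simp_all add: \<phi>_add \<phi>_mult \<phi>_const vec.subspace_add[OF V] vec.subspace_scale[OF V] \<phi>_var b)
    then show ?thesis using that by blast
  qed
  \<comment> \<open>Pairing \<open>\<psi> p\<close> with \<open>v k\<close> isolates the
    \<open>k\<close>-th coefficient of \<open>p\<close>, because the basis is orthogonal and
    \<open>L (v k * v k)\<close> is nonzero.\<close>
  have \<psi>_kernel: "p = 0" if p: "p \<in> linear_forms d" "\<psi> p = 0" for p
  proof -
    define c where "c i = coef p (unit_exp i)" for i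
    have pc: "p = (\<Sum>i\<in>{1..d}. const (c i) * var i)" unfolding c_def by (rule linear_form_eq[OF p(1)])
    have "\<psi> p = (\<Sum>i\<in>{1..d}. \<psi> (const (c i) * var i))" unfolding pc \<psi>_def by (rule subst_sum)
    also have "\<dots> = (\<Sum>i\<in>{1..d}. const (c i) * v i)"
      by (rule sum.cong) (simp_all add: \<psi>_mult \<psi>_const \<psi>_var)
    finally have z: "(\<Sum>i\<in>{1..d}. const (c i) * v i) = 0" using p(2) by simp
    have "c k = 0" if k: "k \<in> {1..d}" for k
    proof -
      have "0 = L (v k * (\<Sum>i\<in>{1..d}. const (c i) * v i))" unfolding z by (simp add: L_0)
      also have "\<dots> = (\<Sum>i\<in>{1..d}. c i * L (v k * v i))"
        by (simp only: sum_distrib_left L_sum mult.left_commute[of "v k"] L_scale)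
      also have "\<dots> = (\<Sum>i\<in>{1..d}. if i = k then c k * L (v k * v k) else 0)"
        by (rule sum.cong) (use Lvw k in auto)
      also have "\<dots> = c k * L (v k * v k)" using k by simp
      finally show ?thesis using Lvv[OF k] by simp
    qed
    then show ?thesis unfolding pc by simp
  qed
  have \<phi>\<psi>: "\<phi> (\<psi> p) = p" for p
  proof (induction p rule: mpoly_induct)
    case (var i p)
    have "\<phi> (\<psi> (var i)) = var i"
    proof (cases "i \<in> {1..d}")
      case True
      have "\<phi> (v i) + const (-1) * var i \<in> linear_forms d"
        using True by (intro vec.subspace_add[OF V] vec.subspace_scale[OF V] \<phi>_linear vV var_linear_form)
      moreover have "\<psi> (\<phi> (v i) + const (-1) * var i) = 0"
        unfolding \<psi>_add \<psi>\<phi> \<psi>_mult \<psi>_const \<psi>_var[OF True] by (simp add: const_uminus)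
      ultimately have "\<phi> (v i) + const (-1) * var i = 0" by (rule \<psi>_kernel)
      then show ?thesis using \<psi>_var[OF True] by (simp add: const_uminus)
    next
      case False
      then show ?thesis unfolding \<psi>_def \<phi>_def by (simp only: subst_var if_False)
    qed
    then show ?case using var by (simp add: \<phi>_mult \<psi>_mult)
  qed (simp_all add: \<phi>_const \<psi>_const \<phi>_add \<psi>_add)
  have change: "linear_change d \<phi>"
    unfolding linear_change_def
  proof (intro conjI allI)
    have "bij_betw \<phi> (polys d) (polys d)"
      by (rule bij_betw_byWitness[of _ \<psi>]) (auto simp: \<phi>\<psi> \<psi>\<phi> \<phi>_polys \<psi>_polys)
    then show "\<phi> \<in> ring_iso (poly_ring d) (poly_ring d)"
      using \<phi>_const[of 1]
      by (intro ring_iso_memI) (simp_all add: \<phi>_add \<phi>_mult \<phi>_polys)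
    show "\<phi> (const c) = const c" for c by (rule \<phi>_const)
    show "\<exists>a. \<forall>i\<in>{1..d}. \<phi> (var i) = (\<Sum>j\<in>{1..d}. const (a i j) * var j)"
      using linear_form_eq[OF b(1)] \<phi>_var
      by (intro exI[of _ "\<lambda>i j. coef (b i) (unit_exp j)"]) simp
  qed
  let ?\<epsilon> = "standard_signs d m :: nat \<Rightarrow> real"
  interpret sign_ideal d ?\<epsilon>
    by unfold_locales (use d in \<open>auto simp: sign_choice_def standard_signs_def\<close>)
  have Le: "L (v i * v i) = L (v 1 * v 1) * e i" if "i \<in> {1..d}" for i
  proof (cases "i = 1")
    case False
    then have "i \<in> {2..d}" using that by auto
    then show ?thesis using signs False by (simp add: e_def)
  qed simp
  \<comment> \<open>In the new variables both functionals are diagonal with proportional entries, so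
    their kernels on quadrics correspond. The factor \<open>L (v 1 * v 1)\<close> absorbs the
    overall sign of the form.\<close>
  have L\<psi>: "L (\<psi> q) = L (v 1 * v 1) * s q" if "q \<in> quadrics d" for q
  proof -
    have "quadrics d \<subseteq> {q. L (\<psi> q) = L (v 1 * v 1) * s q}" (is "_ \<subseteq> ?W")
    proof (rule quadrics_subset_subspace, rule subspace_polysI)
      show "0 \<in> ?W"
        using \<psi>_const[of 0] square_functional_const[of d e 0] by (simp add: L_0)
      show "p + q \<in> ?W"
        if "p \<in> ?W" "q \<in> ?W" for p q
        using that by (simp add: \<psi>_add L_add square_functional_add distrib_left)
      show "const c * p \<in> ?W"
        if "p \<in> ?W" for c p
        using that by (simp add: \<psi>_mult \<psi>_const L_scale square_functional_scale)
      show "var i * var j \<in> ?W" if "i \<in> {1..d}" "j \<in> {1..d}" for i j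
        using that square_functional_var_mult[OF that(1), of e "var j"] Le[of i] Lvw[of i j]
        by (cases "i = j") (simp_all add: \<psi>_mult \<psi>_var)
    qed
    then show ?thesis using that by blast
  qed
  have \<psi>_quadrics: "\<psi> q \<in> quadrics d" if "q \<in> quadrics d" for q
  proof -
    have "quadrics d \<subseteq> {q. \<psi> q \<in> quadrics d}"
    proof (rule quadrics_subset_subspace, rule subspace_polysI)
      show "0 \<in> {q. \<psi> q \<in> quadrics d}" using \<psi>_const[of 0] vec.subspace_0[OF subspace_quadrics] by simp
    qed (simp_all add: \<psi>_add \<psi>_mult \<psi>_const \<psi>_var linear_forms_mult vV
        vec.subspace_add[OF subspace_quadrics] vec.subspace_scale[OF subspace_quadrics])
    then show ?thesis using that by blast
  qed
  have \<phi>_quadrics: "\<phi> q \<in> quadrics d" if "q \<in> quadrics d" for q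
  proof -
    have "quadrics d \<subseteq> {q. \<phi> q \<in> quadrics d}"
    proof (rule quadrics_subset_subspace, rule subspace_polysI)
      show "0 \<in> {q. \<phi> q \<in> quadrics d}" using \<phi>_const[of 0] vec.subspace_0[OF subspace_quadrics] by simp
    qed (simp_all add: \<phi>_add \<phi>_mult \<phi>_const \<phi>_var linear_forms_mult b
        vec.subspace_add[OF subspace_quadrics] vec.subspace_scale[OF subspace_quadrics])
    then show ?thesis using that by blast
  qed
  \<comment> \<open>Both inclusions are checked on generators: \<open>\<phi>\<close> sends quadrics
    killed by \<open>L\<close> into the ideal with signs, and \<open>\<psi>\<close> sends the
    generators of that ideal to quadrics killed by \<open>L\<close>.\<close>
  have "\<phi> ` I = signed_ideal d ?\<epsilon>"
    if I: "ideal I (poly_ring d)" and LI: "{q \<in> quadrics d. L q = 0} \<subseteq> I"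
      and gen: "I \<subseteq> Idl\<^bsub>poly_ring d\<^esub> {q \<in> quadrics d. L q = 0}" for I
  proof
    have "Idl\<^bsub>poly_ring d\<^esub> {q \<in> quadrics d. L q = 0} \<subseteq> {p \<in> polys d. \<phi> p \<in> signed_ideal d ?\<epsilon>}" (is "_ \<subseteq> ?W")
    proof (rule poly.genideal_minimal)
      show "ideal ?W (poly_ring d)"
        by (rule ideal_vimage_poly[OF ideal_signed \<phi>_polys \<phi>_add \<phi>_mult])
      show "{q \<in> quadrics d. L q = 0} \<subseteq> ?W"
      proof
        fix q assume "q \<in> {q \<in> quadrics d. L q = 0}"
        then have q: "q \<in> quadrics d" "L q = 0" by auto
        have "L (v 1 * v 1) * s (\<phi> q) = 0" using L\<psi>[OF \<phi>_quadrics[OF q(1)]] q(2) by (simp add: \<psi>\<phi>)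
        then have "s (\<phi> q) = 0" using Lvv[of 1] d by simp
        moreover have "\<phi> q \<in> polys d" "quadric (\<phi> q)"
          using \<phi>_quadrics[OF q(1)] by (simp_all add: quadrics_def)
        ultimately have "\<phi> q \<in> signed_ideal d ?\<epsilon>"
          by (intro signedI quadric_coefs)
        then show "q \<in> ?W" using q(1) by (simp add: quadrics_def)
      qed
    qed
    then show "\<phi> ` I \<subseteq> signed_ideal d ?\<epsilon>" using gen by blast
    have "signed_ideal d ?\<epsilon> \<subseteq> {p \<in> polys d. \<psi> p \<in> I}" (is "_ \<subseteq> ?W")
      unfolding signed_ideal_def
    proof (rule poly.genideal_minimal)
      show "ideal ?W (poly_ring d)"
        by (rule ideal_vimage_poly[OF I \<psi>_polys \<psi>_add \<psi>_mult])
      show "gens \<subseteq> ?W"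
      proof
        fix p assume p: "p \<in> gens"
        have "p \<in> signed_ideal d ?\<epsilon>" using p gens_signed by (rule rev_subsetD)
        then have sp: "s p = 0" by (rule tr_I)
        from p consider i j where "1 \<le> i" "i < j" "j \<le> d" "p = var i * var j"
          | k where "2 \<le> k" "k \<le> d" "p = var 1 ^ 2 + const (?\<epsilon> k) * var k ^ 2"
          by blast
        then have pq: "p \<in> quadrics d"
        proof cases
          case 1
          then show ?thesis by (simp add: linear_forms_mult)
        next
          case 2
          then show ?thesis
            unfolding 2(3) power2_eq_square
            by (intro vec.subspace_add[OF subspace_quadrics] vec.subspace_scale[OF subspace_quadrics]
              linear_forms_mult var_linear_form) auto
        qed
        then have "L (\<psi> p) = 0" using L\<psi> sp by simp
        then have "\<psi> p \<in> I" using LI \<psi>_quadrics[OF pq] by blast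
        then show "p \<in> ?W" using pq by (simp add: quadrics_def)
      qed
    qed
    then have "p = \<phi> (\<psi> p) \<and> \<psi> p \<in> I" if "p \<in> signed_ideal d ?\<epsilon>" for p using that \<phi>\<psi> by auto
    then show "signed_ideal d ?\<epsilon> \<subseteq> \<phi> ` I" by blast
  qed
  then show ?thesis by (intro that[OF m change] allI impI) blast
qed

end

section \<open>The classification over the real numbers\<close>

lemma classification:
  fixes I :: "real mpoly set"
  assumes d: "2 \<le> d"
    and min: "minimally_generates (poly_ring d) S I" and fin: "finite S"
    and card: "card S = vec.dim (quadrics d :: real mpoly set) - 1"
    and quad: "\<And>q. q \<in> S \<Longrightarrow> quadric q"
    and gor: "gorenstein_ideal (poly_ring d) I"
  shows "\<exists>m<d. \<exists>\<phi>. linear_change d \<phi> \<and> \<phi> ` I = signed_ideal d (standard_signs d m)"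
proof -
  have S: "S \<subseteq> polys d" "Idl\<^bsub>poly_ring d\<^esub> S = I" "\<And>T. T \<subset> S \<Longrightarrow> Idl\<^bsub>poly_ring d\<^esub> T \<noteq> I"
    using min by (auto simp: minimally_generates_def)
  have I: "ideal I (poly_ring d)" using poly.genideal_ideal[OF S(1)] S(2) by simp
  have SI: "S \<subseteq> I" using poly.genideal_self[OF S(1)] S(2) by simp
  have SQ: "S \<subseteq> quadrics d" using S(1) quad by (auto simp: quadrics_def)
  \<comment> \<open>A generator in the linear span of the others lies in the ideal they generate,
    against minimality.\<close>
  have ind: "vec.independent S"
  proof
    assume "vec.dependent S"
    then obtain a where a: "a \<in> S" "a \<in> vec.span (S - {a})" unfolding vec.dependent_def by blast
    have T: "S - {a} \<subseteq> polys d" using S(1) by blast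
    note J = poly.genideal_ideal[OF T]
    have "a \<in> Idl\<^bsub>poly_ring d\<^esub> (S - {a})"
      using span_subset_ideal[OF J poly.genideal_self[OF T]] a(2) by blast
    then have "S \<subseteq> Idl\<^bsub>poly_ring d\<^esub> (S - {a})" using poly.genideal_self[OF T] by blast
    then have "I \<subseteq> Idl\<^bsub>poly_ring d\<^esub> (S - {a})"
      unfolding S(2)[symmetric] by (rule poly.genideal_minimal[OF J])
    moreover have "Idl\<^bsub>poly_ring d\<^esub> (S - {a}) \<subseteq> I"
      using SI by (intro poly.genideal_minimal[OF I]) auto
    ultimately show False using S(3)[of "S - {a}"] a(1) by blast
  qed
  \<comment> \<open>With truncated subtraction, \<open>S\<close> has fewer elements than a basis of
    the quadrics only if the dimension is positive.\<close>
  have pos: "0 < vec.dim (quadrics d :: real mpoly set)"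
  proof (rule ccontr)
    assume "\<not> 0 < vec.dim (quadrics d :: real mpoly set)"
    obtain B :: "real mpoly set" where B: "B \<subseteq> quadrics d" "vec.independent B"
      "quadrics d \<subseteq> vec.span B" "card B = vec.dim (quadrics d :: real mpoly set)"
      by (rule vec.basis_exists)
    have "finite B"
      using vec.independent_span_bound[OF finite_products[of d] B(2)] B(1) quadrics_eq_span by blast
    then have "B = {}" using B(4) \<open>\<not> 0 < _\<close> by simp
    then have "var 1 * var 1 = (0 :: real mpoly)"
      using B(3) var_mult_quadrics[of 1 d 1] d by auto
    then have "coef (var 1 * var 1 :: real mpoly) (monom 1 2) = 0" by simp
    then show False by (simp add: coef_mult_square)
  qed
  have "\<not> quadrics d \<subseteq> vec.span S" using vec.dim_le_card[OF _ fin, of "quadrics d"] card pos by auto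
  then obtain x where x: "x \<in> quadrics d" "x \<notin> vec.span S" by blast
  have xS: "x \<notin> S" using x(2) vec.span_base by blast
  have ind': "vec.independent (insert x S)" by (rule vec.independent_insertI[OF x(2) ind])
  \<comment> \<open>A quadric independent of \<open>insert x S\<close> would give more independent
    quadrics than the dimension allows.\<close>
  have span: "quadrics d \<subseteq> vec.span (insert x S)"
  proof (rule ccontr)
    assume "\<not> quadrics d \<subseteq> vec.span (insert x S)"
    then obtain y where y: "y \<in> quadrics d" "y \<notin> vec.span (insert x S)" by blast
    have "vec.independent (insert y (insert x S))" by (rule vec.independent_insertI[OF y(2) ind'])
    obtain B :: "real mpoly set" where B: "B \<subseteq> quadrics d" "vec.independent B"
      "quadrics d \<subseteq> vec.span B" "card B = vec.dim (quadrics d :: real mpoly set)"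
      by (rule vec.basis_exists)
    have "finite B"
      using vec.independent_span_bound[OF finite_products[of d] B(2)] B(1) quadrics_eq_span by blast
    then have "card (insert y (insert x S)) \<le> card B"
      using vec.independent_span_bound[of B "insert y (insert x S)"] B(3) x(1) y(1) SQ
        \<open>vec.independent (insert y (insert x S))\<close> by blast
    moreover have "y \<notin> insert x S" using y(2) vec.span_base by blast
    ultimately show False using fin xS card B(4) by simp
  qed
  \<comment> \<open>The functional is defined on all polynomials, but its zeros are controlled only
    on the span of \<open>insert x S\<close>, which contains the quadrics.\<close>
  obtain L :: "real mpoly \<Rightarrow> real" where L: "\<forall>p q. L (p + q) = L p + L q"
    "\<forall>c p. L (const c * p) = c * L p"
    "\<forall>p\<in>vec.span (insert x S). L p = 0 \<longleftrightarrow> p \<in> vec.span S"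
    by (rule functional_vanishing_exactly_on_span[OF ind x(2)])
  have LI: "q \<in> I" if "q \<in> quadrics d" "L q = 0" for q
    using L(3) that span span_subset_ideal[OF I SI] by blast
  have SL: "L q = 0" if "q \<in> S" for q
    using L(3) vec.span_base[OF that] vec.span_mono[of S "insert x S"] by blast
  have low: "I \<subseteq> no_linear_part d"
    unfolding S(2)[symmetric]
  proof (rule poly.genideal_minimal[OF ideal_no_linear_part])
    show "S \<subseteq> no_linear_part d"
      using S(1) quadric_coefs[OF quad] by (auto simp: no_linear_part_def)
  qed
  \<comment> \<open>The Gorenstein property enters here: a nonzero \<open>u\<close> in the radical
    of the form has all its products with variables in \<open>I\<close>.\<close>
  interpret quadratic_form d L
  proof (unfold_locales, goal_cases)
    case (3 u)
    show ?case
    proof (rule ccontr)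
      assume "u \<noteq> 0"
      have "\<exists>i. coef u (unit_exp i) \<noteq> 0"
      proof (rule ccontr)
        assume "\<not> (\<exists>i. coef u (unit_exp i) \<noteq> 0)"
        then have "u = 0" using linear_form_eq[OF 3(1)] by simp
        then show False using \<open>u \<noteq> 0\<close> by simp
      qed
      then obtain i where i: "coef u (unit_exp i) \<noteq> 0" by blast
      obtain j where j: "j \<in> {1..d}" "j \<noteq> i"
        using d by (cases "i = 1") (auto intro: that[of 1] that[of 2])
      have "u * var j \<in> I" if "j \<in> {1..d}" for j
        using that 3 by (intro LI linear_forms_mult) auto
      moreover have "coef p 0 = 0" "coef p (unit_exp k) = 0" if "p \<in> I" for p k
        using low that by (auto simp: no_linear_part_def)
      moreover have "u \<in> polys d" using 3(1) linear_forms_polys by blast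
      ultimately have "\<not> gorenstein_ideal (poly_ring d) I"
        using not_gorenstein_ideal[OF I, of u i j] linear_form_coef_0[OF 3(1)] i j by blast
      then show False using gor by blast
    qed
  qed (simp_all add: L(1,2))
  obtain m \<phi> where m: "m < d" "linear_change d \<phi>"
    "\<forall>I. ideal I (poly_ring d) \<and> {q \<in> quadrics d. L q = 0} \<subseteq> I \<and>
      I \<subseteq> Idl\<^bsub>poly_ring d\<^esub> {q \<in> quadrics d. L q = 0} \<longrightarrow>
      \<phi> ` I = signed_ideal d (standard_signs d m)"
    by (rule diagonalization[OF d])
  have "{q \<in> quadrics d. L q = 0} \<subseteq> polys d" by (auto simp: quadrics_def)
  moreover have "S \<subseteq> {q \<in> quadrics d. L q = 0}" using SQ SL by blast
  ultimately have "I \<subseteq> Idl\<^bsub>poly_ring d\<^esub> {q \<in> quadrics d. L q = 0}"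
    unfolding S(2)[symmetric] by (rule poly.subset_Idl_subset)
  then have "\<phi> ` I = signed_ideal d (standard_signs d m)" using m(3) I LI by blast
  then show ?thesis using m(1,2) by blast
qed

theorem theorem3p1:
  fixes d :: nat
  assumes "d \<ge> 3"
  shows
    "(\<forall>I :: real mpoly set.
        ideal I (poly_ring d) \<and>
        codimension (poly_ring d) I = enat d \<and>
        (\<exists>S. minimally_generates (poly_ring d) S I \<and> finite S \<and>
          card S = min_num_gens (poly_ring d :: real mpoly ring)
            (ideal_prod (poly_ring d) (irrelevant_ideal d) (irrelevant_ideal d)) - 1 \<and>
          (\<forall>q\<in>S. quadric q)) \<and>
        gorenstein_ideal (poly_ring d) I \<longrightarrow>
        (\<exists>m<d. \<exists>\<phi>. linear_change d \<phi> \<and> \<phi> ` I = signed_ideal d (standard_signs d m)))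
     \<and>
     (\<forall>\<epsilon> :: nat \<Rightarrow> 'k::field.
        sign_choice d \<epsilon> \<longrightarrow> gorenstein_ideal (poly_ring d) (signed_ideal d \<epsilon>))"
proof (intro conjI allI impI)
  fix I :: "real mpoly set"
  assume "ideal I (poly_ring d) \<and>
        codimension (poly_ring d) I = enat d \<and>
        (\<exists>S. minimally_generates (poly_ring d) S I \<and> finite S \<and>
          card S = min_num_gens (poly_ring d :: real mpoly ring)
            (ideal_prod (poly_ring d) (irrelevant_ideal d) (irrelevant_ideal d)) - 1 \<and>
          (\<forall>q\<in>S. quadric q)) \<and>
        gorenstein_ideal (poly_ring d) I"
  then obtain S where "minimally_generates (poly_ring d) S I" "finite S"
    "card S = vec.dim (quadrics d :: real mpoly set) - 1" "\<forall>q\<in>S. quadric q"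
    "gorenstein_ideal (poly_ring d) I"
    unfolding min_num_gens_irrelevant_square by blast
  then show "\<exists>m<d. \<exists>\<phi>. linear_change d \<phi> \<and> \<phi> ` I = signed_ideal d (standard_signs d m)"
    using assms by (intro classification[of d S I]) auto
next
  fix \<epsilon> :: "nat \<Rightarrow> 'k" assume "sign_choice d \<epsilon>"
  then interpret sign_ideal d \<epsilon> using assms by unfold_locales auto
  show "gorenstein_ideal (poly_ring d) (signed_ideal d \<epsilon>)" by (rule gorenstein)
qed

end
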